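(* Let $D$ and $G$ be bounded domains in $\mathbb C^n$ and let $f:D\to G$ be a proper holomorphic mapping extending continuously to $\overline D$ (the extension is still denoted by $f$). Assume that there is an increasing family (sequence) of domains $\{G_m\}$, $G_m\Subset G_{m+1}$, such that $\bigcup_m G_m=G$ and $\overline{\left(\bigcup_m \partial_s G_m\right)}\cap\partial G=\partial_s G$. Then $f(\partial_s D)=\partial_s G$.
   Context: For a bounded open set $D\subset\mathbb C^n$, the Shilov boundary $\partial_s D$ is the smallest closed subset $S$ of $\overline D$ such that $\max_{\overline D}|h|=\max_{S}|h|$ for every $h\in\mathcal O(D)\cap\mathcal C(\overline D)$. The notation $A\Subset B$ means that $A$ is relatively compact in $B$. *)

theory Defs
  imports "HOL-Analysis.Analysis"
begin

definition domain_Cn :: "(complex ^ 'n) set \<Rightarrow> bool"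
  where "domain_Cn D \<longleftrightarrow> open D \<and> connected D \<and> D \<noteq> {}"

(* Holomorphy in several variables: real Frechet differentiability at each point of the
   (open) set, with a complex-linear derivative; additivity is part of has_derivative. *)
definition holomorphic_Cn :: "(complex ^ 'n \<Rightarrow> complex) \<Rightarrow> (complex ^ 'n) set \<Rightarrow> bool"
  where "holomorphic_Cn h D \<longleftrightarrow>
    (\<forall>z\<in>D. \<exists>L. (h has_derivative L) (at z) \<and> (\<forall>c v. L (c *s v) = c * L v))"

definition holomorphic_map_Cn :: "(complex ^ 'n \<Rightarrow> complex ^ 'm) \<Rightarrow> (complex ^ 'n) set \<Rightarrow> bool"
  where "holomorphic_map_Cn f D \<longleftrightarrow> (\<forall>i. holomorphic_Cn (\<lambda>z. f z $ i) D)"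

(* The library's proper_map asks for a closed map with compact fibres, and for f to map D
   into G; the lemma below shows that this is the usual condition on preimages of compacta. *)
definition proper_holomorphic_map ::
    "(complex ^ 'n) set \<Rightarrow> (complex ^ 'm) set \<Rightarrow> (complex ^ 'n \<Rightarrow> complex ^ 'm) \<Rightarrow> bool"
  where "proper_holomorphic_map D G f \<longleftrightarrow>
    holomorphic_map_Cn f D \<and> proper_map (top_of_set D) (top_of_set G) f"

lemma proper_map_top_of_set_iff:
  fixes D :: "(complex ^ 'n) set" and G :: "(complex ^ 'm) set"
  shows "proper_map (top_of_set D) (top_of_set G) f \<longleftrightarrow>
    f ` D \<subseteq> G \<and> (\<forall>K. compact K \<and> K \<subseteq> G \<longrightarrow> compact {z \<in> D. f z \<in> K})"
    (is "?L \<longleftrightarrow> ?R")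
proof -
  have k: "k_space (top_of_set G)"
    by (intro metrizable_imp_k_space) (simp add: metrizable_space_subtopology metrizable_space_euclidean)
  have kc: "kc_space (top_of_set D)" "kc_space (top_of_set G)"
    by (simp_all add: Hausdorff_imp_kc_space Hausdorff_space_subtopology)
  show ?thesis
  proof
    assume L: ?L
    then have "f ` D \<subseteq> G"
      using proper_map_imp_subset_topspace by fastforce
    with L show ?R
      using compactin_proper_map_preimage[OF L] by (auto simp: compactin_subtopology)
  next
    assume R: ?R
    then show ?L
      by (intro compact_imp_proper_map) (use k kc in \<open>auto simp: compactin_subtopology\<close>)
  qed
qed

(* The maxima are suprema of continuous functions over nonempty compact sets when D is
   bounded and nonempty. S \<noteq> {} is the implicit condition for the maximum over S to exist. *)
definition max_modulus_set :: "(complex ^ 'n) set \<Rightarrow> (complex ^ 'n) set \<Rightarrow> bool"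
  where "max_modulus_set D S \<longleftrightarrow>
    closed S \<and> S \<subseteq> closure D \<and> S \<noteq> {} \<and>
    (\<forall>h. holomorphic_Cn h D \<and> continuous_on (closure D) h \<longrightarrow>
      (SUP z\<in>closure D. norm (h z)) = (SUP z\<in>S. norm (h z)))"

(* Sets are ordered by inclusion, so LEAST is the smallest such S; for bounded nonempty open D
   it exists by Shilov's theorem, as the coordinate functions separate the points of closure D. *)
definition shilov_boundary :: "(complex ^ 'n) set \<Rightarrow> (complex ^ 'n) set"
  where "shilov_boundary D = (LEAST S. max_modulus_set D S)"

definition relatively_compact_in :: "'a::topological_space set \<Rightarrow> 'a set \<Rightarrow> bool"
  where "relatively_compact_in A B \<longleftrightarrow> compact (closure A) \<and> closure A \<subseteq> B"

end

theory Submission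
  imports Defs "HOL-Complex_Analysis.Complex_Analysis"
begin

text \<open>
  One inclusion is easy: \<open>f\<close> maps \<open>D\<close> onto \<open>G\<close>, so if \<open>h\<close> is admissible on \<open>G\<close>, then \<open>h \<circ> f\<close>
  attains its maximum modulus on the Shilov boundary of \<open>D\<close>, whose image is therefore a maximum
  modulus set of \<open>G\<close>.

  For the other one, the part of the closure of \<open>D\<close> that \<open>f\<close> maps into the Shilov boundary of \<open>G\<close>
  is shown to be a maximum modulus set of \<open>D\<close>. The sums of \<open>g h\<^sup>k\<close> over the fibres of \<open>f\<close> are
  holomorphic on \<open>G\<close>, hence bounded on \<open>G\<^sub>m\<close> by their maximum on the Shilov boundary of \<open>G\<^sub>m\<close>;
  letting \<open>k\<close> tend to infinity bounds \<open>h\<close> above \<open>G\<^sub>m\<close> by its values near the fibres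
  above that Shilov boundary. A limit \<open>m \<rightarrow> \<infinity>\<close> gives points of the closure of \<open>D\<close> that
  lie above the Shilov boundary of \<open>G\<close>.

  To avoid the theory of branched coverings, the sum of \<open>H\<close> over the fibre above \<open>w\<close> is replaced by the
  integral of \<open>H \<cdot> \<phi>(s (f - w)) \<cdot> \<bar>det (s f')\<bar>\<^sup>2\<close> over \<open>D\<close>, where \<open>\<phi>\<close> is a radial bump function. Stokes' theorem
  shows that it depends holomorphically on \<open>w\<close> and does not depend on \<open>s\<close>, and that it is invariant
  under perturbations of \<open>f\<close> when \<open>H = 1\<close>; the latter implies that the Jacobian determinant does not vanish
  identically. By Sard's theorem almost all fibres are regular and hence finite, and there the
  limit \<open>s \<rightarrow> \<infinity>\<close> separates the points of the fibre.
\<close>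

section \<open>Holomorphic functions of several variables\<close>

text \<open>Stokes' theorem controls only half of a variation. The factors H and det F' are
  holomorphic and pass through d-bar, so the derivative of the integral in the conjugate parameter
  is the integral of an exact form; the derivative in the parameter itself is not accessible in this
  way. For a translation in w this half is enough, since its vanishing is holomorphy. For H = 1 the
  other half is its complex conjugate and vanishes as well. For the scale s the variation is real,
  so both halves agree for every H.

  The scale has to be at least 1/e, where the closed ball of radius e about w lies in G: this is how
  properness makes the integrand compactly supported in D. One scale must serve the whole closure of
  the set on which the maximum principle is applied, and no single scale works up to the boundary of
  G. Hence the relatively compact exhaustion, and hence values of h near the fibres over the Shilov
  boundary of an exhausting set, not on them.\<close>

definition pd :: "'n::finite \<Rightarrow> (complex^'n \<Rightarrow> complex) \<Rightarrow> complex^'n \<Rightarrow> complex"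
  where "pd k h z = deriv (\<lambda>\<zeta>. h (z + axis k \<zeta>)) 0"

lemma bounded_linear_vector_scalar_mult_left:
  "bounded_linear (\<lambda>\<zeta>::complex. \<zeta> *s (v :: complex^'n))"
proof (rule linear_conv_bounded_linear[THEN iffD1], rule linearI)
  fix a b :: complex and r :: real
  show "(a + b) *s v = a *s v + b *s v"
    by (simp add: vec_eq_iff algebra_simps)
  show "(r *\<^sub>R a) *s v = r *\<^sub>R (a *s v)"
    by (simp add: vec_eq_iff)
qed

lemma axis_conv_smult: "axis k \<zeta> = (\<zeta>::complex) *s (axis k 1 :: complex^'n)"
  by (simp add: vec_eq_iff axis_def)

lemma bounded_linear_axis: "bounded_linear (axis k :: complex \<Rightarrow> complex^'n)"
proof -
  have "(axis k :: complex \<Rightarrow> complex^'n) = (\<lambda>\<zeta>. \<zeta> *s axis k 1)"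
    by (rule ext) (rule axis_conv_smult)
  then show ?thesis
    using bounded_linear_vector_scalar_mult_left[of "axis k 1 :: complex^'n"] by metis
qed

lemma norm_axis_complex [simp]: "norm (axis k \<zeta> :: complex^'n) = norm \<zeta>" for \<zeta> :: complex
  by (simp add: norm_eq_sqrt_inner inner_axis_axis)

text \<open>Complex linearity makes \<open>L\<close> the map determined by its values on the
  coordinate axes, and those are the slice derivatives.\<close>

lemma holomorphic_has_derivative:
  fixes h :: "complex^'n \<Rightarrow> complex"
  assumes "holomorphic_Cn h D" "z \<in> D"
  shows "(h has_derivative (\<lambda>v. \<Sum>k\<in>UNIV. pd k h z * v$k)) (at z)"
proof -
  obtain L where L: "(h has_derivative L) (at z)" and lin: "\<And>c v. L (c *s v) = c * L v"
    using assms unfolding holomorphic_Cn_def by blast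
  have pd: "pd k h z = L (axis k 1)" for k
  proof -
    have "((\<lambda>\<zeta>. z + axis k \<zeta>) has_derivative axis k) (at 0)"
      by (auto intro!: derivative_eq_intros bounded_linear.has_derivative[OF bounded_linear_axis])
    then have "((\<lambda>\<zeta>. h (z + axis k \<zeta>)) has_derivative (\<lambda>\<zeta>. L (axis k \<zeta>))) (at 0)"
      by (rule has_derivative_compose) (use L in \<open>simp add: axis_def zero_vec_def[symmetric]\<close>)
    moreover have "(\<lambda>\<zeta>. L (axis k \<zeta>)) = (*) (L (axis k 1))"
    proof
      fix \<zeta> show "L (axis k \<zeta>) = L (axis k 1) * \<zeta>"
        by (metis axis_conv_smult lin mult.commute)
    qed
    ultimately have "((\<lambda>\<zeta>. h (z + axis k \<zeta>)) has_field_derivative L (axis k 1)) (at 0)"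
      unfolding has_field_derivative_def by metis
    then show ?thesis
      by (simp add: pd_def DERIV_imp_deriv)
  qed
  have "L v = (\<Sum>k\<in>UNIV. pd k h z * v$k)" for v
  proof -
    have "L v = L (\<Sum>k\<in>UNIV. (v$k) *s axis k 1)"
      by (simp add: basis_expansion)
    also have "\<dots> = (\<Sum>k\<in>UNIV. L ((v$k) *s axis k 1))"
      using has_derivative_linear[OF L] by (rule linear_sum)
    finally show ?thesis
      by (simp add: lin pd mult.commute)
  qed
  then have "L = (\<lambda>v. \<Sum>k\<in>UNIV. pd k h z * v$k)"
    by (rule ext)
  with L show ?thesis
    by simp
qed

lemma holomorphic_CnI:
  assumes "\<And>z. z \<in> D \<Longrightarrow> (h has_derivative (\<lambda>v. \<Sum>k\<in>UNIV. c z k * v$k)) (at z)"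
  shows "holomorphic_Cn h D"
  unfolding holomorphic_Cn_def
proof
  fix z assume "z \<in> D"
  then show "\<exists>L. (h has_derivative L) (at z) \<and> (\<forall>c v. L (c *s v) = c * L v)"
    by (intro exI[of _ "\<lambda>v. \<Sum>k\<in>UNIV. c z k * v$k"])
      (use assms in \<open>auto simp: sum_distrib_left mult_ac intro!: sum.cong\<close>)
qed

lemma pd_eqI:
  assumes "(h has_derivative (\<lambda>v. \<Sum>k\<in>UNIV. c k * v$k)) (at z)"
  shows "pd j h z = c j"
proof -
  have hol: "holomorphic_Cn h {z}"
    by (rule holomorphic_CnI[where c = "\<lambda>_. c"]) (use assms in auto)
  have "(\<lambda>v. \<Sum>k\<in>UNIV. pd k h z * v$k) = (\<lambda>v. \<Sum>k\<in>UNIV. c k * v$k)"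
    using has_derivative_unique[OF holomorphic_has_derivative[OF hol] assms] by simp
  from fun_cong[OF this, of "axis j 1"] show ?thesis
    by (simp add: axis_def if_distrib cong: if_cong)
qed

lemma holomorphic_Cn_subset: "holomorphic_Cn h D \<Longrightarrow> E \<subseteq> D \<Longrightarrow> holomorphic_Cn h E"
  by (auto simp: holomorphic_Cn_def)

lemma holomorphic_Cn_continuous_on: "holomorphic_Cn h D \<Longrightarrow> continuous_on D h"
  using holomorphic_has_derivative has_derivative_continuous
  by (blast intro: continuous_at_imp_continuous_on)

section \<open>Restriction to complex lines and Cauchy's formula\<close>

lemma holomorphic_Cn_line:
  assumes "holomorphic_Cn h D" "z + \<zeta> *s v \<in> D"
  shows "((\<lambda>\<zeta>. h (z + \<zeta> *s v)) has_field_derivative (\<Sum>k\<in>UNIV. pd k h (z + \<zeta> *s v) * v$k)) (at \<zeta>)"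
proof -
  have "((\<lambda>\<zeta>. z + \<zeta> *s v) has_derivative (\<lambda>\<zeta>. \<zeta> *s v)) (at \<zeta>)"
    by (auto intro!: derivative_eq_intros bounded_linear.has_derivative[OF bounded_linear_vector_scalar_mult_left])
  from has_derivative_compose[OF this holomorphic_has_derivative[OF assms]]
  show ?thesis
    unfolding has_field_derivative_def
    by (rule has_derivative_eq_rhs) (simp add: fun_eq_iff sum_distrib_left mult_ac)
qed

lemma holomorphic_on_line:
  assumes "holomorphic_Cn h D"
  shows "(\<lambda>\<zeta>. h (z + \<zeta> *s v)) holomorphic_on {\<zeta>. z + \<zeta> *s v \<in> D}"
  unfolding holomorphic_on_def
proof
  fix \<zeta> assume "\<zeta> \<in> {\<zeta>. z + \<zeta> *s v \<in> D}"
  then have "z + \<zeta> *s v \<in> D"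
    by blast
  from holomorphic_Cn_line[OF assms this]
  show "(\<lambda>\<zeta>. h (z + \<zeta> *s v)) field_differentiable at \<zeta> within {\<zeta>. z + \<zeta> *s v \<in> D}"
    unfolding field_differentiable_def by (blast intro: has_field_derivative_at_within)
qed

text \<open>Holomorphy is given as mere pointwise differentiability. Writing the partial derivative
  as an integral of values of \<open>h\<close> over a circle is what yields its continuity and
  differentiability. Of the quadratic denominator in Cauchy's formula, one factor cancels against
  the velocity of the circle, which leaves the \<open>inverse\<close>.\<close>

lemma pd_cauchy:
  fixes h :: "complex^'n \<Rightarrow> complex"
  assumes h: "holomorphic_Cn h D" and D: "cball z r \<subseteq> D" and r: "r > 0"
  shows "pd k h z = integral (cbox 0 1)
    (\<lambda>t. h (z + axis k (r * exp (2 * pi * \<i> * of_real t))) * inverse (r * exp (2 * pi * \<i> * of_real t)))"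
proof -
  let ?g = "\<lambda>\<zeta>. h (z + axis k \<zeta>)"
  have hol: "?g holomorphic_on cball 0 r"
  proof -
    have "?g holomorphic_on {\<zeta>. z + axis k \<zeta> \<in> D}"
      using holomorphic_on_line[OF h, of z "axis k 1"] by (simp add: axis_conv_smult[symmetric])
    moreover have "cball 0 r \<subseteq> {\<zeta>. z + axis k \<zeta> \<in> D}"
      using D by (auto simp: subset_eq dist_norm)
    ultimately show ?thesis
      by (rule holomorphic_on_subset)
  qed
  have "(?g has_field_derivative (1 / (2 * of_real pi * \<i>) * contour_integral (circlepath 0 r) (\<lambda>u. ?g u / (u-0)^2))) (at 0)"
    by (rule Cauchy_derivative_integral_circlepath)
      (use hol r in \<open>auto intro: holomorphic_on_imp_continuous_on holomorphic_on_subset\<close>)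
  then have "pd k h z = 1 / (2 * of_real pi * \<i>) * contour_integral (circlepath 0 r) (\<lambda>u. ?g u / u^2)"
    by (simp add: pd_def DERIV_imp_deriv)
  also have "\<dots> = 1 / (2 * of_real pi * \<i>) * integral (cbox 0 1)
      (\<lambda>t. (2 * of_real pi * \<i>) * (?g (r * exp (2 * pi * \<i> * of_real t)) * inverse (r * exp (2 * pi * \<i> * of_real t))))"
    unfolding contour_integral_integral vector_derivative_circlepath cbox_interval
    unfolding circlepath
    using r by (intro arg_cong[where f = "(*) (1 / (2 * of_real pi * \<i>))"] integral_cong)
      (simp add: field_simps power2_eq_square)
  finally show ?thesis
    by simp
qed

lemma norm_circle_point: "norm (axis k (of_real r * exp (2 * pi * \<i> * of_real t)) :: complex^'n) = \<bar>r\<bar>"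
  by (simp add: norm_mult mult.assoc)

text \<open>The radius \<open>r\<close> serves both for the centres and for the circles about them,
  so the doubled ball is what must lie in \<open>D\<close>.\<close>

lemma continuous_on_circle_shift:
  fixes h :: "complex^'n \<Rightarrow> complex"
  assumes "continuous_on D h" and r: "cball z0 (2 * r) \<subseteq> D" "r > 0"
  shows "continuous_on (ball z0 r \<times> cbox 0 1)
    (\<lambda>(z, t). h (z + axis k (of_real r * exp (2 * pi * \<i> * of_real t))))"
  unfolding split_beta
proof (rule continuous_on_compose2[OF assms(1)])
  show "continuous_on (ball z0 r \<times> cbox 0 1)
      (\<lambda>x. fst x + axis k (of_real r * exp (2 * pi * \<i> * of_real (snd x))))"
    by (intro continuous_intros bounded_linear.continuous_on[OF bounded_linear_axis])
  show "(\<lambda>x. fst x + axis k (of_real r * exp (2 * pi * \<i> * of_real (snd x)))) ` (ball z0 r \<times> cbox 0 1) \<subseteq> D"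
  proof clarify
    fix z :: "complex^'n" and t :: real assume "z \<in> ball z0 r"
    let ?u = "axis k (of_real r * exp (2 * pi * \<i> * of_real t)) :: complex^'n"
    have "dist z0 (z + ?u) \<le> dist z0 z + norm ?u"
      using dist_triangle[of z0 "z + ?u" z] by (simp add: dist_norm)
    also have "\<dots> \<le> 2 * r"
      using \<open>z \<in> ball z0 r\<close> \<open>r > 0\<close> unfolding norm_circle_point by simp
    finally show "fst (z, t) + axis k (of_real r * exp (2 * pi * \<i> * of_real (snd (z, t)))) \<in> D"
      using r(1) by auto
  qed
qed

lemma obtain_cball_twice:
  fixes z :: "complex^'n"
  assumes "open D" "z \<in> D"
  obtains r where "r > 0" "cball z (2 * r) \<subseteq> D"
proof -
  obtain e where "e > 0" "cball z e \<subseteq> D"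
    using assms open_contains_cball by blast
  then show ?thesis
    using that[of "e/2"] by simp
qed

lemma cball_subset_twice:
  fixes z :: "complex^'n"
  assumes "z \<in> ball z0 r" "cball z0 (2 * r) \<subseteq> D"
  shows "cball z r \<subseteq> D"
proof
  fix y assume "y \<in> cball z r"
  then have "dist z0 y \<le> 2 * r"
    using assms(1) dist_triangle[of z0 y z] by auto
  then show "y \<in> D"
    using assms(2) by auto
qed

lemma continuous_on_pd:
  fixes h :: "complex^'n \<Rightarrow> complex"
  assumes "open D" and h: "holomorphic_Cn h D"
  shows "continuous_on D (pd k h)"
proof (rule continuous_at_imp_continuous_on, rule ballI)
  fix z0 assume "z0 \<in> D"
  then obtain r where r: "r > 0" "cball z0 (2 * r) \<subseteq> D"
    using \<open>open D\<close> obtain_cball_twice by blast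
  have "continuous_on (ball z0 r) (\<lambda>z. integral (cbox 0 1)
    (\<lambda>t. h (z + axis k (r * exp (2 * pi * \<i> * of_real t))) * inverse (r * exp (2 * pi * \<i> * of_real t))))"
  proof (rule integral_continuous_on_param)
    show "continuous_on (ball z0 r \<times> cbox 0 1)
     (\<lambda>(z, t). h (z + axis k (complex_of_real r * exp (complex_of_real (2 * pi) * \<i> * complex_of_real t))) *
              inverse (complex_of_real r * exp (complex_of_real (2 * pi) * \<i> * complex_of_real t)))"
      using continuous_on_circle_shift[OF holomorphic_Cn_continuous_on[OF h] r(2,1), of k] r(1)
      unfolding split_beta by (intro continuous_intros) auto
  qed
  then have "continuous_on (ball z0 r) (pd k h)"
    by (rule continuous_on_eq) (use pd_cauchy[OF h cball_subset_twice[OF _ r(2)] r(1)] in auto)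
  then show "isCont (pd k h) z0"
    using r(1) by (simp add: continuous_on_eq_continuous_at)
qed

text \<open>Differentiation under the integral of \<open>pd_cauchy\<close>. In the proof the
  derivative is bundled as a bounded linear function, because the parametric Leibniz rule asks for
  its continuity in that normed space.\<close>

lemma pd_has_derivative:
  fixes h :: "complex^'n \<Rightarrow> complex"
  assumes "open D" and h: "holomorphic_Cn h D" and z0: "z0 \<in> D" and r: "r > 0" "cball z0 (2 * r) \<subseteq> D"
  shows "(pd k h has_derivative (\<lambda>v. \<Sum>i\<in>UNIV. integral (cbox 0 1)
     (\<lambda>t. pd i h (z0 + axis k (r * exp (2 * pi * \<i> * of_real t))) * inverse (r * exp (2 * pi * \<i> * of_real t))) * v$i)) (at z0)"
proof -
  define e :: "real \<Rightarrow> complex" where "e t = r * exp (2 * pi * \<i> * of_real t)" for t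
  define p :: "'n \<Rightarrow> (complex^'n) \<Rightarrow>\<^sub>L complex" where "p i = Blinfun (\<lambda>v. v$i)" for i
  have p: "blinfun_apply (p i) v = v$i" for i v
    unfolding p_def by (subst bounded_linear_Blinfun_apply) (auto intro: bounded_linear_vec_nth)
  define fx where "fx z t = (\<Sum>i\<in>UNIV. blinfun_mult_right (pd i h (z + axis k (e t)) * inverse (e t)) o\<^sub>L p i)" for z t
  have fx: "blinfun_apply (fx z t) v = (\<Sum>i\<in>UNIV. pd i h (z + axis k (e t)) * inverse (e t) * v$i)" for z t v
    by (simp add: fx_def blinfun.sum_left p)
  have e0: "e t \<noteq> 0" for t
    using r(1) by (simp add: e_def)
  have conte: "continuous_on S (\<lambda>x. inverse (e (snd x)))" for S :: "((complex^'n) \<times> real) set"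
    unfolding e_def using r(1) by (intro continuous_intros) auto
  have cont: "continuous_on (ball z0 r \<times> cbox 0 1) (\<lambda>x. pd i h (fst x + axis k (e (snd x))))" for i
    using continuous_on_circle_shift[OF continuous_on_pd[OF assms(1) h] r(2,1), of i k]
    by (simp add: split_beta e_def)
  have contf: "continuous_on (ball z0 r \<times> cbox 0 1) (\<lambda>x. h (fst x + axis k (e (snd x))))"
    using continuous_on_circle_shift[OF holomorphic_Cn_continuous_on[OF h] r(2,1), of k]
    by (simp add: split_beta e_def)
  have contfx: "continuous_on (ball z0 r \<times> cbox 0 1) (\<lambda>x. fx (fst x) (snd x))"
    unfolding fx_def
    by (intro continuous_on_sum bounded_bilinear.continuous_on[OF bounded_bilinear_blinfun_compose]
        bounded_linear.continuous_on[OF bounded_linear_blinfun_mult_right] continuous_on_mult cont conte continuous_on_const)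
  have inD: "z + axis k (e t) \<in> D" if "z \<in> ball z0 r" for z t
  proof -
    have "z + axis k (e t) \<in> cball z r"
      using r(1) by (simp add: e_def dist_norm norm_mult mult.assoc)
    then show ?thesis
      using cball_subset_twice[OF that r(2)] by blast
  qed
  have "((\<lambda>z. integral (cbox 0 1) (\<lambda>t. h (z + axis k (e t)) * inverse (e t))) has_derivative
      integral (cbox 0 1) (fx z0)) (at z0 within ball z0 r)"
  proof (rule leibniz_rule)
    fix z and t :: real assume z: "z \<in> ball z0 r"
    have "((\<lambda>z. h (z + axis k (e t))) has_derivative (\<lambda>v. \<Sum>i\<in>UNIV. pd i h (z + axis k (e t)) * v$i)) (at z)"
      by (rule has_derivative_compose[where f = "\<lambda>z. z + axis k (e t)", OF _ holomorphic_has_derivative[OF h inD[OF z]]])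
        (auto intro!: derivative_eq_intros)
    then have "((\<lambda>z. h (z + axis k (e t)) * inverse (e t)) has_derivative fx z t) (at z)"
      by (rule has_derivative_eq_rhs[OF has_derivative_mult_left])
        (auto simp: fx fun_eq_iff sum_distrib_left mult_ac intro!: sum.cong)
    then show "((\<lambda>z. h (z + axis k (e t)) * inverse (e t)) has_derivative fx z t) (at z within ball z0 r)"
      by (rule has_derivative_at_withinI)
  next
    fix z assume z: "z \<in> ball z0 r"
    have "continuous_on (cbox 0 1) (\<lambda>t. (\<lambda>x. h (fst x + axis k (e (snd x))) * inverse (e (snd x))) (z, t))"
      by (rule continuous_on_compose2[OF continuous_on_mult[OF contf conte]])
        (use z in \<open>auto intro!: continuous_intros\<close>)
    then show "(\<lambda>t. h (z + axis k (e t)) * inverse (e t)) integrable_on cbox 0 1"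
      by (intro integrable_continuous) simp
  next
    show "continuous_on (ball z0 r \<times> cbox 0 1) (\<lambda>(x, t). fx x t)"
      using contfx by (simp add: split_beta)
  qed (use r in auto)
  then have "((\<lambda>z. integral (cbox 0 1) (\<lambda>t. h (z + axis k (e t)) * inverse (e t))) has_derivative
      integral (cbox 0 1) (fx z0)) (at z0)"
    using r(1) by (simp add: at_within_open[of z0 "ball z0 r"])
  then have "(pd k h has_derivative integral (cbox 0 1) (fx z0)) (at z0)"
    by (rule has_derivative_transform_within_open[of _ _ _ _ "ball z0 r"])
      (use r pd_cauchy[OF h cball_subset_twice[OF _ r(2)] r(1)] in \<open>auto simp: e_def\<close>)
  moreover have "blinfun_apply (integral (cbox 0 1) (fx z0)) v =
      (\<Sum>i\<in>UNIV. integral (cbox 0 1) (\<lambda>t. pd i h (z0 + axis k (e t)) * inverse (e t)) * v$i)" for v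
  proof -
    have cont1: "continuous_on (cbox 0 1) (\<lambda>t. g (z0, t))" if "continuous_on (ball z0 r \<times> cbox 0 1) g"
      for g :: "_ \<Rightarrow> 'z::topological_space"
      by (rule continuous_on_compose2[OF that]) (use r in \<open>auto intro!: continuous_intros\<close>)
    have int: "(\<lambda>t. pd i h (z0 + axis k (e t)) * inverse (e t)) integrable_on cbox 0 1" for i
      using cont1[OF continuous_on_mult[OF cont conte], of i] by (intro integrable_continuous) simp
    have "fx z0 integrable_on cbox 0 1"
      using cont1[OF contfx] by (intro integrable_continuous) simp
    then have "blinfun_apply (integral (cbox 0 1) (fx z0)) v = integral (cbox 0 1) (\<lambda>t. fx z0 t v)"
      by (rule blinfun_apply_integral)
    also have "\<dots> = (\<Sum>i\<in>UNIV. integral (cbox 0 1) (\<lambda>t. pd i h (z0 + axis k (e t)) * inverse (e t) * v$i))"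
      unfolding fx by (rule integral_sum, simp, rule integrable_on_mult_left, rule int)
    finally show ?thesis
      by simp
  qed
  ultimately show ?thesis
    unfolding e_def[symmetric] by (metis (no_types, lifting) ext)
qed

lemma holomorphic_pd:
  fixes h :: "complex^'n \<Rightarrow> complex"
  assumes "open D" and h: "holomorphic_Cn h D"
  shows "holomorphic_Cn (pd k h) D"
  unfolding holomorphic_Cn_def
proof
  fix z0 assume z0: "z0 \<in> D"
  then obtain r where r: "r > 0" "cball z0 (2 * r) \<subseteq> D"
    using \<open>open D\<close> obtain_cball_twice by blast
  from pd_has_derivative[OF assms z0 r, of k]
  show "\<exists>L. (pd k h has_derivative L) (at z0) \<and> (\<forall>c v. L (c *s v) = c * L v)"
    by (intro exI conjI) (auto simp: sum_distrib_left mult_ac intro!: sum.cong)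
qed

text \<open>The coefficient of the derivative just computed is the Cauchy integral of
  \<open>pd i h\<close> over a circle in direction \<open>k\<close>, hence equal to
  \<open>pd k (pd i h)\<close>. This symmetry makes the conjugate differentials of a holomorphic map
  closed, which Stokes' theorem relies on.\<close>

lemma pd_commute:
  fixes h :: "complex^'n \<Rightarrow> complex"
  assumes "open D" and h: "holomorphic_Cn h D" and z0: "z0 \<in> D"
  shows "pd i (pd k h) z0 = pd k (pd i h) z0"
proof -
  obtain r where r: "r > 0" "cball z0 (2 * r) \<subseteq> D"
    using assms obtain_cball_twice by blast
  have "cball z0 r \<subseteq> D"
    using cball_subset_twice[OF _ r(2), of z0] r(1) by simp
  with pd_eqI[OF pd_has_derivative[OF assms r, of k], of i]
    pd_cauchy[OF holomorphic_pd[OF assms(1) h, of i], of z0 r k] r(1)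
  show ?thesis by simp
qed

section \<open>Algebraic operations on holomorphic functions\<close>

lemma holomorphic_Cn_const: "holomorphic_Cn (\<lambda>z. c) D"
  by (rule holomorphic_CnI[where c = "\<lambda>z k. 0"]) simp

lemma has_derivative_pd_add:
  assumes "holomorphic_Cn f D" "holomorphic_Cn g D" "z \<in> D"
  shows "((\<lambda>z. f z + g z) has_derivative (\<lambda>v. \<Sum>k\<in>UNIV. (pd k f z + pd k g z) * v$k)) (at z)"
  by (rule has_derivative_eq_rhs[OF has_derivative_add[OF assms(1,2)[THEN holomorphic_has_derivative, OF assms(3)]]])
    (simp add: algebra_simps sum.distrib)

lemma holomorphic_Cn_add:
  assumes "holomorphic_Cn f D" "holomorphic_Cn g D"
  shows "holomorphic_Cn (\<lambda>z. f z + g z) D"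
  by (rule holomorphic_CnI, rule has_derivative_pd_add[OF assms])
lemmas pd_add = pd_eqI[OF has_derivative_pd_add]

lemma has_derivative_pd_mult:
  assumes "holomorphic_Cn f D" "holomorphic_Cn g D" "z \<in> D"
  shows "((\<lambda>z. f z * g z) has_derivative (\<lambda>v. \<Sum>k\<in>UNIV. (f z * pd k g z + pd k f z * g z) * v$k)) (at z)"
  by (rule has_derivative_eq_rhs[OF has_derivative_mult[OF assms(1,2)[THEN holomorphic_has_derivative, OF assms(3)]]])
    (simp add: algebra_simps sum.distrib sum_distrib_left)

lemma holomorphic_Cn_mult:
  assumes "holomorphic_Cn f D" "holomorphic_Cn g D"
  shows "holomorphic_Cn (\<lambda>z. f z * g z) D"
  by (rule holomorphic_CnI, rule has_derivative_pd_mult[OF assms])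

lemma has_derivative_pd_cmult:
  assumes "holomorphic_Cn f D" "z \<in> D"
  shows "((\<lambda>z. c * f z) has_derivative (\<lambda>v. \<Sum>k\<in>UNIV. (c * pd k f z) * v$k)) (at z)"
  by (rule has_derivative_eq_rhs[OF has_derivative_mult_right[OF holomorphic_has_derivative[OF assms]]])
    (simp add: algebra_simps sum_distrib_left)

lemma holomorphic_Cn_cmult:
  assumes "holomorphic_Cn f D"
  shows "holomorphic_Cn (\<lambda>z. c * f z) D"
  by (rule holomorphic_CnI, rule has_derivative_pd_cmult[OF assms])
lemmas pd_cmult = pd_eqI[OF has_derivative_pd_cmult]

lemma has_derivative_pd_coord:
  "((\<lambda>z. z$j) has_derivative (\<lambda>v. \<Sum>k\<in>UNIV. (if k = j then 1 else 0) * v$k)) (at (z :: complex^'n))"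
  by (rule has_derivative_eq_rhs[OF bounded_linear.has_derivative[OF bounded_linear_vec_nth has_derivative_ident]])
    (simp add: if_distrib[of "\<lambda>x. x * _"] cong: if_cong)

lemma holomorphic_Cn_coord: "holomorphic_Cn (\<lambda>z. z$j) D"
  by (rule holomorphic_CnI[where c = "\<lambda>z k. if k = j then 1 else 0"]) (rule has_derivative_pd_coord)

lemmas pd_coord = pd_eqI[OF has_derivative_pd_coord]

lemma holomorphic_Cn_diff:
  assumes "holomorphic_Cn f D" "holomorphic_Cn g D"
  shows "holomorphic_Cn (\<lambda>z. f z - g z) D"
  using holomorphic_Cn_add[OF assms(1) holomorphic_Cn_cmult[OF assms(2), of "-1"]] by simp

lemma holomorphic_Cn_sum:
  assumes "\<And>i. i \<in> A \<Longrightarrow> holomorphic_Cn (f i) D"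
  shows "holomorphic_Cn (\<lambda>z. \<Sum>i\<in>A. f i z) D"
  using assms
  by (induction A rule: infinite_finite_induct) (auto intro: holomorphic_Cn_const holomorphic_Cn_add)

lemma holomorphic_Cn_prod:
  assumes "\<And>i. i \<in> A \<Longrightarrow> holomorphic_Cn (f i) D"
  shows "holomorphic_Cn (\<lambda>z. \<Prod>i\<in>A. f i z) D"
  using assms
  by (induction A rule: infinite_finite_induct) (auto intro: holomorphic_Cn_const holomorphic_Cn_mult)

lemma holomorphic_Cn_power: "holomorphic_Cn f D \<Longrightarrow> holomorphic_Cn (\<lambda>z. f z ^ k) D"
  by (induction k) (auto intro: holomorphic_Cn_const holomorphic_Cn_mult)

lemma holomorphic_Cn_det:
  fixes A :: "complex^'n \<Rightarrow> complex^'m^'m"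
  assumes "\<And>i j. holomorphic_Cn (\<lambda>z. A z $ i $ j) D"
  shows "holomorphic_Cn (\<lambda>z. det (A z)) D"
  unfolding det_def
  by (intro holomorphic_Cn_sum holomorphic_Cn_mult holomorphic_Cn_prod holomorphic_Cn_const assms)

subsection \<open>The complex Jacobian\<close>

definition jac :: "(complex^'n::finite \<Rightarrow> complex^'m::finite) \<Rightarrow> complex^'n \<Rightarrow> complex^'n^'m"
  where "jac f z = (\<chi> j k. pd k (\<lambda>z. f z $ j) z)"

lemma holomorphic_map_has_derivative:
  assumes "holomorphic_map_Cn f D" "z \<in> D"
  shows "(f has_derivative ((*v) (jac f z))) (at z)"
proof (subst has_derivative_componentwise_within, rule ballI)
  fix b :: "complex^'b" assume "b \<in> Basis"
  then obtain i u where b: "b = axis i u"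
    by (auto simp: Basis_vec_def)
  have "holomorphic_Cn (\<lambda>z. f z $ i) D"
    using assms(1) by (simp add: holomorphic_map_Cn_def)
  from has_derivative_inner_left[OF holomorphic_has_derivative[OF this assms(2)], of u]
  show "((\<lambda>x. f x \<bullet> b) has_derivative (\<lambda>x. (jac f z *v x) \<bullet> b)) (at z)"
    by (simp add: b inner_axis jac_def matrix_vector_mult_def)
qed

lemma holomorphic_map_continuous_on: "holomorphic_map_Cn f D \<Longrightarrow> continuous_on D f"
  using holomorphic_map_has_derivative has_derivative_continuous
  by (blast intro: continuous_at_imp_continuous_on)

lemma holomorphic_Cn_compose:
  assumes h: "holomorphic_Cn h G" and f: "holomorphic_map_Cn f D" and "f ` D \<subseteq> G"
  shows "holomorphic_Cn (\<lambda>z. h (f z)) D"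
proof (rule holomorphic_CnI)
  fix z assume z: "z \<in> D"
  have "((\<lambda>z. h (f z)) has_derivative (\<lambda>v. \<Sum>j\<in>UNIV. pd j h (f z) * (jac f z *v v)$j)) (at z)"
    using has_derivative_compose[OF holomorphic_map_has_derivative[OF f z] holomorphic_has_derivative[OF h]]
      assms(3) z by blast
  also have "(\<lambda>v. \<Sum>j\<in>UNIV. pd j h (f z) * (jac f z *v v)$j) =
      (\<lambda>v. \<Sum>k\<in>UNIV. (\<Sum>j\<in>UNIV. pd j h (f z) * jac f z $ j $ k) * v$k)"
    unfolding matrix_vector_mult_def sum_distrib_left sum_distrib_right vec_lambda_beta
    by (subst sum.swap) (simp add: mult.assoc)
  finally show "((\<lambda>z. h (f z)) has_derivative
      (\<lambda>v. \<Sum>k\<in>UNIV. (\<Sum>j\<in>UNIV. pd j h (f z) * jac f z $ j $ k) * v$k)) (at z)" .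
qed

lemma holomorphic_det_jac:
  assumes "open D" "holomorphic_map_Cn f D"
  shows "holomorphic_Cn (\<lambda>z. det (jac f z)) D"
  using assms by (intro holomorphic_Cn_det) (simp add: jac_def holomorphic_pd holomorphic_map_Cn_def)

section \<open>Stokes' theorem for the d-bar operator\<close>

text \<open>Every real-linear functional on complex vectors has exactly one expression of this form;
  \<open>a\<close> and \<open>b\<close> are the Wirtinger derivatives with respect to the
  coordinates and their conjugates.\<close>

definition wirt :: "(complex^'n::finite \<Rightarrow> complex) \<Rightarrow> complex^'n \<Rightarrow> ('n \<Rightarrow> complex) \<Rightarrow> ('n \<Rightarrow> complex) \<Rightarrow> bool"
  where "wirt g z a b \<longleftrightarrow>
    (g has_derivative (\<lambda>v. \<Sum>k\<in>UNIV. a k * v$k + b k * cnj (v$k))) (at z)"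

text \<open>Continuously real differentiable, with \<open>b z k\<close> the derivative in the direction of the conjugate
  of the \<open>k\<close>-th coordinate.\<close>

definition C1W :: "(complex^'n::finite) set \<Rightarrow> (complex^'n \<Rightarrow> complex) \<Rightarrow> (complex^'n \<Rightarrow> 'n \<Rightarrow> complex) \<Rightarrow> bool"
  where "C1W D g b \<longleftrightarrow> (\<exists>a. (\<forall>z\<in>D. wirt g z (a z) (b z)) \<and>
    (\<forall>k. continuous_on D (\<lambda>z. a z k)) \<and> (\<forall>k. continuous_on D (\<lambda>z. b z k)))"

section \<open>Calculus of Wirtinger derivatives\<close>

lemma wirt_axis:
  "(\<Sum>k\<in>UNIV. a k * (axis j c :: complex^'n)$k + b k * cnj ((axis j c :: complex^'n)$k)) = a j * c + b j * cnj c"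
proof -
  have "a k * (axis j c :: complex^'n)$k + b k * cnj ((axis j c :: complex^'n)$k) =
      (if k = j then a j * c + b j * cnj c else 0)" for k
    by (simp add: axis_def)
  then show ?thesis by simp
qed

lemma C1W_continuous_on: "C1W D g b \<Longrightarrow> continuous_on D g"
  unfolding C1W_def wirt_def
  using has_derivative_continuous by (blast intro: continuous_at_imp_continuous_on)

lemma C1W_continuous_on_dbar: "C1W D g b \<Longrightarrow> continuous_on D (\<lambda>z. b z k)"
  unfolding C1W_def by blast

lemma C1W_holomorphic:
  assumes "open D" "holomorphic_Cn h D"
  shows "C1W D h (\<lambda>z k. 0)"
  unfolding C1W_def wirt_def
  by (rule exI[of _ "\<lambda>z k. pd k h z"])
    (use assms holomorphic_has_derivative[OF assms(2)] in \<open>auto intro: continuous_on_pd\<close>)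

lemma C1W_cnj_holomorphic:
  assumes "open D" "holomorphic_Cn h D"
  shows "C1W D (\<lambda>z. cnj (h z)) (\<lambda>z k. cnj (pd k h z))"
  unfolding C1W_def wirt_def
  by (rule exI[of _ "\<lambda>z k. 0"])
    (use assms has_derivative_cnj[OF holomorphic_has_derivative[OF assms(2)]]
      in \<open>auto intro!: continuous_on_cnj continuous_on_pd\<close>)

lemma C1W_mult:
  assumes "C1W D f b" "C1W D g c"
  shows "C1W D (\<lambda>z. f z * g z) (\<lambda>z k. b z k * g z + f z * c z k)"
proof -
  obtain a where a: "\<And>z. z \<in> D \<Longrightarrow> wirt f z (a z) (b z)" "\<And>k. continuous_on D (\<lambda>z. a z k)"
    using assms(1) unfolding C1W_def by blast
  obtain a' where a': "\<And>z. z \<in> D \<Longrightarrow> wirt g z (a' z) (c z)" "\<And>k. continuous_on D (\<lambda>z. a' z k)"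
    using assms(2) unfolding C1W_def by blast
  show ?thesis
    unfolding C1W_def
  proof (intro exI[of _ "\<lambda>z k. a z k * g z + f z * a' z k"] conjI ballI allI)
    fix z assume "z \<in> D"
    show "wirt (\<lambda>z. f z * g z) z (\<lambda>k. a z k * g z + f z * a' z k) (\<lambda>k. b z k * g z + f z * c z k)"
      unfolding wirt_def
      by (rule has_derivative_eq_rhs[OF has_derivative_mult[OF a(1)[unfolded wirt_def, OF \<open>z \<in> D\<close>] a'(1)[unfolded wirt_def, OF \<open>z \<in> D\<close>]]])
        (simp add: fun_eq_iff sum_distrib_left sum_distrib_right sum.distrib[symmetric] algebra_simps)
  qed (intro continuous_intros a a' C1W_continuous_on[OF assms(1)] C1W_continuous_on[OF assms(2)]
      C1W_continuous_on_dbar[OF assms(1)] C1W_continuous_on_dbar[OF assms(2)])+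
qed

lemma C1W_prod:
  assumes "finite A" "\<And>l. l \<in> A \<Longrightarrow> C1W D (g l) (b l)" "open D"
  shows "C1W D (\<lambda>z. \<Prod>l\<in>A. g l z) (\<lambda>z k. \<Sum>l\<in>A. b l z k * (\<Prod>j\<in>A-{l}. g j z))"
  using assms(1,2)
proof (induction A rule: finite_induct)
  case empty
  then show ?case
    using C1W_holomorphic[OF assms(3) holomorphic_Cn_const] by simp
next
  case (insert x A)
  have "C1W D (\<lambda>z. g x z * (\<Prod>l\<in>A. g l z))
      (\<lambda>z k. b x z k * (\<Prod>l\<in>A. g l z) + g x z * (\<Sum>l\<in>A. b l z k * (\<Prod>j\<in>A-{l}. g j z)))"
    by (rule C1W_mult) (use insert in auto)
  moreover have "(\<Sum>l\<in>insert x A. b l z k * (\<Prod>j\<in>insert x A-{l}. g j z)) =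
      b x z k * (\<Prod>l\<in>A. g l z) + g x z * (\<Sum>l\<in>A. b l z k * (\<Prod>j\<in>A-{l}. g j z))" for z k
  proof -
    have "(\<Prod>j\<in>insert x A-{l}. g j z) = g x z * (\<Prod>j\<in>A-{l}. g j z)" if "l \<in> A" for l
    proof -
      have "insert x A - {l} = insert x (A - {l})"
        using that insert.hyps by auto
      then show ?thesis
        using insert.hyps by simp
    qed
    moreover have "insert x A - {x} = A"
      using insert.hyps by auto
    ultimately show ?thesis
      using insert.hyps by (simp add: sum_distrib_left mult_ac)
  qed
  ultimately show ?case
    using insert.hyps by simp
qed

section \<open>Zero extension and integrals of derivatives of compactly supported functions\<close>

lemma continuous_on_zero_extension:
  fixes g :: "'a::t2_space \<Rightarrow> 'b::{topological_space, zero}"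
  assumes "open D" "closed K" "K \<subseteq> D" "continuous_on D g" "\<And>z. z \<in> D - K \<Longrightarrow> g z = 0"
  shows "continuous_on UNIV (\<lambda>z. if z \<in> D then g z else 0)"
proof -
  have "continuous_on (D \<union> - K) (\<lambda>z. if z \<in> D then g z else 0)"
  proof (rule continuous_on_open_Un)
    show "continuous_on D (\<lambda>z. if z \<in> D then g z else 0)"
      by (rule continuous_on_eq[OF assms(4)]) auto
    show "continuous_on (- K) (\<lambda>z. if z \<in> D then g z else 0)"
      by (rule continuous_on_eq[OF continuous_on_const[of _ 0]]) (use assms in auto)
  qed (use assms in auto)
  moreover have "D \<union> - K = UNIV"
    using assms by auto
  ultimately show ?thesis by simp
qed

text \<open>Off \<open>K\<close> the function vanishes on an open set, so its derivative is zero
  there. The directions 1 and i of each coordinate show that both Wirtinger coefficients are zero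
  too, and they can be extended as well.\<close>

lemma C1W_extend:
  assumes "open D" "compact K" "K \<subseteq> D" "C1W D g b" and zero: "\<And>z. z \<in> D - K \<Longrightarrow> g z = 0"
  shows "C1W UNIV (\<lambda>z. if z \<in> D then g z else 0) (\<lambda>z k. if z \<in> D then b z k else 0)"
proof -
  have "closed K"
    using assms(2) by (rule compact_imp_closed)
  obtain a where a: "\<And>z. z \<in> D \<Longrightarrow> wirt g z (a z) (b z)" "\<And>k. continuous_on D (\<lambda>z. a z k)"
    using assms(4) unfolding C1W_def by blast
  have ab0: "a z k = 0 \<and> b z k = 0" if z: "z \<in> D - K" for z k
  proof -
    have "(g has_derivative (\<lambda>v. 0)) (at z)"
      by (rule has_derivative_transform_within_open[of "\<lambda>z. 0" _ _ _ "D - K"])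
        (use z assms(1) \<open>closed K\<close> zero in auto)
    with a(1)[of z] z have eq: "(\<lambda>v. \<Sum>k\<in>UNIV. a z k * v$k + b z k * cnj (v$k)) = (\<lambda>v. 0)"
      unfolding wirt_def using has_derivative_unique by blast
    have "a z k + b z k = 0"
      using fun_cong[OF eq, of "axis k 1"] by (simp only: wirt_axis) simp
    moreover have "a z k * \<i> + b z k * cnj \<i> = 0"
      using fun_cong[OF eq, of "axis k \<i>"] by (simp only: wirt_axis)
    then have "\<i> * (a z k - b z k) = 0"
      by (simp add: algebra_simps)
    ultimately show ?thesis by simp
  qed
  show ?thesis
    unfolding C1W_def
  proof (intro exI[of _ "\<lambda>z k. if z \<in> D then a z k else 0"] conjI ballI allI)
    fix z :: "complex^'a"
    show "wirt (\<lambda>z. if z \<in> D then g z else 0) z (\<lambda>k. if z \<in> D then a z k else 0) (\<lambda>k. if z \<in> D then b z k else 0)"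
    proof (cases "z \<in> D")
      case True
      then have "((\<lambda>z. if z \<in> D then g z else 0) has_derivative (\<lambda>v. \<Sum>k\<in>UNIV. a z k * v$k + b z k * cnj (v$k))) (at z)"
        using has_derivative_transform_within_open[OF a(1)[unfolded wirt_def, OF True] assms(1) True] by simp
      with True show ?thesis
        by (simp add: wirt_def)
    next
      case False
      have "((\<lambda>z. if z \<in> D then g z else 0) has_derivative (\<lambda>v. 0)) (at z)"
        by (rule has_derivative_transform_within_open[of "\<lambda>z. 0" _ _ _ "- K"])
          (use False assms(3) \<open>closed K\<close> zero in auto)
      with False show ?thesis
        by (simp add: wirt_def)
    qed
  qed (intro continuous_on_zero_extension[OF assms(1) \<open>closed K\<close> assms(3)] a C1W_continuous_on_dbar[OF assms(4)];
      use ab0 in blast)+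
qed

text \<open>Small translations in direction \<open>e\<close> keep the support inside the box and so
  leave the integral of \<open>v\<close> unchanged. Its derivative in the length of the translation,
  computed under the integral, is the integral of the directional derivative.\<close>

lemma integral_directional_derivative_eq_0:
  fixes v :: "complex^'n \<Rightarrow> complex"
  assumes der: "\<And>z. (v has_derivative L z) (at z)" and cont: "continuous_on UNIV (\<lambda>z. L z e)"
    and K: "compact K" "K \<subseteq> box lo hi" and zero: "\<And>z. z \<notin> K \<Longrightarrow> v z = 0"
  shows "((\<lambda>z. L z e) has_integral 0) (cbox lo hi)"
proof -
  obtain r where r: "r > 0" "(\<Union>x\<in>K. ball x r) \<subseteq> box lo hi"
    using compact_subset_open_imp_ball_epsilon_subset[OF K(1) open_box K(2)] by blast
  \<comment> \<open>Translations with parameter below \<open>d\<close> move points by less than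
    \<open>r\<close>; the summand 1 covers \<open>e = 0\<close>.\<close>
  define d where "d = r / (norm e + 1)"
  have d: "d > 0"
    using r(1) by (simp add: d_def add_nonneg_pos)
  define I where "I t = integral (cbox lo hi) (\<lambda>z. v (z + t *\<^sub>R e))" for t
  have contv: "continuous_on UNIV v"
    using der has_derivative_continuous by (blast intro: continuous_at_imp_continuous_on)
  have I0: "I t = I 0" if t: "t \<in> {-d<..<d}" for t
  proof -
    have "\<bar>t\<bar> * norm e \<le> d * norm e"
      using t by (intro mult_right_mono) auto
    also have "\<dots> < r"
    proof -
      have "r * norm e < r * (norm e + 1)"
        using r(1) by simp
      then show ?thesis
        by (simp add: d_def pos_divide_less_eq add_nonneg_pos)
    qed
    finally have small: "norm (t *\<^sub>R e) < r" by simp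
    have K': "z \<in> cbox (lo + t *\<^sub>R e) (hi + t *\<^sub>R e)" if "z \<in> K" for z
    proof -
      have "z - t *\<^sub>R e \<in> ball z r"
        using small by (simp add: dist_norm)
      then have "z - t *\<^sub>R e \<in> cbox lo hi"
        using r(2) that box_subset_cbox by blast
      then show ?thesis
        by (simp add: mem_box algebra_simps)
    qed
    have K0: "z \<in> cbox lo hi" if "z \<in> K" for z
      using K(2) that box_subset_cbox by blast
    have full: "integral S v = integral UNIV v" if "K \<subseteq> S" for S
    proof -
      have "(\<lambda>x. if x \<in> S then v x else 0) = v"
        using zero that by (auto simp: fun_eq_iff)
      then show ?thesis
        using integral_restrict_UNIV[of S v] by simp
    qed
    have "I t = integral (cbox lo hi) (v \<circ> (+) (t *\<^sub>R e))"
      by (simp add: I_def o_def add.commute)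
    also have "\<dots> = integral (cbox (lo + t *\<^sub>R e) (hi + t *\<^sub>R e)) v"
      by (rule integral_shift_cbox_plus)
    also have "\<dots> = integral (cbox lo hi) v"
      using full[OF subsetI[OF K']] full[OF subsetI[OF K0]] by simp
    finally show ?thesis
      by (simp add: I_def)
  qed
  have lin: "(I has_vector_derivative integral (cbox lo hi) (\<lambda>z. L (z + 0 *\<^sub>R e) e)) (at 0 within {-d<..<d})"
    unfolding I_def
  proof (rule leibniz_rule_vector_derivative)
    fix t z assume "t \<in> {-d<..<d}"
    have "((\<lambda>t. z + t *\<^sub>R e) has_derivative (\<lambda>t. t *\<^sub>R e)) (at t)"
      by (auto intro!: derivative_eq_intros)
    from has_derivative_compose[OF this der]
    have "((\<lambda>t. v (z + t *\<^sub>R e)) has_vector_derivative L (z + t *\<^sub>R e) e) (at t)"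
      unfolding has_vector_derivative_def
      by (rule has_derivative_eq_rhs)
        (use has_derivative_linear[OF der] in \<open>simp add: linear_cmul\<close>)
    then show "((\<lambda>t. v (z + t *\<^sub>R e)) has_vector_derivative L (z + t *\<^sub>R e) e) (at t within {-d<..<d})"
      by (rule has_vector_derivative_at_within)
  next
    fix t assume "t \<in> {-d<..<d}"
    show "(\<lambda>z. v (z + t *\<^sub>R e)) integrable_on cbox lo hi"
      by (intro integrable_continuous continuous_on_compose2[OF contv] continuous_intros) auto
  next
    show "continuous_on ({-d<..<d} \<times> cbox lo hi) (\<lambda>(t, z). L (z + t *\<^sub>R e) e)"
      unfolding split_beta by (intro continuous_on_compose2[OF cont] continuous_intros) auto
  qed (use d in auto)
  have "(I has_vector_derivative 0) (at 0 within {-d<..<d})"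
    using d by (intro has_vector_derivative_transform[OF _ I0 has_vector_derivative_const]) auto
  then have "(I has_vector_derivative 0) (at 0)"
    using at_within_open[of 0 "{-d<..<d}"] d by auto
  moreover have "(I has_vector_derivative integral (cbox lo hi) (\<lambda>z. L (z + 0 *\<^sub>R e) e)) (at 0)"
  proof -
    have "at (0::real) within {-d<..<d} = at 0"
      by (rule at_within_open) (use d in auto)
    with lin show ?thesis by metis
  qed
  ultimately have "integral (cbox lo hi) (\<lambda>z. L z e) = 0"
  proof -
    assume "(I has_vector_derivative 0) (at 0)"
      and "(I has_vector_derivative integral (cbox lo hi) (\<lambda>z. L (z + 0 *\<^sub>R e) e)) (at 0)"
    from vector_derivative_unique_at[OF this] show ?thesis
      by simp
  qed
  moreover have "(\<lambda>z. L z e) integrable_on cbox lo hi"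
    by (intro integrable_continuous continuous_on_subset[OF cont]) auto
  ultimately show ?thesis
    by (metis integrable_integral)
qed

lemma dbar_has_integral_0:
  assumes "open D" "compact K" "K \<subseteq> D" "D \<subseteq> box lo hi" "C1W D g b"
    and zero: "\<And>z. z \<in> D - K \<Longrightarrow> g z = 0"
  shows "((\<lambda>z. if z \<in> D then b z k else 0) has_integral 0) (cbox lo hi)"
proof -
  define v where "v z = (if z \<in> D then g z else 0)" for z
  define b' where "b' z k = (if z \<in> D then b z k else 0)" for z k
  have "C1W UNIV v b'"
    unfolding v_def b'_def by (rule C1W_extend[OF assms(1,2,3,5) zero])
  then obtain a where a: "\<And>z. wirt v z (a z) (b' z)" and
    cont: "\<And>k. continuous_on UNIV (\<lambda>z. a z k)" "\<And>k. continuous_on UNIV (\<lambda>z. b' z k)"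
    unfolding C1W_def by auto
  have int: "((\<lambda>z. \<Sum>j\<in>UNIV. a z j * (axis k c :: complex^'a)$j + b' z j * cnj ((axis k c :: complex^'a)$j)) has_integral 0) (cbox lo hi)" for c
    by (rule integral_directional_derivative_eq_0[where K = K and v = v])
      (use a assms in \<open>auto simp: wirt_def v_def intro!: continuous_intros cont\<close>)
  \<comment> \<open>The conjugate derivative is 1/2 times the derivative in direction 1 plus i/2
    times the one in direction i; the coefficient \<open>a\<close> cancels.\<close>
  have "((\<lambda>z. (a z k * 1 + b' z k * cnj 1) * (1/2) + (a z k * \<i> + b' z k * cnj \<i>) * (\<i>/2)) has_integral 0 * (1/2) + 0 * (\<i>/2)) (cbox lo hi)"
    using int[of 1] int[of \<i>] unfolding wirt_axis
    by (intro has_integral_add has_integral_mult_left)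
  then show ?thesis
    unfolding b'_def[symmetric] by (simp add: algebra_simps)
qed

section \<open>Determinants and Stokes' theorem\<close>

lemma alternating_sum_eq_0:
  fixes Q :: "('n::finite \<Rightarrow> 'n) \<Rightarrow> complex"
  assumes "i \<noteq> l" "\<And>\<sigma>. Q (\<sigma> \<circ> Transposition.transpose i l) = Q \<sigma>"
  shows "(\<Sum>\<sigma> | \<sigma> permutes UNIV. of_int (sign \<sigma>) * Q \<sigma>) = 0"
proof -
  let ?S = "\<Sum>\<sigma> | \<sigma> permutes UNIV. of_int (sign \<sigma>) * Q \<sigma>"
  have "?S = (\<Sum>\<sigma> | \<sigma> permutes UNIV. of_int (sign (\<sigma> \<circ> Transposition.transpose i l)) * Q (\<sigma> \<circ> Transposition.transpose i l))"
    by (rule sum_permutations_compose_right) (simp add: permutes_swap_id)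
  also have "\<dots> = (\<Sum>\<sigma> | \<sigma> permutes UNIV. - (of_int (sign \<sigma>) * Q \<sigma>))"
  proof (rule sum.cong)
    fix \<sigma> :: "'n \<Rightarrow> 'n" assume "\<sigma> \<in> {\<sigma>. \<sigma> permutes UNIV}"
    then have "permutation \<sigma>"
      using permutes_imp_permutation[of UNIV \<sigma>] by simp
    then have "sign (\<sigma> \<circ> Transposition.transpose i l) = - sign \<sigma>"
      using assms(1) by (simp add: sign_compose permutation_swap_id sign_swap_id)
    then show "of_int (sign (\<sigma> \<circ> Transposition.transpose i l)) * Q (\<sigma> \<circ> Transposition.transpose i l) = - (of_int (sign \<sigma>) * Q \<sigma>)"
      using assms(2) by simp
  qed simp
  also have "\<dots> = - ?S"
    by (rule sum_negf)
  finally show ?thesis by simp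
qed

definition cnj_mat :: "complex^'n^'m \<Rightarrow> complex^'n^'m"
  where "cnj_mat A = (\<chi> j k. cnj (A $ j $ k))"

definition row_subst :: "'m \<Rightarrow> ('n \<Rightarrow> complex) \<Rightarrow> complex^'n^'m \<Rightarrow> complex^'n^'m"
  where "row_subst i y A = (\<chi> j k. if j = i then y k else A $ j $ k)"

lemma row_subst_nth [simp]: "row_subst i y A $ j $ k = (if j = i then y k else A $ j $ k)"
  by (simp add: row_subst_def)

lemma cnj_mat_nth [simp]: "cnj_mat A $ j $ k = cnj (A $ j $ k)"
  by (simp add: cnj_mat_def)

text \<open>The determinant is, up to sign, the coefficient of d-bar v wedged with the conjugates of
  the df_j for j other than \<open>i\<close>. These are closed and \<open>H\<close> is holomorphic,
  so the form is exact. In coordinates, the conjugate derivative of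
  \<open>H z * (v z * T \<sigma> z)\<close> in direction \<open>\<sigma> i\<close> is the wanted
  term plus terms with second derivatives of \<open>f\<close>; the latter are symmetric in two
  indices and cancel in the alternating sum over \<open>\<sigma>\<close>.\<close>

lemma stokes_det:
  fixes f :: "complex^'n \<Rightarrow> complex^'n"
  assumes D: "open D" "compact K" "K \<subseteq> D" "D \<subseteq> box lo hi"
    and H: "holomorphic_Cn H D" and f: "holomorphic_map_Cn f D"
    and v: "C1W D v b" and zero: "\<And>z. z \<in> D - K \<Longrightarrow> v z = 0"
  shows "((\<lambda>z. if z \<in> D then H z * det (row_subst i (b z) (cnj_mat (jac f z))) else 0)
    has_integral 0) (cbox lo hi)"
proof -
  have fj: "holomorphic_Cn (\<lambda>z. f z $ j) D" for j
    using f by (simp add: holomorphic_map_Cn_def)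
  define P where "P = {\<sigma>::'n \<Rightarrow> 'n. \<sigma> permutes UNIV}"
  define d where "d j k z = cnj (pd k (\<lambda>z. f z $ j) z)" for j k z
  define dd where "dd j k l z = cnj (pd k (pd l (\<lambda>z. f z $ j)) z)" for j k l z
  define T where "T \<sigma> z = (\<Prod>j\<in>-{i}. d j (\<sigma> j) z)" for \<sigma> z
  \<comment> \<open>The term in which the derivative in direction \<open>\<sigma> i\<close> falls on
    the factor of row \<open>l\<close>; exchanging \<open>\<sigma> i\<close> and
    \<open>\<sigma> l\<close> does not change it.\<close>
  define Q where "Q z l \<sigma> = dd l (\<sigma> i) (\<sigma> l) z * (\<Prod>j\<in>-{i}-{l}. d j (\<sigma> j) z)" for z l \<sigma>
  have "C1W D (d j k) (\<lambda>z m. dd j m k z)" for j k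
    unfolding d_def dd_def by (intro C1W_cnj_holomorphic holomorphic_pd fj D(1))
  then have "C1W D (T \<sigma>) (\<lambda>z k. \<Sum>l\<in>-{i}. dd l k (\<sigma> l) z * (\<Prod>j\<in>-{i}-{l}. d j (\<sigma> j) z))" for \<sigma>
    unfolding T_def using D(1) by (intro C1W_prod) auto
  then have C1: "C1W D (\<lambda>z. H z * (v z * T \<sigma> z)) (\<lambda>z k. 0 * (v z * T \<sigma> z) + H z * (b z k * T \<sigma> z +
      v z * (\<Sum>l\<in>-{i}. dd l k (\<sigma> l) z * (\<Prod>j\<in>-{i}-{l}. d j (\<sigma> j) z))))" for \<sigma>
    by (intro C1W_mult v C1W_holomorphic H D(1))
  have "((\<lambda>z. if z \<in> D then 0 * (v z * T \<sigma> z) + H z * (b z (\<sigma> i) * T \<sigma> z +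
      v z * (\<Sum>l\<in>-{i}. Q z l \<sigma>)) else 0) has_integral 0) (cbox lo hi)" for \<sigma>
    unfolding Q_def by (rule dbar_has_integral_0[OF D C1]) (use zero in auto)
  then have "((\<lambda>z. \<Sum>\<sigma>\<in>P. of_int (sign \<sigma>) * (if z \<in> D then 0 * (v z * T \<sigma> z) + H z * (b z (\<sigma> i) * T \<sigma> z +
      v z * (\<Sum>l\<in>-{i}. Q z l \<sigma>)) else 0)) has_integral (\<Sum>\<sigma>\<in>P. of_int (sign \<sigma>) * 0)) (cbox lo hi)"
    by (intro has_integral_sum has_integral_mult_right) (auto simp: P_def)
  moreover have "(\<Sum>\<sigma>\<in>P. of_int (sign \<sigma>) * (if z \<in> D then 0 * (v z * T \<sigma> z) + H z * (b z (\<sigma> i) * T \<sigma> z +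
      v z * (\<Sum>l\<in>-{i}. Q z l \<sigma>)) else 0)) =
      (if z \<in> D then H z * det (row_subst i (b z) (cnj_mat (jac f z))) else 0)" for z
  proof (cases "z \<in> D")
    case True
    have Q0: "(\<Sum>\<sigma>\<in>P. of_int (sign \<sigma>) * Q z l \<sigma>) = 0" if "l \<in> -{i}" for l
      unfolding P_def
    proof (rule alternating_sum_eq_0)
      show "i \<noteq> l" using that by auto
      fix \<sigma>
      have "(\<Prod>j\<in>-{i}-{l}. d j ((\<sigma> \<circ> Transposition.transpose i l) j) z) = (\<Prod>j\<in>-{i}-{l}. d j (\<sigma> j) z)"
        by (rule prod.cong) auto
      then show "Q z l (\<sigma> \<circ> Transposition.transpose i l) = Q z l \<sigma>"
        unfolding Q_def dd_def by (simp add: pd_commute[OF D(1) fj True])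
    qed
    have "(\<Sum>\<sigma>\<in>P. of_int (sign \<sigma>) * (H z * (b z (\<sigma> i) * T \<sigma> z + v z * (\<Sum>l\<in>-{i}. Q z l \<sigma>)))) =
        H z * (\<Sum>\<sigma>\<in>P. of_int (sign \<sigma>) * (b z (\<sigma> i) * T \<sigma> z)) +
        H z * v z * (\<Sum>l\<in>-{i}. \<Sum>\<sigma>\<in>P. of_int (sign \<sigma>) * Q z l \<sigma>)"
      by (subst sum.swap) (simp add: sum_distrib_left algebra_simps sum.distrib)
    also have "\<dots> = H z * (\<Sum>\<sigma>\<in>P. of_int (sign \<sigma>) * (b z (\<sigma> i) * T \<sigma> z))"
      using Q0 by simp
    also have "(\<Sum>\<sigma>\<in>P. of_int (sign \<sigma>) * (b z (\<sigma> i) * T \<sigma> z)) =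
        det (row_subst i (b z) (cnj_mat (jac f z)))"
      unfolding det_def P_def
    proof (intro sum.cong refl arg_cong2[of _ _ _ _ "(*)"])
      fix \<sigma>
      have "(\<Prod>j\<in>UNIV. row_subst i (b z) (cnj_mat (jac f z)) $ j $ \<sigma> j) =
          b z (\<sigma> i) * (\<Prod>j\<in>UNIV-{i}. row_subst i (b z) (cnj_mat (jac f z)) $ j $ \<sigma> j)"
        by (subst prod.remove[of _ i]) auto
      also have "(\<Prod>j\<in>UNIV-{i}. row_subst i (b z) (cnj_mat (jac f z)) $ j $ \<sigma> j) = T \<sigma> z"
        unfolding T_def Compl_eq_Diff_UNIV by (rule prod.cong) (auto simp: d_def jac_def)
      finally show "b z (\<sigma> i) * T \<sigma> z = (\<Prod>j\<in>UNIV. row_subst i (b z) (cnj_mat (jac f z)) $ j $ \<sigma> j)"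
        by simp
    qed
    finally show ?thesis
      using True by simp
  qed simp
  ultimately show ?thesis by simp
qed

subsection \<open>Variation of the integrals\<close>

text \<open>The square makes the cutoff continuously differentiable at 1, as much smoothness as
  Stokes' theorem asks for here. It is always applied to a squared norm, which is differentiable at
  0 as well.\<close>

definition bump :: "real \<Rightarrow> real" where "bump x = (max 0 (1 - x))\<^sup>2"

definition bump' :: "real \<Rightarrow> real" where "bump' x = - 2 * max 0 (1 - x)"

lemma bump_nonneg: "bump x \<ge> 0"
  by (simp add: bump_def)

lemma bump_eq_0: "x \<ge> 1 \<Longrightarrow> bump x = 0"
  by (simp add: bump_def)

lemma bump'_eq_0: "x \<ge> 1 \<Longrightarrow> bump' x = 0"
  by (simp add: bump'_def)

lemma bump_pos: "x < 1 \<Longrightarrow> bump x > 0"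
  by (simp add: bump_def)

lemma continuous_on_bump [continuous_intros]:
  "continuous_on S f \<Longrightarrow> continuous_on S (\<lambda>x. bump (f x))"
  "continuous_on S f \<Longrightarrow> continuous_on S (\<lambda>x. bump' (f x))"
  unfolding bump_def bump'_def by (intro continuous_intros; simp)+

lemma has_real_derivative_bump: "(bump has_real_derivative bump' x) (at x)"
proof -
  consider "x < 1" | "x > 1" | "x = 1" by linarith
  then show ?thesis
  proof cases
    case 1
    have "((\<lambda>x. (1 - x)\<^sup>2) has_real_derivative bump' x) (at x)"
      by (rule derivative_eq_intros refl | simp)+ (use 1 in \<open>simp add: bump'_def\<close>)
    then show ?thesis
      by (rule has_field_derivative_transform_within_open[of _ _ _ "{..<1}"]) (use 1 in \<open>auto simp: bump_def\<close>)
  next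
    case 2
    have "((\<lambda>x. 0) has_real_derivative bump' x) (at x)"
      using 2 by (simp add: bump'_def)
    then show ?thesis
      by (rule has_field_derivative_transform_within_open[of _ _ _ "{1<..}"]) (use 2 in \<open>auto simp: bump_def\<close>)
  next
    case 3
    have "((\<lambda>y. (bump y - bump 1) / (y - 1)) \<longlongrightarrow> 0) (at 1)"
    proof (rule Lim_null_comparison)
      show "\<forall>\<^sub>F y in at (1::real). norm ((bump y - bump 1) / (y - 1)) \<le> \<bar>y - 1\<bar>"
        by (rule always_eventually) (auto simp: bump_def max_def power2_eq_square abs_mult abs_minus_commute)
      have "((\<lambda>y::real. \<bar>y - 1\<bar>) \<longlongrightarrow> \<bar>1 - 1\<bar>) (at 1)"
        by (intro tendsto_intros)
      then show "((\<lambda>y::real. \<bar>y - 1\<bar>) \<longlongrightarrow> 0) (at 1)" by simp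
    qed
    then show ?thesis
      using 3 by (simp add: has_field_derivative_iff bump'_def)
  qed
qed

lemma inner_complex_vec: "complex_of_real (2 * (x \<bullet> y)) = (\<Sum>j\<in>UNIV. x$j * cnj (y$j) + cnj (x$j) * y$j)"
  for x y :: "complex^'n"
  unfolding inner_vec_def of_real_sum sum_distrib_left
proof (rule sum.cong)
  fix j
  show "complex_of_real (2 * (x$j \<bullet> y$j)) = x$j * cnj (y$j) + cnj (x$j) * y$j"
    by (simp add: inner_complex_def complex_eq_iff)
qed simp

text \<open>As \<open>F\<close> is holomorphic, only the conjugate factor in the squared norm
  contributes to the derivative in a conjugate direction.\<close>

lemma C1W_bump:
  fixes F :: "complex^'n \<Rightarrow> complex^'m"
  assumes "open D" and F: "holomorphic_map_Cn F D"
  shows "C1W D (\<lambda>z. of_real (bump ((norm (F z))\<^sup>2)))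
    (\<lambda>z k. of_real (bump' ((norm (F z))\<^sup>2)) * (\<Sum>j\<in>UNIV. F z $ j * cnj (jac F z $ j $ k)))"
proof -
  have contF: "continuous_on D F"
    by (rule holomorphic_map_continuous_on[OF F])
  have contJ: "continuous_on D (\<lambda>z. jac F z $ j $ k)" for j k
    unfolding jac_def using F continuous_on_pd[OF assms(1)] by (simp add: holomorphic_map_Cn_def)
  let ?b = "\<lambda>z k. of_real (bump' ((norm (F z))\<^sup>2)) * (\<Sum>j\<in>UNIV. F z $ j * cnj (jac F z $ j $ k))"
  let ?a = "\<lambda>z k. of_real (bump' ((norm (F z))\<^sup>2)) * (\<Sum>j\<in>UNIV. cnj (F z $ j) * jac F z $ j $ k)"
  show ?thesis
    unfolding C1W_def
  proof (intro exI[of _ ?a] conjI ballI allI)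
    fix z assume z: "z \<in> D"
    note dF = holomorphic_map_has_derivative[OF F z]
    have "((\<lambda>z. F z \<bullet> F z) has_derivative (\<lambda>v. 2 * (F z \<bullet> (jac F z *v v)))) (at z)"
      by (rule has_derivative_eq_rhs[OF has_derivative_inner[OF dF dF]])
        (simp add: inner_commute)
    from has_derivative_compose[OF this has_real_derivative_bump[unfolded has_field_derivative_def]]
    have "((\<lambda>z. bump (F z \<bullet> F z)) has_derivative (\<lambda>v. bump' (F z \<bullet> F z) * (2 * (F z \<bullet> (jac F z *v v))))) (at z)" .
    from has_derivative_of_real[OF this]
    have "((\<lambda>z. complex_of_real (bump ((norm (F z))\<^sup>2))) has_derivative
        (\<lambda>v. of_real (bump' ((norm (F z))\<^sup>2) * (2 * (F z \<bullet> (jac F z *v v)))))) (at z)"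
      by (simp add: power2_norm_eq_inner)
    moreover have "complex_of_real (bump' ((norm (F z))\<^sup>2) * (2 * (F z \<bullet> (jac F z *v v)))) =
        (\<Sum>k\<in>UNIV. ?a z k * v$k + ?b z k * cnj (v$k))" for v
    proof -
      have "complex_of_real (2 * (F z \<bullet> (jac F z *v v))) =
          (\<Sum>j\<in>UNIV. F z $ j * cnj (\<Sum>k\<in>UNIV. jac F z $ j $ k * v$k) + cnj (F z $ j) * (\<Sum>k\<in>UNIV. jac F z $ j $ k * v$k))"
        unfolding inner_complex_vec by (simp add: matrix_vector_mult_def)
      also have "\<dots> = (\<Sum>j\<in>UNIV. \<Sum>k\<in>UNIV. F z $ j * cnj (jac F z $ j $ k) * cnj (v$k) + cnj (F z $ j) * jac F z $ j $ k * v$k)"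
        by (simp add: sum_distrib_left sum.distrib mult.assoc)
      also have "\<dots> = (\<Sum>k\<in>UNIV. (\<Sum>j\<in>UNIV. cnj (F z $ j) * jac F z $ j $ k) * v$k + (\<Sum>j\<in>UNIV. F z $ j * cnj (jac F z $ j $ k)) * cnj (v$k))"
        by (subst sum.swap) (simp add: sum_distrib_right sum.distrib add.commute)
      finally show ?thesis
        unfolding of_real_mult[of "bump' _"] by (simp add: sum_distrib_left algebra_simps)
    qed
    ultimately show "wirt (\<lambda>z. of_real (bump ((norm (F z))\<^sup>2))) z (?a z) (?b z)"
      unfolding wirt_def by simp
  qed (intro continuous_intros contF contJ)+
qed

lemma det_cnj_mat: "det (cnj_mat A) = cnj (det A)" for A :: "complex^'n^'n"
  unfolding det_def by simp

text \<open>Cramer's rule: a combination of all rows, placed in row \<open>i\<close>, contributes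
  only its \<open>i\<close>-th coefficient times the determinant. The rest is
  multilinearity.\<close>

lemma det_row_combination:
  fixes A :: "complex^'n^'n"
  shows "det (row_subst i (\<lambda>k. c * (\<Sum>l\<in>UNIV. x l * A$l$k) + p * y k) A) =
    c * x i * det A + p * det (row_subst i y A)"
proof -
  let ?s = "\<Sum>l\<in>UNIV. (\<chi> l. x l)$l *s row l A"
  have "row_subst i (\<lambda>k. c * (\<Sum>l\<in>UNIV. x l * A$l$k) + p * y k) A =
      (\<chi> j. if j = i then c *s ?s + p *s (\<chi> k. y k) else row j A)"
    by (simp add: vec_eq_iff row_def)
  moreover have "row_subst i y A = (\<chi> j. if j = i then (\<chi> k. y k) else row j A)"
    by (simp add: vec_eq_iff row_def)
  ultimately show ?thesis
    using det_row_add[of i "\<lambda>_. c *s ?s" "\<lambda>_. p *s (\<chi> k. y k)" "\<lambda>j. row j A"]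
      det_row_mul[of i c "\<lambda>_. ?s" "\<lambda>j. row j A"] det_row_mul[of i p "\<lambda>_. \<chi> k. y k" "\<lambda>j. row j A"]
      cramer_lemma_transpose[of i "\<chi> l. x l" A]
    by (simp add: mult.assoc)
qed

text \<open>With a complex parameter t, the integrand is \<open>H\<close> times the derivative in
  the conjugate of t, at t = 0, of the bump at |F + t g|^2 times the squared modulus of the Jacobian
  determinant of F + t g. It is a sum over i of integrands of \<open>stokes_det\<close>, taken with
  the bump times the conjugate of the i-th component of \<open>g\<close>; the holomorphic factor
  there is \<open>H z * det (jac F z)\<close>.\<close>

lemma variation_has_integral_0:
  fixes F g :: "complex^'n \<Rightarrow> complex^'n"
  assumes D: "open D" "compact K" "K \<subseteq> D" "D \<subseteq> box lo hi"
    and H: "holomorphic_Cn H D" and F: "holomorphic_map_Cn F D" and g: "holomorphic_map_Cn g D"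
    and supp: "\<And>z. z \<in> D - K \<Longrightarrow> norm (F z) \<ge> 1"
  shows "((\<lambda>z. if z \<in> D then H z * det (jac F z) *
      (of_real (bump' ((norm (F z))\<^sup>2)) * (\<Sum>j\<in>UNIV. F z $ j * cnj (g z $ j)) * cnj (det (jac F z)) +
       of_real (bump ((norm (F z))\<^sup>2)) * cnj (\<Sum>i\<in>UNIV. det (row_subst i (\<lambda>k. jac g z $ i $ k) (jac F z))))
      else 0) has_integral 0) (cbox lo hi)"
proof -
  let ?p = "\<lambda>z. complex_of_real (bump ((norm (F z))\<^sup>2))"
  let ?q = "\<lambda>z. complex_of_real (bump' ((norm (F z))\<^sup>2))"
  have HJ: "holomorphic_Cn (\<lambda>z. H z * det (jac F z)) D"
    by (intro holomorphic_Cn_mult H holomorphic_det_jac D F)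
  have "((\<lambda>z. if z \<in> D then (H z * det (jac F z)) * (?q z * (F z $ i * cnj (g z $ i)) * cnj (det (jac F z)) +
      ?p z * cnj (det (row_subst i (\<lambda>k. jac g z $ i $ k) (jac F z)))) else 0) has_integral 0) (cbox lo hi)" for i
  proof -
    have gi: "holomorphic_Cn (\<lambda>z. g z $ i) D"
      using g by (simp add: holomorphic_map_Cn_def)
    have 1: "C1W D (\<lambda>z. ?p z * cnj (g z $ i))
      (\<lambda>z k. (?q z * (\<Sum>j\<in>UNIV. F z $ j * cnj (jac F z $ j $ k))) * cnj (g z $ i) + ?p z * cnj (jac g z $ i $ k))"
      using C1W_mult[OF C1W_bump[OF D(1) F] C1W_cnj_holomorphic[OF D(1) gi]] by (simp add: jac_def)
    have 2: "?p z * cnj (g z $ i) = 0" if "z \<in> D - K" for z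
      using supp[OF that] by (simp add: bump_eq_0)
    let ?b = "\<lambda>z k. (?q z * (\<Sum>j\<in>UNIV. F z $ j * cnj (jac F z $ j $ k))) * cnj (g z $ i) + ?p z * cnj (jac g z $ i $ k)"
    have 3: "det (row_subst i (?b z) (cnj_mat (jac F z))) =
        ?q z * (F z $ i * cnj (g z $ i)) * cnj (det (jac F z)) +
        ?p z * cnj (det (row_subst i (\<lambda>k. jac g z $ i $ k) (jac F z)))" for z
    proof -
      have "?b z = (\<lambda>k. (?q z * cnj (g z $ i)) * (\<Sum>l\<in>UNIV. F z $ l * cnj_mat (jac F z) $ l $ k) + ?p z * cnj (jac g z $ i $ k))"
        by (simp add: fun_eq_iff mult_ac)
      moreover have "row_subst i (\<lambda>k. cnj (jac g z $ i $ k)) (cnj_mat (jac F z)) =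
          cnj_mat (row_subst i (\<lambda>k. jac g z $ i $ k) (jac F z))"
        by (simp add: vec_eq_iff)
      ultimately show ?thesis
        by (simp only: det_row_combination det_cnj_mat) (simp add: mult_ac)
    qed
    show ?thesis
      using stokes_det[OF D HJ F 1 2, of i] unfolding 3 .
  qed
  then have "((\<lambda>z. \<Sum>i\<in>UNIV. if z \<in> D then (H z * det (jac F z)) * (?q z * (F z $ i * cnj (g z $ i)) * cnj (det (jac F z)) +
      ?p z * cnj (det (row_subst i (\<lambda>k. jac g z $ i $ k) (jac F z)))) else 0) has_integral (\<Sum>i::'n\<in>UNIV. 0)) (cbox lo hi)"
    by (intro has_integral_sum) auto
  moreover have "(\<Sum>i\<in>UNIV. if z \<in> D then (H z * det (jac F z)) * (?q z * (F z $ i * cnj (g z $ i)) * cnj (det (jac F z)) +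
      ?p z * cnj (det (row_subst i (\<lambda>k. jac g z $ i $ k) (jac F z)))) else 0) =
    (if z \<in> D then H z * det (jac F z) * (?q z * (\<Sum>j\<in>UNIV. F z $ j * cnj (g z $ j)) * cnj (det (jac F z)) +
       ?p z * cnj (\<Sum>i\<in>UNIV. det (row_subst i (\<lambda>k. jac g z $ i $ k) (jac F z)))) else 0)" for z
    by (simp add: sum.distrib sum_distrib_left sum_distrib_right algebra_simps)
  ultimately show ?thesis by simp
qed

section \<open>Integrals over the fibres of a holomorphic map\<close>

text \<open>For \<open>F = s (f - w)\<close> this is, up to a constant factor, a mollified sum of \<open>H\<close> over the fibre
  of \<open>f\<close> above \<open>w\<close>, each point counted with its multiplicity.\<close>

definition mass :: "(complex^'n) set \<Rightarrow> (complex^'n \<Rightarrow> complex) \<Rightarrow> (complex^'n \<Rightarrow> complex^'n) \<Rightarrow> complex"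
  where "mass D H F = integral D (\<lambda>z. H z *
    (of_real (bump ((norm (F z))\<^sup>2)) * (det (jac F z) * cnj (det (jac F z)))))"

section \<open>Jacobians of affine combinations and of scaled maps\<close>

lemma scaleR_complex_nth: "(t *\<^sub>R x) $ j = of_real t * x $ j" for x :: "complex^'n"
  by (simp add: scaleR_conv_of_real[where 'a = complex])

lemma pd_const: "pd k (\<lambda>z. c) z = 0"
  by (simp add: pd_def)

lemma jac_affine:
  assumes F: "holomorphic_map_Cn F D" "holomorphic_map_Cn G D" and z: "z \<in> D"
  shows "jac (\<lambda>z. F z + t *\<^sub>R G z) z = (\<chi> j k. jac F z $ j $ k + of_real t * jac G z $ j $ k)"
proof -
  have Fj: "holomorphic_Cn (\<lambda>z. F z $ j) D" "holomorphic_Cn (\<lambda>z. G z $ j) D" for j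
    using F by (auto simp: holomorphic_map_Cn_def)
  have "pd k (\<lambda>z. F z $ j + of_real t * G z $ j) z = pd k (\<lambda>z. F z $ j) z + of_real t * pd k (\<lambda>z. G z $ j) z" for j k
    using pd_add[OF Fj(1) holomorphic_Cn_cmult[OF Fj(2)] z] pd_cmult[OF Fj(2) z] by simp
  then show ?thesis
    unfolding jac_def vec_eq_iff vector_add_component scaleR_complex_nth by simp
qed

lemma holomorphic_map_affine:
  assumes "holomorphic_map_Cn F D" "holomorphic_map_Cn G D"
  shows "holomorphic_map_Cn (\<lambda>z. F z + t *\<^sub>R G z) D"
  using assms unfolding holomorphic_map_Cn_def
  by (auto simp: scaleR_conv_of_real[where 'a = complex] intro!: holomorphic_Cn_add holomorphic_Cn_cmult)

lemma holomorphic_map_const: "holomorphic_map_Cn (\<lambda>z. c) D"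
  by (simp add: holomorphic_map_Cn_def holomorphic_Cn_const)

lemma holomorphic_map_scale_shift:
  assumes "holomorphic_map_Cn f D"
  shows "holomorphic_map_Cn (\<lambda>z. s *\<^sub>R (f z - w)) D"
  using assms unfolding holomorphic_map_Cn_def
  by (auto simp: scaleR_conv_of_real[where 'a = complex]
      intro!: holomorphic_Cn_diff holomorphic_Cn_cmult holomorphic_Cn_const)

lemma det_smult_entries:
  "det (\<chi> j k. c * A $ j $ k) = c ^ CARD('n) * det A" for A :: "complex^'n^'n"
  unfolding det_def by (simp add: prod.distrib sum_distrib_left mult_ac)

lemma jac_scale_shift:
  assumes f: "holomorphic_map_Cn f D" and z: "z \<in> D"
  shows "jac (\<lambda>z. s *\<^sub>R (f z - w)) z = (\<chi> j k. of_real s * jac f z $ j $ k)"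
proof -
  have "jac (\<lambda>z. - (s *\<^sub>R w) + s *\<^sub>R f z) z = (\<chi> j k. jac (\<lambda>z. - (s *\<^sub>R w)) z $ j $ k + of_real s * jac f z $ j $ k)"
    by (rule jac_affine[OF holomorphic_map_const f z])
  moreover have "(\<lambda>z. - (s *\<^sub>R w) + s *\<^sub>R f z) = (\<lambda>z. s *\<^sub>R (f z - w))"
    by (simp add: fun_eq_iff scaleR_diff_right)
  moreover have "jac (\<lambda>z. - (s *\<^sub>R w)) z $ j $ k = 0" for j k
    unfolding jac_def by (simp only: vec_lambda_beta pd_const)
  ultimately show ?thesis by simp
qed

lemma det_row_subst_scale:
  "det (row_subst i (\<lambda>k. p * y k) A) = p * det (row_subst i y A)" for A :: "complex^'n^'n"
  using det_row_combination[of i 0 "\<lambda>_. 0" A p y] by simp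

lemma variation_has_integral_0_bounded:
  fixes F g :: "complex^'n \<Rightarrow> complex^'n"
  assumes D: "open D" "bounded D" "compact K" "K \<subseteq> D"
    and H: "holomorphic_Cn H D" and F: "holomorphic_map_Cn F D" and g: "holomorphic_map_Cn g D"
    and supp: "\<And>z. z \<in> D - K \<Longrightarrow> norm (F z) \<ge> 1"
  shows "((\<lambda>z. H z * det (jac F z) *
      (of_real (bump' ((norm (F z))\<^sup>2)) * (\<Sum>j\<in>UNIV. F z $ j * cnj (g z $ j)) * cnj (det (jac F z)) +
       of_real (bump ((norm (F z))\<^sup>2)) * cnj (\<Sum>i\<in>UNIV. det (row_subst i (\<lambda>k. jac g z $ i $ k) (jac F z)))))
      has_integral 0) D"
proof -
  obtain a where "D \<subseteq> box (-a) a"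
    using bounded_subset_box_symmetric[OF D(2)] by blast
  moreover from this have "D \<subseteq> cbox (-a) a"
    using box_subset_cbox by blast
  ultimately show ?thesis
    using variation_has_integral_0[OF D(1,3,4) _ H F g supp, of "-a" a] by simp
qed

text \<open>Integrability over \<open>S\<close> and that of the zero extension over \<open>T\<close>
  are equivalent, so both sides take the default value together.\<close>

lemma integral_zero_extension:
  fixes g :: "'a::euclidean_space \<Rightarrow> 'b::banach"
  assumes "S \<subseteq> T"
  shows "integral T (\<lambda>z. if z \<in> S then g z else 0) = integral S g"
  using assms by (simp add: integral_def integrable_on_def)

section \<open>Integrals depending on a parameter\<close>

lemma continuous_on_zero_extension_param:
  fixes g :: "'c::t2_space \<Rightarrow> 'a::t2_space \<Rightarrow> 'b::{topological_space, zero}"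
  assumes "open W" "open D" "closed K" "K \<subseteq> D" "continuous_on (W \<times> D) (\<lambda>x. g (fst x) (snd x))"
    "\<And>w z. w \<in> W \<Longrightarrow> z \<in> D - K \<Longrightarrow> g w z = 0"
  shows "continuous_on (W \<times> S) (\<lambda>(w, z). if z \<in> D then g w z else 0)"
proof -
  have "continuous_on (W \<times> D \<union> W \<times> - K) (\<lambda>x. if snd x \<in> D then g (fst x) (snd x) else 0)"
  proof (rule continuous_on_open_Un)
    show "continuous_on (W \<times> D) (\<lambda>x. if snd x \<in> D then g (fst x) (snd x) else 0)"
      by (rule continuous_on_eq[OF assms(5)]) auto
    show "continuous_on (W \<times> - K) (\<lambda>x. if snd x \<in> D then g (fst x) (snd x) else 0)"
      by (rule continuous_on_eq[OF continuous_on_const[of _ 0]]) (use assms in auto)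
  qed (use assms in \<open>auto intro: open_Times\<close>)
  then show ?thesis
    unfolding split_beta by (rule continuous_on_subset) (use assms(4) in auto)
qed

lemma continuous_on_det:
  fixes A :: "'a::topological_space \<Rightarrow> complex^'n^'n"
  assumes "\<And>i j. continuous_on S (\<lambda>x. A x $ i $ j)"
  shows "continuous_on S (\<lambda>x. det (A x))"
  unfolding det_def by (intro continuous_intros assms)

lemma continuous_on_jac:
  assumes "open D" "holomorphic_map_Cn f D"
  shows "continuous_on D (\<lambda>z. jac f z $ j $ k)"
  using assms by (simp add: jac_def continuous_on_pd holomorphic_map_Cn_def)

lemma inner_scaled_complex_vec:
  "complex_of_real (2 * (x \<bullet> y)) = (\<Sum>j\<in>UNIV. x$j * cnj (y$j)) + cnj (\<Sum>j\<in>UNIV. x$j * cnj (y$j))"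
  for x y :: "complex^'n"
  unfolding inner_complex_vec by (simp add: sum.distrib)

text \<open>The derivative under the integral is only real-linear; its integrand splits into a
  complex-linear and an antilinear part. The antilinear one is the variation of the map in the
  constant direction \<open>v\<close> and integrates to 0. A single compact \<open>K\<close> for all
  \<open>w\<close> near \<open>w0\<close> makes the zero-extended integrand jointly
  continuous.\<close>

lemma mass_translate:
  fixes f :: "complex^'n \<Rightarrow> complex^'n"
  assumes D: "open D" "bounded D" and H: "holomorphic_Cn H D" and f: "holomorphic_map_Cn f D"
    and K: "compact K" "K \<subseteq> D" and \<delta>: "\<delta> > 0"
    and supp: "\<And>w z. w \<in> ball w0 \<delta> \<Longrightarrow> z \<in> D - K \<Longrightarrow> norm (s *\<^sub>R (f z - w)) \<ge> 1"
  shows "\<exists>L. ((\<lambda>w. mass D H (\<lambda>z. s *\<^sub>R (f z - w))) has_derivative L) (at w0) \<and> (\<forall>a v. L (a *s v) = a * L v)"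
proof -
  obtain b where b: "D \<subseteq> cbox (-b) b"
    using bounded_subset_cbox_symmetric[OF D(2)] by blast
  define F where "F w z = s *\<^sub>R (f z - w)" for w z
  define J where "J z = det (\<chi> j k. of_real s * jac f z $ j $ k)" for z
  define A where "A z = H z * (J z * cnj (J z))" for z
  have JF: "det (jac (F w) z) = J z" if "z \<in> D" for w z
    unfolding F_def J_def jac_scale_shift[OF f that] ..
  define g where "g w z = A z * of_real (bump ((norm (F w z))\<^sup>2))" for w z
  define g' where "g' w z = blinfun_scaleR_left (A z * of_real (bump' ((norm (F w z))\<^sup>2) * (- 2 * s)))
      o\<^sub>L blinfun_inner_right (F w z)" for w z
  have mass: "mass D H (F w) = integral (cbox (-b) b) (\<lambda>z. if z \<in> D then g w z else 0)" for w
    unfolding integral_zero_extension[OF b] mass_def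
    by (rule integral_cong) (simp add: JF g_def A_def mult_ac)
  have contJ: "continuous_on D J"
    unfolding J_def
    by (rule continuous_on_det) (simp, intro continuous_intros continuous_on_jac D f)
  have contA: "continuous_on D A"
    unfolding A_def by (intro continuous_intros holomorphic_Cn_continuous_on[OF H] contJ)
  have contf: "continuous_on D f"
    by (rule holomorphic_map_continuous_on[OF f])
  note cont2 = continuous_on_compose2[OF contA continuous_on_snd[OF continuous_on_id], of "_ \<times> D", unfolded id_def]
    continuous_on_compose2[OF contf continuous_on_snd[OF continuous_on_id], of "_ \<times> D", unfolded id_def]
  have contg: "continuous_on (W \<times> D) (\<lambda>x. g (fst x) (snd x))" for W
    unfolding g_def F_def by (intro continuous_intros cont2) auto
  have contg': "continuous_on (W \<times> D) (\<lambda>x. g' (fst x) (snd x))" for W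
    unfolding g'_def F_def
    by (intro bounded_bilinear.continuous_on[OF bounded_bilinear_blinfun_compose]
        bounded_linear.continuous_on[OF bounded_linear_blinfun_scaleR_left]
        bounded_linear.continuous_on[OF bounded_linear_blinfun_inner_right] continuous_intros cont2) auto
  have g0: "g w z = 0 \<and> g' w z = 0" if "w \<in> ball w0 \<delta>" "z \<in> D - K" for w z
  proof -
    have "(norm (F w z))\<^sup>2 \<ge> 1"
      using supp[OF that] by (simp add: F_def)
    then show ?thesis
      by (auto intro!: blinfun_eqI simp: g_def g'_def bump_eq_0 bump'_eq_0)
  qed
  have contg0: "continuous_on (ball w0 \<delta> \<times> cbox (-b) b) (\<lambda>(w, z). if z \<in> D then g w z else 0)"
    and contg0': "continuous_on (ball w0 \<delta> \<times> cbox (-b) b) (\<lambda>(w, z). if z \<in> D then g' w z else 0)"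
    using D(1) K compact_imp_closed[OF K(1)] g0 contg contg'
    by (auto intro!: continuous_on_zero_extension_param[where K = K])
  let ?I = "integral (cbox (-b) b) (\<lambda>z. if z \<in> D then g' w0 z else 0)"
  have cont1: "continuous_on (cbox (-b) b) (\<lambda>z. k (w, z))" if "continuous_on (ball w0 \<delta> \<times> cbox (-b) b) k" "w \<in> ball w0 \<delta>"
    for k :: "_ \<Rightarrow> 'z::topological_space" and w
    by (rule continuous_on_compose2[OF that(1)]) (use that(2) in \<open>auto intro!: continuous_intros\<close>)
  have "((\<lambda>w. integral (cbox (-b) b) (\<lambda>z. if z \<in> D then g w z else 0)) has_derivative ?I) (at w0 within ball w0 \<delta>)"
  proof (rule leibniz_rule)
    fix w z assume "w \<in> ball w0 \<delta>"
    show "((\<lambda>w. if z \<in> D then g w z else 0) has_derivative blinfun_apply (if z \<in> D then g' w z else 0)) (at w within ball w0 \<delta>)"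
    proof (cases "z \<in> D")
      case True
      have dF: "((\<lambda>w. F w z) has_derivative (\<lambda>v. - (s *\<^sub>R v))) (at w)"
        unfolding F_def by (auto intro!: derivative_eq_intros)
      have "((\<lambda>w. F w z \<bullet> F w z) has_derivative (\<lambda>v. - 2 * s * (F w z \<bullet> v))) (at w)"
        by (rule has_derivative_eq_rhs[OF has_derivative_inner[OF dF dF]]) (simp add: inner_commute fun_eq_iff)
      from has_derivative_compose[OF this has_real_derivative_bump[unfolded has_field_derivative_def]]
      have "((\<lambda>w. bump (F w z \<bullet> F w z)) has_derivative (\<lambda>v. bump' (F w z \<bullet> F w z) * (- 2 * s * (F w z \<bullet> v)))) (at w)" .
      from has_derivative_mult_right[OF has_derivative_of_real[OF this], of "A z"]
      have "((\<lambda>w. g w z) has_derivative g' w z) (at w)"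
        unfolding g_def power2_norm_eq_inner
        by (rule has_derivative_eq_rhs)
          (simp add: g'_def power2_norm_eq_inner fun_eq_iff scaleR_conv_of_real[where 'a = complex] mult_ac)
      with True show ?thesis
        by (simp add: has_derivative_at_withinI)
    next
      case False
      then show ?thesis
        by (simp add: zero_blinfun.rep_eq)
    qed
  next
    fix w assume "w \<in> ball w0 \<delta>"
    from cont1[OF contg0 this] show "(\<lambda>z. if z \<in> D then g w z else 0) integrable_on cbox (-b) b"
      by (intro integrable_continuous) simp
  next
    show "continuous_on (ball w0 \<delta> \<times> cbox (-b) b) (\<lambda>(w, z). if z \<in> D then g' w z else 0)"
      by (rule contg0')
  qed (use \<delta> in auto)
  moreover have "at w0 within ball w0 \<delta> = at w0"
    using at_within_open[of w0 "ball w0 \<delta>"] \<delta> by auto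
  ultimately have der: "((\<lambda>w. mass D H (F w)) has_derivative ?I) (at w0)"
    unfolding mass by simp
  have I: "((\<lambda>z. - of_real s * (A z * of_real (bump' ((norm (F w0 z))\<^sup>2)) * (\<Sum>j\<in>UNIV. cnj (F w0 z $ j) * v $ j)))
      has_integral blinfun_apply ?I v) D" for v
  proof -
    have w0: "w0 \<in> ball w0 \<delta>" using \<delta> by simp
    have int: "(\<lambda>z. if z \<in> D then g' w0 z else 0) integrable_on cbox (-b) b"
      using cont1[OF contg0' w0] by (intro integrable_continuous) simp
    have "((\<lambda>z. blinfun_apply (if z \<in> D then g' w0 z else 0) v) has_integral blinfun_apply ?I v) (cbox (-b) b)"
      using has_integral_linear[OF integrable_integral[OF int] blinfun.bounded_linear_left[of v]]
      by (simp add: o_def)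
    moreover have "(\<lambda>z. blinfun_apply (if z \<in> D then g' w0 z else 0) v) = (\<lambda>z. if z \<in> D then g' w0 z v else 0)"
      by (simp add: fun_eq_iff)
    ultimately have 1: "((\<lambda>z. g' w0 z v) has_integral blinfun_apply ?I v) D"
      using b by simp
    have supp0: "norm (F w0 z) \<ge> 1" if "z \<in> D - K" for z
      using supp[OF w0 that] by (simp add: F_def)
    have row0: "det (row_subst i (\<lambda>k. 0) B) = 0" for i and B :: "complex^'n^'n"
      using det_row_subst_scale[of i 0 "\<lambda>_. 0" B] by simp
    have FwD: "holomorphic_map_Cn (F w0) D"
      unfolding F_def by (rule holomorphic_map_scale_shift[OF f])
    \<comment> \<open>A constant perturbation has zero Jacobian, so the determinants with a replaced
      row drop out of the variation.\<close>
    have "((\<lambda>z. H z * det (jac (F w0) z) *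
      (of_real (bump' ((norm (F w0 z))\<^sup>2)) * (\<Sum>j\<in>UNIV. F w0 z $ j * cnj (v $ j)) * cnj (det (jac (F w0) z))))
      has_integral 0) D"
      using variation_has_integral_0_bounded[OF D K H FwD holomorphic_map_const[of v] supp0]
      by (simp add: jac_def[of "\<lambda>z. v"] pd_const row0)
    then have "((\<lambda>z. A z * of_real (bump' ((norm (F w0 z))\<^sup>2)) * (\<Sum>j\<in>UNIV. F w0 z $ j * cnj (v $ j)))
      has_integral 0) D"
      by (rule has_integral_eq[rotated]) (simp add: JF A_def mult_ac)
    from has_integral_add[OF 1 has_integral_mult_right[OF this, of "of_real s"]]
    have "((\<lambda>z. g' w0 z v + of_real s * (A z * of_real (bump' ((norm (F w0 z))\<^sup>2)) * (\<Sum>j\<in>UNIV. F w0 z $ j * cnj (v $ j))))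
      has_integral blinfun_apply ?I v) D" by simp
    then show ?thesis
    proof (rule has_integral_eq[rotated])
      fix z
      have "blinfun_apply (g' w0 z) v = - of_real s * (A z * of_real (bump' ((norm (F w0 z))\<^sup>2))) * of_real (2 * (F w0 z \<bullet> v))"
        by (simp add: g'_def scaleR_conv_of_real mult_ac)
      also have "of_real (2 * (F w0 z \<bullet> v)) = (\<Sum>j\<in>UNIV. F w0 z $ j * cnj (v $ j)) + (\<Sum>j\<in>UNIV. cnj (F w0 z $ j) * v $ j)"
        unfolding inner_complex_vec sum.distrib ..
      finally show "blinfun_apply (g' w0 z) v + of_real s * (A z * of_real (bump' ((norm (F w0 z))\<^sup>2)) * (\<Sum>j\<in>UNIV. F w0 z $ j * cnj (v $ j))) =
          - of_real s * (A z * of_real (bump' ((norm (F w0 z))\<^sup>2)) * (\<Sum>j\<in>UNIV. cnj (F w0 z $ j) * v $ j))"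
        by (simp add: algebra_simps)
    qed
  qed
  have "blinfun_apply ?I (a *s v) = a * blinfun_apply ?I v" for a v
  proof -
    have "((\<lambda>z. - of_real s * (A z * of_real (bump' ((norm (F w0 z))\<^sup>2)) * (\<Sum>j\<in>UNIV. cnj (F w0 z $ j) * (a *s v) $ j)))
      has_integral a * blinfun_apply ?I v) D"
      by (rule has_integral_eq[OF _ has_integral_mult_right[OF I[of v], of a]]) (simp add: sum_distrib_left mult_ac)
    then show ?thesis
      using I has_integral_unique by blast
  qed
  with der show ?thesis
    unfolding F_def by blast
qed

lemma has_field_derivative_det_affine:
  fixes A B :: "complex^'n^'n"
  shows "((\<lambda>u. det (\<chi> j k. A $ j $ k + u * B $ j $ k)) has_field_derivative
    (\<Sum>i\<in>UNIV. det (row_subst i (\<lambda>k. B $ i $ k) (\<chi> j k. A $ j $ k + u * B $ j $ k)))) (at u)"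
proof -
  let ?M = "(\<chi> j k. A $ j $ k + u * B $ j $ k) :: complex^'n^'n"
  let ?P = "{\<sigma>::'n \<Rightarrow> 'n. \<sigma> permutes UNIV}"
  have "((\<lambda>u. \<Sum>\<sigma>\<in>?P. of_int (sign \<sigma>) * (\<Prod>j\<in>UNIV. A $ j $ \<sigma> j + u * B $ j $ \<sigma> j)) has_field_derivative
    (\<Sum>\<sigma>\<in>?P. of_int (sign \<sigma>) * (\<Sum>i\<in>UNIV. B $ i $ \<sigma> i * (\<Prod>j\<in>UNIV-{i}. A $ j $ \<sigma> j + u * B $ j $ \<sigma> j)))) (at u)"
    by (intro DERIV_sum DERIV_cmult has_field_derivative_prod) (auto intro!: derivative_eq_intros)
  moreover have "(\<Sum>\<sigma>\<in>?P. of_int (sign \<sigma>) * (\<Sum>i\<in>UNIV. B $ i $ \<sigma> i * (\<Prod>j\<in>UNIV-{i}. A $ j $ \<sigma> j + u * B $ j $ \<sigma> j))) =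
      (\<Sum>i\<in>UNIV. det (row_subst i (\<lambda>k. B $ i $ k) ?M))"
    unfolding sum_distrib_left det_def
  proof (subst sum.swap, intro sum.cong refl arg_cong2[of _ _ _ _ "(*)"])
    fix i :: 'n and \<sigma> :: "'n \<Rightarrow> 'n"
    have "(\<Prod>j\<in>UNIV. row_subst i (\<lambda>k. B $ i $ k) ?M $ j $ \<sigma> j) =
        B $ i $ \<sigma> i * (\<Prod>j\<in>UNIV-{i}. row_subst i (\<lambda>k. B $ i $ k) ?M $ j $ \<sigma> j)"
      by (subst prod.remove[of _ i]) auto
    also have "(\<Prod>j\<in>UNIV-{i}. row_subst i (\<lambda>k. B $ i $ k) ?M $ j $ \<sigma> j) =
        (\<Prod>j\<in>UNIV-{i}. A $ j $ \<sigma> j + u * B $ j $ \<sigma> j)"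
      by (rule prod.cong) auto
    finally show "B $ i $ \<sigma> i * (\<Prod>j\<in>UNIV-{i}. A $ j $ \<sigma> j + u * B $ j $ \<sigma> j) =
        (\<Prod>j\<in>UNIV. row_subst i (\<lambda>k. B $ i $ k) ?M $ j $ \<sigma> j)"
      by simp
  qed
  ultimately show ?thesis
    by (simp add: det_def)
qed

text \<open>For a real parameter the derivative of the weight is the sum of the halves
  \<open>V\<close> and \<open>cnj V\<close>, and Stokes' theorem disposes of
  \<open>H z * V t0 z\<close> only. The factor \<open>H\<close> keeps the two products from being
  conjugate to each other, so each application treats the second half in its own way.\<close>

lemma mass_homotopy:
  fixes F0 F1 :: "complex^'n \<Rightarrow> complex^'n"
  assumes D: "open D" "bounded D" and H: "holomorphic_Cn H D"
    and F0: "holomorphic_map_Cn F0 D" and F1: "holomorphic_map_Cn F1 D"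
    and K: "compact K" "K \<subseteq> D" and T: "open T" "convex T" "t0 \<in> T"
    and supp: "\<forall>t\<in>T. \<forall>z\<in>D - K. norm (F0 z + t *\<^sub>R F1 z) \<ge> 1"
  defines "F \<equiv> \<lambda>t z. F0 z + t *\<^sub>R F1 z"
  defines "V \<equiv> \<lambda>t z. det (jac (F t) z) *
      (of_real (bump' ((norm (F t z))\<^sup>2)) * (\<Sum>j\<in>UNIV. F t z $ j * cnj (F1 z $ j)) * cnj (det (jac (F t) z)) +
       of_real (bump ((norm (F t z))\<^sup>2)) * cnj (\<Sum>i\<in>UNIV. det (row_subst i (\<lambda>k. jac F1 z $ i $ k) (jac (F t) z))))"
  shows "((\<lambda>t. mass D H (F t)) has_vector_derivative integral D (\<lambda>z. H z * (V t0 z + cnj (V t0 z)))) (at t0 within T)"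
    and "((\<lambda>z. H z * V t0 z) has_integral 0) D"
proof -
  obtain b where b: "D \<subseteq> cbox (-b) b"
    using bounded_subset_cbox_symmetric[OF D(2)] by blast
  define M where "M t z = (\<chi> j k. jac F0 z $ j $ k + of_real t * jac F1 z $ j $ k)" for t z
  have JF: "jac (F t) z = M t z" if "z \<in> D" for t z
    unfolding F_def M_def by (rule jac_affine[OF F0 F1 that])
  define S where "S t z = (\<Sum>j\<in>UNIV. F t z $ j * cnj (F1 z $ j))" for t z
  define J' where "J' t z = (\<Sum>i\<in>UNIV. det (row_subst i (\<lambda>k. jac F1 z $ i $ k) (M t z)))" for t z
  define W where "W t z = det (M t z) * (of_real (bump' ((norm (F t z))\<^sup>2)) * S t z * cnj (det (M t z)) +
      of_real (bump ((norm (F t z))\<^sup>2)) * cnj (J' t z))" for t z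
  have VW: "V t z = W t z" if "z \<in> D" for t z
    by (simp add: V_def W_def S_def J'_def JF[OF that])
  define g where "g t z = H z * (of_real (bump ((norm (F t z))\<^sup>2)) * (det (M t z) * cnj (det (M t z))))" for t z
  define g' where "g' t z = H z * (W t z + cnj (W t z))" for t z
  have mass: "mass D H (F t) = integral (cbox (-b) b) (\<lambda>z. if z \<in> D then g t z else 0)" for t
    unfolding integral_zero_extension[OF b] mass_def
    by (rule integral_cong) (simp add: JF g_def)
  have contH: "continuous_on D H"
    by (rule holomorphic_Cn_continuous_on[OF H])
  have contF: "continuous_on D F0" "continuous_on D F1"
    by (rule holomorphic_map_continuous_on[OF F0], rule holomorphic_map_continuous_on[OF F1])
  have contJ: "continuous_on D (\<lambda>z. jac F0 z $ j $ k)" "continuous_on D (\<lambda>z. jac F1 z $ j $ k)" for j k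
    by (rule continuous_on_jac[OF D(1) F0], rule continuous_on_jac[OF D(1) F1])
  have cont2: "continuous_on (T \<times> D) (\<lambda>x. k (snd x))" if "continuous_on D k" for k :: "_ \<Rightarrow> 'z::topological_space"
    by (rule continuous_on_compose2[OF that]) (auto intro!: continuous_intros)
  note c2 = cont2[OF contH] cont2[OF contF(1)] cont2[OF contF(2)] cont2[OF contJ(1)] cont2[OF contJ(2)]
  have contM: "continuous_on (T \<times> D) (\<lambda>x. M (fst x) (snd x) $ j $ k)" for j k
    unfolding M_def by simp (intro continuous_intros c2)
  have contF2: "continuous_on (T \<times> D) (\<lambda>x. F (fst x) (snd x))"
    unfolding F_def by (intro continuous_intros c2)
  have "continuous_on (T \<times> D) (\<lambda>x. row_subst i (\<lambda>k. jac F1 (snd x) $ i $ k) (M (fst x) (snd x)) $ j $ k)" for i j k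
    by (cases "j = i") (simp_all add: c2 contM)
  then have contJ': "continuous_on (T \<times> D) (\<lambda>x. J' (fst x) (snd x))"
    unfolding J'_def by (intro continuous_on_sum continuous_on_det)
  have contdet: "continuous_on (T \<times> D) (\<lambda>x. det (M (fst x) (snd x)))"
    by (rule continuous_on_det) (rule contM)
  have contS: "continuous_on (T \<times> D) (\<lambda>x. S (fst x) (snd x))"
    unfolding S_def by (intro continuous_intros contF2 c2)
  have contW: "continuous_on (T \<times> D) (\<lambda>x. W (fst x) (snd x))"
    unfolding W_def by (intro continuous_intros contF2 contdet contS contJ')
  have contg: "continuous_on (T \<times> D) (\<lambda>x. g (fst x) (snd x))"
    unfolding g_def by (intro continuous_intros contF2 contdet c2)
  have contg': "continuous_on (T \<times> D) (\<lambda>x. g' (fst x) (snd x))"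
    unfolding g'_def by (intro continuous_intros contW c2)
  have g0: "g t z = 0 \<and> g' t z = 0" if "t \<in> T" "z \<in> D - K" for t z
  proof -
    have "(norm (F t z))\<^sup>2 \<ge> 1"
      using supp that by (simp add: F_def)
    then show ?thesis
      by (simp add: g_def g'_def W_def bump_eq_0 bump'_eq_0)
  qed
  have contg0: "continuous_on (T \<times> cbox (-b) b) (\<lambda>(t, z). if z \<in> D then g t z else 0)"
    and contg0': "continuous_on (T \<times> cbox (-b) b) (\<lambda>(t, z). if z \<in> D then g' t z else 0)"
    using D(1) K compact_imp_closed[OF K(1)] g0 contg contg' T(1)
    by (auto intro!: continuous_on_zero_extension_param[where K = K])
  have "((\<lambda>t. integral (cbox (-b) b) (\<lambda>z. if z \<in> D then g t z else 0)) has_vector_derivative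
      integral (cbox (-b) b) (\<lambda>z. if z \<in> D then g' t0 z else 0)) (at t0 within T)"
  proof (rule leibniz_rule_vector_derivative)
    fix t z assume "t \<in> T"
    show "((\<lambda>t. if z \<in> D then g t z else 0) has_vector_derivative (if z \<in> D then g' t z else 0)) (at t within T)"
    proof (cases "z \<in> D")
      case True
      have dF: "((\<lambda>t. F t z) has_derivative (\<lambda>\<tau>. \<tau> *\<^sub>R F1 z)) (at t)"
        unfolding F_def by (auto intro!: derivative_eq_intros)
      have "((\<lambda>t. F t z \<bullet> F t z) has_real_derivative 2 * (F t z \<bullet> F1 z)) (at t)"
        unfolding has_field_derivative_def
        by (rule has_derivative_eq_rhs[OF has_derivative_inner[OF dF dF]]) (simp add: inner_commute fun_eq_iff)
      from DERIV_chain'[OF this has_real_derivative_bump]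
      have 1: "((\<lambda>t. complex_of_real (bump ((norm (F t z))\<^sup>2))) has_vector_derivative
          of_real (bump' ((norm (F t z))\<^sup>2)) * of_real (2 * (F t z \<bullet> F1 z))) (at t)"
        unfolding power2_norm_eq_inner of_real_mult[symmetric]
        by (intro has_vector_derivative_of_real)
      have 2: "((\<lambda>t. det (M t z)) has_vector_derivative J' t z) (at t)"
        unfolding J'_def M_def
        by (rule has_vector_derivative_real_field[OF has_field_derivative_det_affine])
      have "((\<lambda>t. g t z) has_vector_derivative H z * (of_real (bump ((norm (F t z))\<^sup>2)) *
          (det (M t z) * cnj (J' t z) + J' t z * cnj (det (M t z))) +
          of_real (bump' ((norm (F t z))\<^sup>2)) * of_real (2 * (F t z \<bullet> F1 z)) * (det (M t z) * cnj (det (M t z))))) (at t)"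
        unfolding g_def by (intro has_vector_derivative_mult_right has_vector_derivative_mult has_vector_derivative_cnj 1 2)
      moreover have "of_real (bump ((norm (F t z))\<^sup>2)) *
          (det (M t z) * cnj (J' t z) + J' t z * cnj (det (M t z))) +
          of_real (bump' ((norm (F t z))\<^sup>2)) * of_real (2 * (F t z \<bullet> F1 z)) * (det (M t z) * cnj (det (M t z))) =
          W t z + cnj (W t z)"
        unfolding inner_scaled_complex_vec S_def[symmetric] by (simp add: W_def algebra_simps)
      ultimately show ?thesis
        using True by (simp add: g'_def has_vector_derivative_at_within)
    qed simp
  next
    fix t assume "t \<in> T"
    have "continuous_on (cbox (-b) b) (\<lambda>z. (\<lambda>(t, z). if z \<in> D then g t z else 0) (t, z))"
      by (rule continuous_on_compose2[OF contg0]) (use \<open>t \<in> T\<close> in \<open>auto intro!: continuous_intros\<close>)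
    then show "(\<lambda>z. if z \<in> D then g t z else 0) integrable_on cbox (-b) b"
      by (intro integrable_continuous) simp
  qed (use T contg0' in auto)
  then show "((\<lambda>t. mass D H (F t)) has_vector_derivative integral D (\<lambda>z. H z * (V t0 z + cnj (V t0 z)))) (at t0 within T)"
    unfolding mass integral_zero_extension[OF b] g'_def
    by (rule has_vector_derivative_eq_rhs) (auto intro!: integral_cong simp: VW)
  have "norm (F t0 z) \<ge> 1" if "z \<in> D - K" for z
    using supp T(3) that by (simp add: F_def)
  from variation_has_integral_0_bounded[OF D K H _ F1 this]
  show "((\<lambda>z. H z * V t0 z) has_integral 0) D"
    using holomorphic_map_affine[OF F0 F1] unfolding V_def F_def by (simp add: mult.assoc)
qed

text \<open>With \<open>H = 1\<close> the second half of the variation is the conjugate of the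
  first, so it integrates to 0 too. This is the homotopy invariance of the degree.\<close>

lemma mass_perturb:
  fixes F0 F1 :: "complex^'n \<Rightarrow> complex^'n"
  assumes D: "open D" "bounded D"
    and F0: "holomorphic_map_Cn F0 D" and F1: "holomorphic_map_Cn F1 D"
    and K: "compact K" "K \<subseteq> D" and T: "open T" "convex T"
    and supp: "\<And>t z. t \<in> T \<Longrightarrow> z \<in> D - K \<Longrightarrow> norm (F0 z + t *\<^sub>R F1 z) \<ge> 1"
    and t: "t1 \<in> T" "t2 \<in> T"
  shows "mass D (\<lambda>z. 1) (\<lambda>z. F0 z + t1 *\<^sub>R F1 z) = mass D (\<lambda>z. 1) (\<lambda>z. F0 z + t2 *\<^sub>R F1 z)"
proof -
  have der: "((\<lambda>t. mass D (\<lambda>z. 1) (\<lambda>z. F0 z + t *\<^sub>R F1 z)) has_vector_derivative 0) (at t within T)" if "t \<in> T" for t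
  proof -
    have "\<forall>t\<in>T. \<forall>z\<in>D - K. norm (F0 z + t *\<^sub>R F1 z) \<ge> 1"
      using supp by blast
    note * = mass_homotopy[OF D holomorphic_Cn_const F0 F1 K T that this, of 1]
    have "integral D (\<lambda>z. 1 * (W z + cnj (W z))) = 0" if "((\<lambda>z. 1 * W z) has_integral 0) D" for W
      using has_integral_add[OF that has_integral_cnj[THEN iffD2, OF that]] by (simp add: o_def integral_unique)
    from *(1)[unfolded this[OF *(2)]] show ?thesis .
  qed
  obtain c where "\<And>t. t \<in> T \<Longrightarrow> mass D (\<lambda>z. 1) (\<lambda>z. F0 z + t *\<^sub>R F1 z) = c"
    using has_vector_derivative_zero_constant[OF T(2) der] by blast
  from this[OF t(1)] this[OF t(2)] show ?thesis by simp
qed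

text \<open>Along a scaling, \<open>V\<close> is real: the map is a real multiple of its own
  variation, so their Hermitian product is real, and the derivative of the Jacobian determinant is
  the determinant times the dimension divided by the scale. Hence the second half of the variation
  equals the first, for every \<open>H\<close>.\<close>

lemma mass_scale:
  fixes f :: "complex^'n \<Rightarrow> complex^'n"
  assumes D: "open D" "bounded D" and H: "holomorphic_Cn H D" and f: "holomorphic_map_Cn f D"
    and K: "compact K" "K \<subseteq> D" and a: "a > 0"
    and supp: "\<And>z. z \<in> D - K \<Longrightarrow> a * norm (f z - w) \<ge> 1"
    and s: "s1 > a" "s2 > a"
  shows "mass D H (\<lambda>z. s1 *\<^sub>R (f z - w)) = mass D H (\<lambda>z. s2 *\<^sub>R (f z - w))"
proof -
  let ?F1 = "\<lambda>z. f z - w"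
  have F1: "holomorphic_map_Cn ?F1 D"
    using holomorphic_map_scale_shift[OF f, of 1 w] by simp
  have der: "((\<lambda>s. mass D H (\<lambda>z. 0 + s *\<^sub>R ?F1 z)) has_vector_derivative 0) (at s within {a<..})" if "s \<in> {a<..}" for s
  proof -
    have "\<forall>t\<in>{a<..}. \<forall>z\<in>D - K. norm (0 + t *\<^sub>R ?F1 z) \<ge> 1"
    proof (intro ballI)
      fix t z assume that: "t \<in> {a<..}" "z \<in> D - K"
      have "a * norm (?F1 z) \<le> t * norm (?F1 z)"
        using that by (intro mult_right_mono) auto
      then show "norm (0 + t *\<^sub>R ?F1 z) \<ge> 1"
        using supp[OF that(2)] that a by simp
    qed
    note * = mass_homotopy[OF D H holomorphic_map_const[of 0] F1 K open_greaterThan convex_real_interval(3) that this]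
    define V where "V z = det (jac (\<lambda>z. 0 + s *\<^sub>R ?F1 z) z) *
      (of_real (bump' ((norm (0 + s *\<^sub>R ?F1 z))\<^sup>2)) * (\<Sum>j\<in>UNIV. (0 + s *\<^sub>R ?F1 z) $ j * cnj (?F1 z $ j)) * cnj (det (jac (\<lambda>z. 0 + s *\<^sub>R ?F1 z) z)) +
       of_real (bump ((norm (0 + s *\<^sub>R ?F1 z))\<^sup>2)) * cnj (\<Sum>i\<in>UNIV. det (row_subst i (\<lambda>k. jac ?F1 z $ i $ k) (jac (\<lambda>z. 0 + s *\<^sub>R ?F1 z) z))))" for z
    have real: "cnj (V z) = V z" if "z \<in> D" for z
    proof -
      have s0: "s > 0"
        using \<open>s \<in> {a<..}\<close> a by simp
      have J: "jac (\<lambda>z. s *\<^sub>R ?F1 z) z $ j $ k = of_real s * jac ?F1 z $ j $ k" for j k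
        using jac_scale_shift[OF f that, of s w] jac_scale_shift[OF f that, of 1 w] by simp
      have "row_subst i (\<lambda>k. of_real s * jac ?F1 z $ i $ k) (jac (\<lambda>z. s *\<^sub>R ?F1 z) z) = jac (\<lambda>z. s *\<^sub>R ?F1 z) z" for i
        by (simp add: vec_eq_iff J)
      then have row: "of_real s * det (row_subst i (\<lambda>k. jac ?F1 z $ i $ k) (jac (\<lambda>z. s *\<^sub>R ?F1 z) z)) =
          det (jac (\<lambda>z. s *\<^sub>R ?F1 z) z)" for i
        by (metis det_row_subst_scale)
      have rowsum: "(\<Sum>i\<in>UNIV. det (row_subst i (\<lambda>k. jac ?F1 z $ i $ k) (jac (\<lambda>z. s *\<^sub>R ?F1 z) z))) =
          of_real (real CARD('n) / s) * det (jac (\<lambda>z. s *\<^sub>R ?F1 z) z)"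
      proof -
        have "det (row_subst i (\<lambda>k. jac ?F1 z $ i $ k) (jac (\<lambda>z. s *\<^sub>R ?F1 z) z)) =
            of_real (1 / s) * det (jac (\<lambda>z. s *\<^sub>R ?F1 z) z)" for i
        proof -
          have "of_real (1 / s) * (of_real s * x) = x" for x :: complex
            using s0 by simp
          from this[of "det (row_subst i (\<lambda>k. jac ?F1 z $ i $ k) (jac (\<lambda>z. s *\<^sub>R ?F1 z) z))"]
          show ?thesis
            unfolding row by (rule sym)
        qed
        then show ?thesis by simp
      qed
      have sumF: "(\<Sum>j\<in>UNIV. (s *\<^sub>R ?F1 z) $ j * cnj (?F1 z $ j)) = (\<Sum>j\<in>UNIV. of_real (s * (cmod (?F1 z $ j))\<^sup>2))"
        unfolding of_real_mult complex_norm_square by (simp add: scaleR_conv_of_real[where 'a = complex] mult_ac)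
      show ?thesis
        unfolding V_def add_0 rowsum sumF by (simp add: algebra_simps)
    qed
    have 2: "((\<lambda>z. H z * V z) has_integral 0) D"
      using *(2) unfolding V_def .
    have "((\<lambda>z. H z * (V z + cnj (V z))) has_integral 2 * 0) D"
      by (rule has_integral_eq[OF _ has_integral_mult_right[OF 2, of 2]]) (simp add: real)
    then have "integral D (\<lambda>z. H z * (V z + cnj (V z))) = 0"
      by (simp add: integral_unique)
    from has_vector_derivative_eq_rhs[OF *(1) this[unfolded V_def]] show ?thesis .
  qed
  obtain c where "\<And>s. s \<in> {a<..} \<Longrightarrow> mass D H (\<lambda>z. 0 + s *\<^sub>R ?F1 z) = c"
    using has_vector_derivative_zero_constant[OF convex_real_interval(3) der] by blast
  from this[of s1] this[of s2] s show ?thesis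
    by simp
qed

section \<open>Proper holomorphic maps between domains of equal dimension\<close>

lemma convex_complex_line_vimage:
  fixes B :: "(complex^'n) set"
  assumes "convex B"
  shows "convex {\<zeta>. z + \<zeta> *s v \<in> B}"
proof (rule convexI)
  fix x y and u t :: real
  assume *: "x \<in> {\<zeta>. z + \<zeta> *s v \<in> B}" "y \<in> {\<zeta>. z + \<zeta> *s v \<in> B}" "0 \<le> u" "0 \<le> t" "u + t = 1"
  have "u *\<^sub>R (z + x *s v) + t *\<^sub>R (z + y *s v) = (u + t) *\<^sub>R z + (u *\<^sub>R x + t *\<^sub>R y) *s v"
    by (simp add: vec_eq_iff algebra_simps scaleR_conv_of_real[where 'a = complex])
  with convexD[OF assms _ _ *(3-5), of "z + x *s v" "z + y *s v"] *
  show "u *\<^sub>R x + t *\<^sub>R y \<in> {\<zeta>. z + \<zeta> *s v \<in> B}"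
    by simp
qed

lemma continuous_on_complex_line: "continuous_on S (\<lambda>\<zeta>. z + \<zeta> *s (v :: complex^'n))"
  by (intro continuous_intros bounded_linear.continuous_on[OF bounded_linear_vector_scalar_mult_left])

lemma open_complex_line_vimage:
  fixes B :: "(complex^'n) set"
  assumes "open B"
  shows "open {\<zeta>. z + \<zeta> *s v \<in> B}"
  using open_vimage[OF assms continuous_on_complex_line[of UNIV z v]] by (simp add: vimage_def)

text \<open>On the complex line through \<open>x\<close> and \<open>y\<close> this is the identity
  theorem in one variable; convexity keeps the slice of \<open>B\<close> connected.\<close>

lemma holomorphic_identity_ball:
  fixes h :: "complex^'n \<Rightarrow> complex"
  assumes h: "holomorphic_Cn h B" and B: "open B" "convex B" and U: "open U" "U \<subseteq> B" "x \<in> U"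
    and zero: "\<And>z. z \<in> U \<Longrightarrow> h z = 0" and y: "y \<in> B"
  shows "h y = 0"
proof -
  let ?l = "\<lambda>\<zeta>. x + \<zeta> *s (y - x)"
  have "h (?l 1) = 0"
  proof (rule analytic_continuation_open[where f = "\<lambda>\<zeta>. h (?l \<zeta>)" and g = "\<lambda>\<zeta>. 0" and z = 1
        and s = "{\<zeta>. ?l \<zeta> \<in> U}" and s' = "{\<zeta>. ?l \<zeta> \<in> B}"])
    show "open {\<zeta>. ?l \<zeta> \<in> U}" "open {\<zeta>. ?l \<zeta> \<in> B}"
      by (intro open_complex_line_vimage U B)+
    have "?l 0 = x" by (simp add: vec_eq_iff)
    then have "0 \<in> {\<zeta>. ?l \<zeta> \<in> U}"
      using U(3) by simp
    then show "{\<zeta>. ?l \<zeta> \<in> U} \<noteq> {}"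
      by blast
    show "connected {\<zeta>. ?l \<zeta> \<in> B}"
      by (intro convex_connected convex_complex_line_vimage B)
    show "(\<lambda>\<zeta>. h (?l \<zeta>)) holomorphic_on {\<zeta>. ?l \<zeta> \<in> B}"
      by (rule holomorphic_on_line[OF h])
    have "?l 1 = y" by (simp add: vec_eq_iff)
    then show "1 \<in> {\<zeta>. ?l \<zeta> \<in> B}"
      using y by simp
  qed (use U zero in auto)
  moreover have "?l 1 = y" by (simp add: vec_eq_iff)
  ultimately show ?thesis by simp
qed

text \<open>The interior of the zero set is closed in \<open>D\<close>: a ball about a limit point
  meets it in an open set, to which the version on balls applies.\<close>

lemma holomorphic_identity:
  fixes h :: "complex^'n \<Rightarrow> complex"
  assumes h: "holomorphic_Cn h D" and D: "open D" "connected D" and U: "open U" "U \<subseteq> D" "U \<noteq> {}"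
    and zero: "\<And>z. z \<in> U \<Longrightarrow> h z = 0" and y: "y \<in> D"
  shows "h y = 0"
proof -
  define E where "E = interior {z\<in>D. h z = 0}"
  have ED: "E \<subseteq> D"
    unfolding E_def using interior_subset by blast
  have "U \<subseteq> E"
    unfolding E_def by (rule interior_maximal) (use U zero in auto)
  then have "E \<noteq> {}"
    using U by blast
  have "D \<inter> closure E \<subseteq> E"
  proof
    fix z assume "z \<in> D \<inter> closure E"
    then obtain r where r: "r > 0" "ball z r \<subseteq> D"
      using D(1) open_contains_ball by blast
    obtain x where x: "x \<in> E" "dist x z < r"
      using \<open>z \<in> D \<inter> closure E\<close> r(1) closure_approachable by blast
    have "h y = 0" if "y \<in> ball z r" for y
    proof (rule holomorphic_identity_ball[of h "ball z r" "E \<inter> ball z r" x])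
      show "holomorphic_Cn h (ball z r)"
        using holomorphic_Cn_subset[OF h r(2)] .
      show "h z' = 0" if "z' \<in> E \<inter> ball z r" for z'
        using that interior_subset unfolding E_def by blast
    qed (use x that in \<open>auto simp: E_def dist_commute\<close>)
    then have "ball z r \<subseteq> E"
      unfolding E_def by (intro interior_maximal) (use r in auto)
    then show "z \<in> E"
      using r(1) by auto
  qed
  then have "E = D \<inter> closure E"
    using ED closure_subset by blast
  then have "closedin (top_of_set D) E"
    by (metis closedin_closed_Int closed_closure)
  moreover have "openin (top_of_set D) E"
    using ED by (simp add: E_def openin_open_eq D(1))
  ultimately have "E = D"
    using D(2) \<open>E \<noteq> {}\<close> unfolding connected_clopen by blast
  then show ?thesis
    using y interior_subset unfolding E_def by blast
qed

text \<open>The determinant is an entire function of the parameter. If it vanished for all small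
  real values it would vanish identically, contrary to its growth at infinity.\<close>

lemma det_perturb_nonzero:
  fixes A :: "complex^'n^'n"
  assumes d: "d > 0"
  shows "\<exists>t\<in>{-d<..<d::real}. det (\<chi> j k. A $ j $ k + of_real t * (mat 1 :: complex^'n^'n) $ j $ k) \<noteq> 0"
proof (rule ccontr)
  let ?I = "mat 1 :: complex^'n^'n"
  define g where "g u = det (\<chi> j k. A $ j $ k + u * ?I $ j $ k)" for u
  assume "\<not> ?thesis"
  then have g0: "g (of_real t) = 0" if "t \<in> {-d<..<d}" for t
    using that by (simp add: g_def)
  have hol: "g holomorphic_on UNIV"
    unfolding g_def holomorphic_on_def field_differentiable_def
    using has_field_derivative_det_affine[of A ?I] by blast
  have lim: "(0::complex) islimpt of_real ` {-d<..<d}"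
    unfolding islimpt_approachable
  proof (intro allI impI)
    fix e :: real assume "e > 0"
    then show "\<exists>x'\<in>complex_of_real ` {-d<..<d}. x' \<noteq> 0 \<and> dist x' 0 < e"
      using d by (intro bexI[of _ "of_real (min d e / 2)"] imageI) (auto simp: min_def)
  qed
  have all0: "g u = 0" for u
    by (rule analytic_continuation[OF hol open_UNIV connected_UNIV _ _ lim]) (use g0 in auto)
  \<comment> \<open>Growth at infinity seen from the substitution u = 1/x: the rescaled determinant
    is continuous at x = 0 with the value det 1 = 1.\<close>
  define k where "k x = det (\<chi> i j. x * A $ i $ j + ?I $ i $ j)" for x :: complex
  have "k x = 0" if "x \<noteq> 0" for x
  proof -
    have "(\<chi> i j. x * A $ i $ j + ?I $ i $ j) = (\<chi> i j. x * (\<chi> i j. A $ i $ j + (1 / x) * ?I $ i $ j) $ i $ j)"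
      using that by (simp add: vec_eq_iff field_simps)
    then have "k x = x ^ CARD('n) * g (1 / x)"
      unfolding k_def g_def by (simp only: det_smult_entries)
    then show ?thesis
      using all0 by simp
  qed
  then have ev: "\<forall>\<^sub>F x in at 0. k x = 0"
    by (auto simp: eventually_at_filter)
  have "continuous_on UNIV k"
    unfolding k_def by (rule continuous_on_det) (auto intro!: continuous_intros)
  then have "(k \<longlongrightarrow> k 0) (at 0)"
    by (simp add: continuous_on_eq_continuous_at isCont_def)
  then have "k 0 = 0"
    using tendsto_eventually[OF ev] tendsto_unique trivial_limit_at by blast
  moreover have "(\<chi> i j. 0 * A $ i $ j + ?I $ i $ j) = ?I"
    by (simp add: vec_eq_iff)
  then have "k 0 = 1"
    unfolding k_def by (metis det_I)
  ultimately show False by simp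
qed

section \<open>Sard's theorem for holomorphic maps and integrals that force vanishing\<close>

lemma rank_lt_if_singular:
  fixes g :: "real^'m::{finite,wellorder} \<Rightarrow> real^'m::{finite,wellorder}"
  assumes "linear g" "\<not> inj g"
  shows "rank (matrix g) < CARD('m)"
proof -
  have "\<not> inj ((*v) (matrix g))"
    using assms by (simp add: matrix_works)
  then have "rank (matrix g) \<noteq> CARD('m)"
    using full_rank_injective[of "matrix g"] by (simp add: inj_on_def)
  then show ?thesis
    using rank_bound[of "matrix g"] by simp
qed

lemma inj_matrix_vector_mult_iff:
  fixes A :: "complex^'n^'n"
  shows "inj ((*v) A) \<longleftrightarrow> det A \<noteq> 0"
  using invertible_det_nz[of A] invertible_left_inverse[of A] matrix_left_invertible_injective[of A]
  by (auto simp: inj_def)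

text \<open>\<open>baby_Sard\<close> is stated through the rank of real matrices with wellordered
  index types. The complex space is therefore identified with a real one indexed by
  \<open>'n bit0\<close>, a type with twice as many elements. Zero complex determinant means that
  the derivative is not injective, a property that survives the identification.\<close>

lemma negligible_critical_values:
  fixes f :: "complex^'n \<Rightarrow> complex^'n"
  assumes f: "holomorphic_map_Cn f D" and S: "S \<subseteq> D" "\<And>z. z \<in> S \<Longrightarrow> det (jac f z) = 0"
  shows "negligible (f ` S)"
proof -
  have "DIM(complex^'n) = DIM(real^'n bit0)"
    by simp
  then obtain \<phi> :: "complex^'n \<Rightarrow> real^'n bit0" and \<psi>
    where \<phi>: "linear \<phi>" "linear \<psi>" "\<And>x. \<psi> (\<phi> x) = x" "\<And>y. \<phi> (\<psi> y) = y"
    using isomorphisms_UNIV_UNIV by metis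
  let ?g = "\<lambda>x. \<phi> (f (\<psi> x))"
  have neg: "negligible (?g ` (\<phi> ` S))"
  proof (rule baby_Sard)
    fix x assume "x \<in> \<phi> ` S"
    then have x: "\<psi> x \<in> S"
      using \<phi>(3) by auto
    have "(f has_derivative (*v) (jac f (\<psi> x))) (at (\<psi> x))"
      using holomorphic_map_has_derivative[OF f] x S(1) by blast
    with has_derivative_compose[OF linear_imp_has_derivative[OF \<phi>(2)], of f "(*v) (jac f (\<psi> x))" x UNIV]
    have "((\<lambda>x. f (\<psi> x)) has_derivative (\<lambda>v. jac f (\<psi> x) *v \<psi> v)) (at x)"
      by blast
    from has_derivative_compose[OF this linear_imp_has_derivative[OF \<phi>(1)]]
    have der: "(?g has_derivative (\<lambda>v. \<phi> (jac f (\<psi> x) *v \<psi> v))) (at x)" .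
    then show "(?g has_derivative (\<lambda>v. \<phi> (jac f (\<psi> x) *v \<psi> v))) (at x within \<phi> ` S)"
      by (rule has_derivative_at_withinI)
    have "\<not> inj ((*v) (jac f (\<psi> x)))"
      using inj_matrix_vector_mult_iff S(2)[OF x] by blast
    then obtain u v where uv: "u \<noteq> v" "jac f (\<psi> x) *v u = jac f (\<psi> x) *v v"
      by (auto simp: inj_def)
    then have "\<phi> u \<noteq> \<phi> v" "\<phi> (jac f (\<psi> x) *v \<psi> (\<phi> u)) = \<phi> (jac f (\<psi> x) *v \<psi> (\<phi> v))"
      using \<phi>(3) by metis+
    then have "\<not> inj (\<lambda>v. \<phi> (jac f (\<psi> x) *v \<psi> v))"
      by (auto simp: inj_def)
    then show "rank (matrix (\<lambda>v. \<phi> (jac f (\<psi> x) *v \<psi> v))) < CARD('n bit0)"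
      by (rule rank_lt_if_singular[OF has_derivative_linear[OF der]])
  qed simp
  have "f ` S = \<psi> ` (?g ` (\<phi> ` S))"
    using \<phi>(3) by (auto simp: image_iff)
  moreover have "negligible (\<psi> ` (?g ` (\<phi> ` S)))"
    by (rule negligible_differentiable_image_negligible[OF _ neg])
      (use \<phi>(2) in \<open>auto intro: linear_imp_differentiable_on\<close>)
  ultimately show ?thesis by simp
qed

text \<open>The zero extension is continuous on a box around \<open>D\<close>, and a continuous
  nonnegative function on a box with integral 0 vanishes.\<close>

lemma integral_Re_eq_0_imp:
  fixes g :: "'a::euclidean_space \<Rightarrow> complex"
  assumes D: "open D" "bounded D" and K: "compact K" "K \<subseteq> D" and g: "continuous_on D g"
    and zero: "\<And>z. z \<in> D - K \<Longrightarrow> g z = 0" and nonneg: "\<And>z. z \<in> D \<Longrightarrow> Re (g z) \<ge> 0"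
    and int: "integral D g = 0" and z: "z \<in> D"
  shows "Re (g z) = 0"
proof -
  obtain b where b: "D \<subseteq> box (-b) b"
    using bounded_subset_box_symmetric[OF D(2)] by blast
  then have b': "D \<subseteq> cbox (-b) b"
    using box_subset_cbox by blast
  let ?g = "\<lambda>z. if z \<in> D then g z else 0"
  have cont: "continuous_on UNIV ?g"
    by (rule continuous_on_zero_extension[OF D(1) compact_imp_closed[OF K(1)] K(2) g zero])
  have "?g integrable_on cbox (-b) b"
    by (intro integrable_continuous continuous_on_subset[OF cont]) auto
  then have "(?g has_integral 0) (cbox (-b) b)"
    using integral_zero_extension[OF b', of g] int by (simp add: has_integral_iff)
  from has_integral_linear[OF this bounded_linear_Re]
  have "((\<lambda>z. Re (?g z)) has_integral 0) (cbox (-b) b)"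
    by (simp add: o_def)
  moreover have "continuous_on (cbox (-b) b) (\<lambda>z. Re (?g z))"
    by (intro continuous_intros continuous_on_subset[OF cont]) auto
  ultimately have "Re (?g z) = 0"
    by (intro has_integral_0_cbox_imp_0[of "-b" b "\<lambda>z. Re (?g z)"]) (use nonneg b b' z in auto)
  then show ?thesis
    using z by simp
qed

text \<open>The weight of \<open>H\<close> in \<open>mass\<close> for the map s (f - w). The squared
  factor is the real Jacobian determinant of s f; it balances the shrinking of the support around
  the fibre, so that each regular point keeps a fixed share in the limit of large
  \<open>s\<close>.\<close>

definition fibre_density :: "(complex^'n \<Rightarrow> complex^'n) \<Rightarrow> real \<Rightarrow> complex^'n \<Rightarrow> complex^'n \<Rightarrow> real"
  where "fibre_density f s w z = bump ((norm (s *\<^sub>R (f z - w)))\<^sup>2) * (s ^ CARD('n) * cmod (det (jac f z)))\<^sup>2"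

lemma fibre_density_nonneg: "fibre_density f s w z \<ge> 0"
  by (simp add: fibre_density_def bump_nonneg)

lemma fibre_density_eq_0:
  assumes "s * norm (f z - w) \<ge> 1" "s \<ge> 0"
  shows "fibre_density f s w z = 0"
proof -
  have "(norm (s *\<^sub>R (f z - w)))\<^sup>2 \<ge> 1"
    using assms by simp
  then show ?thesis
    by (simp add: fibre_density_def bump_eq_0)
qed

lemma mass_eq_integral_fibre_density:
  assumes "holomorphic_map_Cn f D"
  shows "mass D H (\<lambda>z. s *\<^sub>R (f z - w)) = integral D (\<lambda>z. fibre_density f s w z *\<^sub>R H z)"
  unfolding mass_def
proof (rule integral_cong)
  fix z assume z: "z \<in> D"
  have "det (jac (\<lambda>z. s *\<^sub>R (f z - w)) z) = of_real (s ^ CARD('a)) * det (jac f z)"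
    unfolding jac_scale_shift[OF assms z] det_smult_entries by simp
  then have "det (jac (\<lambda>z. s *\<^sub>R (f z - w)) z) * cnj (det (jac (\<lambda>z. s *\<^sub>R (f z - w)) z)) =
      of_real ((s ^ CARD('a) * cmod (det (jac f z)))\<^sup>2)"
    using complex_norm_square[of "det (jac f z)"] by (simp add: power_mult_distrib power2_eq_square mult_ac)
  then show "H z * (of_real (bump ((norm (s *\<^sub>R (f z - w)))\<^sup>2)) *
      (det (jac (\<lambda>z. s *\<^sub>R (f z - w)) z) * cnj (det (jac (\<lambda>z. s *\<^sub>R (f z - w)) z)))) =
      fibre_density f s w z *\<^sub>R H z"
    by (simp add: fibre_density_def scaleR_conv_of_real mult_ac)
qed

text \<open>Compactness leaves a margin between the ball and the complement of \<open>G\<close>; a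
  point slightly outside the ball is compared with its radial projection \<open>?x\<close>.\<close>

lemma cball_enlarge:
  fixes c :: "'a::euclidean_space"
  assumes "open G" "cball c r \<subseteq> G" "r \<ge> 0"
  obtains d where "d > 0" "cball c (r + d) \<subseteq> G"
proof -
  obtain e where e: "e > 0" "(\<Union>x\<in>cball c r. ball x e) \<subseteq> G"
    using compact_subset_open_imp_ball_epsilon_subset[OF compact_cball assms(1,2)] by blast
  have "cball c (r + e/2) \<subseteq> G"
  proof
    fix y assume y: "y \<in> cball c (r + e/2)"
    show "y \<in> G"
    proof (cases "dist c y \<le> r")
      case True
      then show ?thesis
        using assms(2) by auto
    next
      case False
      then have pos: "dist c y > 0"
        using assms(3) by linarith
      let ?x = "c + (r / dist c y) *\<^sub>R (y - c)"
      have "dist c ?x = r"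
        using pos assms(3) by (simp add: dist_norm norm_minus_commute)
      have "y - ?x = (1 - r / dist c y) *\<^sub>R (y - c)"
        by (simp add: algebra_simps)
      then have "dist ?x y = \<bar>1 - r / dist c y\<bar> * dist c y"
        by (metis dist_commute dist_norm norm_scaleR)
      moreover have "r / dist c y < 1"
        using False pos by (simp add: divide_less_eq)
      ultimately have "dist ?x y = dist c y - r"
        using pos by (simp add: left_diff_distrib)
      with \<open>dist c ?x = r\<close> have "?x \<in> cball c r" "y \<in> ball ?x e"
        using y e(1) by auto
      then show ?thesis
        using e(2) by blast
    qed
  qed
  with that[of "e/2"] e(1) show ?thesis by simp
qed

locale proper_holo =
  fixes D G :: "(complex^'n) set" and f :: "complex^'n \<Rightarrow> complex^'n"
  assumes D: "open D" "bounded D" "connected D" "D \<noteq> {}"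
    and G: "open G" "connected G"
    and f: "holomorphic_map_Cn f D"
    and maps: "f ` D \<subseteq> G"
    and proper: "\<And>K. compact K \<Longrightarrow> K \<subseteq> G \<Longrightarrow> compact {z \<in> D. f z \<in> K}"
begin

abbreviation "\<rho> \<equiv> fibre_density f"

lemma cont_f: "continuous_on D f"
  by (rule holomorphic_map_continuous_on[OF f])

text \<open>A determinant vanishing on \<open>U\<close> vanishes on \<open>D\<close>, so the scaled
  map \<open>F0\<close> has mass 0. By homotopy invariance the mass stays 0 when t times the
  identity map is added, for small t. As the integrand is nonnegative, the determinant of the
  perturbed map vanishes at \<open>z0\<close> for all these t, which
  \<open>det_perturb_nonzero\<close> excludes.\<close>

lemma jac_nonzero:
  assumes U: "open U" "U \<subseteq> D" "U \<noteq> {}"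
  obtains z where "z \<in> U" "det (jac f z) \<noteq> 0"
proof (rule ccontr)
  assume "\<not> thesis"
  then have "\<forall>z\<in>U. det (jac f z) = 0"
    using that by blast
  then have J0: "det (jac f z) = 0" if "z \<in> D" for z
    using holomorphic_identity[OF holomorphic_det_jac[OF D(1) f] D(1,3) U _ that] by blast
  obtain z0 where z0: "z0 \<in> D"
    using D(4) by blast
  define w where "w = f z0"
  obtain e where e: "e > 0" "cball w e \<subseteq> G"
    using G(1) maps z0 open_contains_cball w_def by blast
  define K where "K = {z\<in>D. f z \<in> cball w e}"
  have K: "compact K" "K \<subseteq> D"
    using proper[OF compact_cball e(2)] by (auto simp: K_def)
  obtain R where R: "R > 0" "\<And>z. z \<in> D \<Longrightarrow> norm z \<le> R"
    using D(2) bounded_pos by blast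
  \<comment> \<open>The factor \<open>2 / e\<close> makes the norm of \<open>F0\<close> at least 2
    off \<open>K\<close>, which leaves room for a perturbation of norm below 1. Subtracting
    \<open>w\<close> makes \<open>F0\<close> vanish at \<open>z0\<close>, so that the bump is
    positive there after the perturbation.\<close>
  define F0 where "F0 z = (2 / e) *\<^sub>R (f z - w)" for z
  have F0: "holomorphic_map_Cn F0 D"
    unfolding F0_def by (rule holomorphic_map_scale_shift[OF f])
  have id: "holomorphic_map_Cn (\<lambda>z. z) D"
    by (simp add: holomorphic_map_Cn_def holomorphic_Cn_coord)
  define T where "T = {- (1 / R) <..< 1 / R}"
  have T: "open T" "convex T" "0 \<in> T"
    using R(1) by (auto simp: T_def)
  have small: "norm (t *\<^sub>R z) < 1" if "t \<in> T" "z \<in> D" for t z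
  proof -
    have "\<bar>t\<bar> * norm z \<le> \<bar>t\<bar> * R"
      using R(2)[OF that(2)] by (simp add: mult_left_mono)
    also have "\<dots> < 1"
      using that(1) R(1) by (auto simp: T_def field_simps abs_if split: if_splits)
    finally show ?thesis by simp
  qed
  have supp: "norm (F0 z + t *\<^sub>R z) \<ge> 1" if "t \<in> T" "z \<in> D - K" for t z
  proof -
    have "norm (f z - w) > e"
      using that(2) by (auto simp: K_def dist_norm norm_minus_commute)
    moreover have "norm (F0 z) = 2 / e * norm (f z - w)"
      unfolding F0_def norm_scaleR using e(1) by simp
    ultimately have "norm (F0 z) \<ge> 2 / e * e"
      using e(1) by (metis divide_nonneg_pos less_imp_le mult_left_mono zero_le_numeral)
    then have "norm (F0 z) \<ge> 2"
      using e(1) by simp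
    moreover have "norm (t *\<^sub>R z) < 1"
      using small that by blast
    moreover have "norm (F0 z) \<le> norm (F0 z + t *\<^sub>R z) + norm (t *\<^sub>R z)"
      using norm_triangle_ineq[of "F0 z + t *\<^sub>R z" "- (t *\<^sub>R z)"] by simp
    ultimately show ?thesis by linarith
  qed
  have JF0: "det (jac F0 z) = 0" if "z \<in> D" for z
    unfolding F0_def jac_scale_shift[OF f that] det_smult_entries using J0[OF that] by simp
  have "mass D (\<lambda>z. 1) (\<lambda>z. F0 z + 0 *\<^sub>R z) = integral D (\<lambda>z. 0)"
    unfolding mass_def by (rule integral_cong) (simp add: JF0)
  then have m0: "mass D (\<lambda>z. 1) (\<lambda>z. F0 z + t *\<^sub>R z) = 0" if "t \<in> T" for t
    using mass_perturb[OF D(1,2) F0 id K T(1,2) supp that T(3)] by simp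
  have jac_id: "jac (\<lambda>z. z) z0 = mat 1"
    unfolding jac_def by (simp add: vec_eq_iff mat_def pd_coord)
  have "det (jac (\<lambda>z. F0 z + t *\<^sub>R z) z0) = 0" if t: "t \<in> T" for t
  proof -
    let ?F = "\<lambda>z. F0 z + t *\<^sub>R z"
    have F: "holomorphic_map_Cn ?F D"
      by (rule holomorphic_map_affine[OF F0 id])
    let ?g = "\<lambda>z. 1 * (complex_of_real (bump ((norm (?F z))\<^sup>2)) * (det (jac ?F z) * cnj (det (jac ?F z))))"
    have Re: "Re (?g z) = bump ((norm (?F z))\<^sup>2) * (cmod (det (jac ?F z)))\<^sup>2" for z
      unfolding complex_norm_square[symmetric] by simp
    have "Re (?g z0) = 0"
    proof (rule integral_Re_eq_0_imp[OF D(1,2) K])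
      show "continuous_on D ?g"
        by (intro continuous_intros holomorphic_map_continuous_on[OF F]
            holomorphic_Cn_continuous_on[OF holomorphic_det_jac[OF D(1) F]])
      show "?g z = 0" if "z \<in> D - K" for z
        using supp[OF t that] by (simp add: bump_eq_0)
      show "Re (?g z) \<ge> 0" if "z \<in> D" for z
        unfolding Re by (simp add: bump_nonneg)
      show "integral D ?g = 0"
        using m0[OF t] by (simp add: mass_def)
    qed (rule z0)
    moreover have "(norm (?F z0))\<^sup>2 < 1"
      using small[OF t z0] by (simp add: F0_def w_def power_less_one_iff abs_square_less_1)
    then have "bump ((norm (?F z0))\<^sup>2) > 0"
      by (rule bump_pos)
    ultimately show ?thesis
      unfolding Re by simp
  qed
  then have "det (\<chi> j k. jac F0 z0 $ j $ k + of_real t * (mat 1 :: complex^'n^'n) $ j $ k) = 0" if "t \<in> T" for t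
    using jac_affine[OF F0 id z0, of t] that unfolding jac_id by metis
  moreover obtain t where "t \<in> T" "det (\<chi> j k. jac F0 z0 $ j $ k + of_real t * (mat 1 :: complex^'n^'n) $ j $ k) \<noteq> 0"
    using det_perturb_nonzero[of "1/R" "jac F0 z0"] R(1) unfolding T_def by auto
  ultimately show False by blast
qed

section \<open>Fibre sums as integrals against the density\<close>

lemma fibre_nbhd_compact:
  assumes "cball w e \<subseteq> G"
  shows "compact {z\<in>D. f z \<in> cball w e}"
  using proper[OF compact_cball assms] .

lemma density_supp:
  assumes "e > 0" "s \<ge> 1 / e" "z \<in> D - {z\<in>D. f z \<in> cball w e}"
  shows "s * norm (f z - w) \<ge> 1"
proof -
  have "norm (f z - w) > e"
    using assms(3) by (auto simp: dist_norm norm_minus_commute)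
  then have "s * e \<le> s * norm (f z - w)"
    using assms(1,2) by (intro mult_left_mono) (auto intro: order_trans[of _ "1/e"])
  moreover have "s * e \<ge> 1"
    using assms(1,2) by (simp add: field_simps)
  ultimately show ?thesis by linarith
qed

lemma continuous_on_density: "continuous_on D (\<lambda>z. \<rho> s w z)"
  unfolding fibre_density_def
  by (intro continuous_intros cont_f holomorphic_Cn_continuous_on[OF holomorphic_det_jac[OF D(1) f]])

lemma density_integrable:
  fixes \<psi> :: "complex^'n \<Rightarrow> 'b::banach"
  assumes w: "cball w e \<subseteq> G" "e > 0" "s \<ge> 1 / e" and \<psi>: "continuous_on D \<psi>"
  shows "(\<lambda>z. \<rho> s w z *\<^sub>R \<psi> z) integrable_on D"
proof -
  obtain b where b: "D \<subseteq> cbox (-b) b"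
    using bounded_subset_cbox_symmetric[OF D(2)] by blast
  let ?K = "{z\<in>D. f z \<in> cball w e}"
  have s0: "s \<ge> 0"
    using w(2,3) by (auto intro: order_trans[of _ "1/e"])
  have cont: "continuous_on UNIV (\<lambda>z. if z \<in> D then \<rho> s w z *\<^sub>R \<psi> z else 0)"
  proof (rule continuous_on_zero_extension[OF D(1)])
    show "closed ?K"
      using fibre_nbhd_compact[OF w(1)] by (rule compact_imp_closed)
    show "\<rho> s w z *\<^sub>R \<psi> z = 0" if "z \<in> D - ?K" for z
      using fibre_density_eq_0[of s f z w] density_supp[OF w(2,3) that] s0 by simp
  qed (auto intro: continuous_intros continuous_on_density \<psi>)
  have "(\<lambda>z. if z \<in> D then \<rho> s w z *\<^sub>R \<psi> z else 0) integrable_on cbox (-b) b"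
    by (rule integrable_continuous, rule continuous_on_subset[OF cont]) auto
  then show ?thesis
    using b by (simp add: integrable_on_def)
qed

definition pushforward :: "(complex^'n \<Rightarrow> complex) \<Rightarrow> real \<Rightarrow> complex^'n \<Rightarrow> complex"
  where "pushforward H s w = integral D (\<lambda>z. \<rho> s w z *\<^sub>R H z)"

lemma pushforward_eq_mass: "pushforward H s w = mass D H (\<lambda>z. s *\<^sub>R (f z - w))"
  by (simp add: pushforward_def mass_eq_integral_fibre_density[OF f])

lemma pushforward_scale:
  assumes H: "holomorphic_Cn H D" and w: "cball w e \<subseteq> G" "e > 0" and s: "s1 > 1 / e" "s2 > 1 / e"
  shows "pushforward H s1 w = pushforward H s2 w"
  unfolding pushforward_eq_mass
  by (rule mass_scale[OF D(1,2) H f fibre_nbhd_compact[OF w(1)] _ _ density_supp[OF w(2)] s])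
    (use w(2) in auto)

lemma pushforward_has_derivative:
  assumes H: "holomorphic_Cn H D" and w0: "cball w0 e \<subseteq> G" "e > 0" and s: "s \<ge> 1 / e"
  shows "\<exists>L. (pushforward H s has_derivative L) (at w0) \<and> (\<forall>a v. L (a *s v) = a * L v)"
proof -
  \<comment> \<open>If \<open>f z\<close> is farther than \<open>e + d\<close> from
    \<open>w0\<close>, it is farther than \<open>e\<close> from every point of the ball of radius
    \<open>d\<close>; so one compact set serves all these points.\<close>
  obtain d where d: "d > 0" "cball w0 (e + d) \<subseteq> G"
    using cball_enlarge[OF G(1) w0(1)] w0(2) by auto
  have s0: "s > 0"
    using s w0(2) by (auto intro: less_le_trans[of _ "1/e"])
  have "norm (s *\<^sub>R (f z - w)) \<ge> 1" if "w \<in> ball w0 d" "z \<in> D - {z\<in>D. f z \<in> cball w0 (e + d)}" for w z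
  proof -
    have "norm (f z - w0) > e + d"
      using that(2) by (auto simp: dist_norm norm_minus_commute)
    moreover have "norm (w - w0) < d"
      using that(1) by (simp add: dist_norm norm_minus_commute)
    moreover have "norm (f z - w0) \<le> norm (f z - w) + norm (w - w0)"
      using norm_triangle_ineq[of "f z - w" "w - w0"] by simp
    ultimately have "z \<in> D - {z\<in>D. f z \<in> cball w e}"
      using that(2) by (auto simp: dist_norm norm_minus_commute)
    from density_supp[OF w0(2) s this] show ?thesis
      using s0 by simp
  qed
  from mass_translate[OF D(1,2) H f fibre_nbhd_compact[OF d(2)] _ d(1) this]
  show ?thesis
    unfolding pushforward_eq_mass[abs_def] by auto
qed

lemma pushforward_holomorphic:
  assumes "holomorphic_Cn H D" "\<And>w. w \<in> W \<Longrightarrow> cball w e \<subseteq> G" "e > 0" "s \<ge> 1 / e"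
  shows "holomorphic_Cn (pushforward H s) W"
  unfolding holomorphic_Cn_def using pushforward_has_derivative assms by blast

text \<open>The density is nonnegative and vanishes where \<open>s * norm (f z - w) \<ge> 1\<close>;
  the real part on the right is its total mass.\<close>

lemma pushforward_norm_le:
  assumes w: "cball w e \<subseteq> G" "e > 0" "s \<ge> 1 / e" and H: "continuous_on D H"
    and bound: "\<And>z. z \<in> D \<Longrightarrow> s * norm (f z - w) < 1 \<Longrightarrow> norm (H z) \<le> B"
  shows "norm (pushforward H s w) \<le> B * Re (pushforward (\<lambda>z. 1) s w)"
proof -
  have s0: "s \<ge> 0"
    using w(2,3) by (auto intro: order_trans[of _ "1/e"])
  have int1: "(\<lambda>z. \<rho> s w z *\<^sub>R B) integrable_on D"
    by (rule density_integrable[OF w]) (rule continuous_on_const)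
  have "norm (pushforward H s w) \<le> integral D (\<lambda>z. \<rho> s w z *\<^sub>R B)"
    unfolding pushforward_def
  proof (rule Henstock_Kurzweil_Integration.integral_norm_bound_integral[OF density_integrable[OF w H] int1])
    fix z assume z: "z \<in> D"
    show "norm (\<rho> s w z *\<^sub>R H z) \<le> \<rho> s w z *\<^sub>R B"
    proof (cases "s * norm (f z - w) < 1")
      case True
      then show ?thesis
        using bound[OF z True] by (simp add: fibre_density_nonneg mult_left_mono)
    next
      case False
      then show ?thesis
        using fibre_density_eq_0[of s f z w] s0 by simp
    qed
  qed
  also have "\<dots> = B * integral D (\<lambda>z. \<rho> s w z)"
    by (simp add: mult.commute)
  also have "integral D (\<lambda>z. \<rho> s w z) = Re (pushforward (\<lambda>z. 1) s w)"
  proof -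
    have int: "(\<lambda>z. \<rho> s w z *\<^sub>R (1::complex)) integrable_on D"
      by (rule density_integrable[OF w]) (rule continuous_on_const)
    show ?thesis
      unfolding pushforward_def using integral_linear[OF int bounded_linear_Re] by (simp add: o_def)
  qed
  finally show ?thesis .
qed

text \<open>The bump is positive on a nonempty open set, and some point of that set has nonzero
  Jacobian determinant; a continuous nonnegative density that is positive somewhere cannot integrate
  to 0.\<close>

lemma pushforward_pos:
  assumes w: "cball w e \<subseteq> G" "e > 0" "s \<ge> 1 / e" and z0: "z0 \<in> D" "s * norm (f z0 - w) < 1"
  shows "pushforward (\<lambda>z. 1) s w \<noteq> 0"
proof
  assume int0: "pushforward (\<lambda>z. 1) s w = 0"
  have s0: "s > 0"
    using w(2,3) by (auto intro: less_le_trans[of _ "1/e"])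
  let ?K = "{z\<in>D. f z \<in> cball w e}"
  let ?U = "{z\<in>D. s * norm (f z - w) < 1}"
  have "open ?U"
    using continuous_on_open_vimage[OF D(1), of "\<lambda>z. s * norm (f z - w)"] 
      continuous_openin_preimage_gen[of D "\<lambda>z. s * norm (f z - w)" "{..<1}"]
    by (auto simp: openin_open_eq D(1) vimage_def Int_def intro!: continuous_intros cont_f)
  then obtain z where z: "z \<in> ?U" "det (jac f z) \<noteq> 0"
    using jac_nonzero[of ?U] z0 by blast
  have "Re (\<rho> s w z *\<^sub>R (1::complex)) = 0"
  proof (rule integral_Re_eq_0_imp[OF D(1,2) fibre_nbhd_compact[OF w(1)]])
    show "continuous_on D (\<lambda>z. \<rho> s w z *\<^sub>R (1::complex))"
      by (intro continuous_intros continuous_on_density)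
    show "\<rho> s w z *\<^sub>R (1::complex) = 0" if "z \<in> D - ?K" for z
      using fibre_density_eq_0[of s f z w] density_supp[OF w(2,3) that] s0 by simp
    show "integral D (\<lambda>z. \<rho> s w z *\<^sub>R (1::complex)) = 0"
      using int0 by (simp add: pushforward_def)
  qed (use z in \<open>auto simp: fibre_density_nonneg\<close>)
  then have "\<rho> s w z = 0"
    by simp
  moreover have "(norm (s *\<^sub>R (f z - w)))\<^sup>2 < 1"
    using z(1) s0 by (simp add: abs_square_less_1)
  then have "bump ((norm (s *\<^sub>R (f z - w)))\<^sup>2) > 0"
    by (rule bump_pos)
  ultimately show False
    using z(2) s0 by (simp add: fibre_density_def)
qed

lemma pushforward_const_real: "pushforward (\<lambda>z. 1) s w \<in> \<real>"
proof -
  have "cnj (pushforward (\<lambda>z. 1) s w) = pushforward (\<lambda>z. 1) s w"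
    by (simp add: pushforward_def integral_cnj)
  then show ?thesis
    by (simp add: Reals_cnj_iff)
qed

text \<open>The total mass, a constant multiple of the degree of \<open>f\<close>, is both
  holomorphic in \<open>w\<close> and real-valued.\<close>

lemma pushforward_const_locally:
  assumes w0: "cball w0 (2 * e) \<subseteq> G" "e > 0" and s: "s \<ge> 1 / e" and w: "w \<in> ball w0 e"
  shows "pushforward (\<lambda>z. 1) s w = pushforward (\<lambda>z. 1) s w0"
proof -
  let ?m = "pushforward (\<lambda>z. 1) s"
  have "(?m has_derivative (\<lambda>v. 0)) (at w within ball w0 e)" if w: "w \<in> ball w0 e" for w
  proof -
    have "cball w e \<subseteq> cball w0 (2 * e)"
    proof
      fix y assume "y \<in> cball w e"
      then show "y \<in> cball w0 (2 * e)"
        using w dist_triangle[of w0 y w] by simp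
    qed
    then obtain L where L: "(?m has_derivative L) (at w)" "\<And>a v. L (a *s v) = a * L v"
      using pushforward_has_derivative[OF holomorphic_Cn_const, of w e s 1] w0 s by blast
    have "(\<lambda>w. cnj (?m w)) = ?m"
      using pushforward_const_real by (simp add: fun_eq_iff Reals_cnj_iff)
    then have "(?m has_derivative (\<lambda>v. cnj (L v))) (at w)"
      using has_derivative_cnj[OF L(1)] by simp
    then have real: "cnj (L v) = L v" for v
      using has_derivative_unique[OF L(1)] by metis
    \<comment> \<open>Both \<open>L v\<close> and \<open>L (\<i> *s v)\<close>, which is
      \<open>\<i> * L v\<close>, are real.\<close>
    have "L v = 0" for v
    proof -
      have "- \<i> * L v = \<i> * L v"
        using real[of "\<i> *s v"] real[of v] unfolding L(2) by simp
      then show ?thesis by simp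
    qed
    then have "L = (\<lambda>v. 0)" by auto
    with L(1) show ?thesis
      by (simp add: has_derivative_at_withinI)
  qed
  from has_derivative_zero_constant[OF convex_ball this]
  obtain c where "\<And>x. x \<in> ball w0 e \<Longrightarrow> ?m x = c" by blast
  from this[OF w] this[of w0] w0(2) show ?thesis by simp
qed

section \<open>Surjectivity of proper holomorphic maps\<close>

lemma compact_gap:
  assumes "compact C" "w \<notin> f ` C" "C \<subseteq> D"
  shows "\<exists>d>0. \<forall>z\<in>C. d \<le> norm (f z - w)"
proof -
  have "closed (f ` C)"
    by (intro compact_imp_closed compact_continuous_image continuous_on_subset[OF cont_f] assms)
  from separate_point_closed[OF this assms(2)] show ?thesis
    by (auto simp: dist_norm norm_minus_commute)
qed

lemma image_gap:
  assumes w: "w \<in> G" "w \<notin> f ` D"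
  shows "\<exists>d>0. \<forall>z\<in>D. d \<le> norm (f z - w)"
proof -
  obtain e where e: "e > 0" "cball w e \<subseteq> G"
    using G(1) w(1) open_contains_cball by blast
  obtain d where d: "d > 0" "\<And>z. z \<in> D \<Longrightarrow> f z \<in> cball w e \<Longrightarrow> d \<le> norm (f z - w)"
    using compact_gap[OF fibre_nbhd_compact[OF e(2)], of w] w(2) by auto
  have "min d e \<le> norm (f z - w)" if "z \<in> D" for z
    using d(2)[OF that] by (cases "f z \<in> cball w e") (auto simp: dist_norm norm_minus_commute)
  then show ?thesis
    using d(1) e(1) by (intro exI[of _ "min d e"]) auto
qed

text \<open>Above a point with empty fibre the density vanishes for large scales, so by scale
  invariance the total mass is 0. Over a point of the image it is nonzero, and it is locally
  constant; hence the image is open. Properness, through \<open>image_gap\<close>, makes it closed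
  in the connected set \<open>G\<close>.\<close>

lemma image_eq: "f ` D = G"
proof -
  have "openin (top_of_set G) (f ` D)"
  proof (subst openin_open_eq[OF G(1)], intro conjI maps)
    show "open (f ` D)"
      unfolding open_contains_ball
    proof (intro ballI)
      fix w0 assume "w0 \<in> f ` D"
      then obtain z0 where z0: "z0 \<in> D" "w0 = f z0" by blast
      obtain e' where e': "e' > 0" "cball w0 e' \<subseteq> G"
        using G(1) maps z0 open_contains_cball by blast
      define e where "e = e' / 2"
      have e: "e > 0" "cball w0 (2 * e) \<subseteq> G"
        using e' by (auto simp: e_def)
      have "ball w0 e \<subseteq> f ` D"
      proof
        fix w assume w: "w \<in> ball w0 e"
        have sub: "cball w e \<subseteq> G" "cball w0 e \<subseteq> G"
        proof -
          have "y \<in> cball w0 (2 * e)" if "y \<in> cball w e" for y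
            using w that dist_triangle[of w0 y w] by simp
          then show "cball w e \<subseteq> G" using e(2) by blast
          show "cball w0 e \<subseteq> G" using e by (auto intro: subset_trans[OF subset_cball])
        qed
        show "w \<in> f ` D"
        proof (rule ccontr)
          assume "w \<notin> f ` D"
          moreover have "w \<in> G"
            using sub(1) e(1) by auto
          ultimately obtain d where d: "d > 0" "\<And>z. z \<in> D \<Longrightarrow> d \<le> norm (f z - w)"
            using image_gap by blast
          \<comment> \<open>The bound \<open>s \<ge> 1 / d\<close> empties the support of the
            density; \<open>s > 1 / e\<close> permits the comparison with the fixed scale
            \<open>2 / e\<close>.\<close>
          define s where "s = max (2 / e) (1 / d)"
          have s: "s > 1 / e" "s \<ge> 1 / d" "2 / e > 1 / e" "s > 0"
            using e(1) d(1) by (auto simp: s_def less_max_iff_disj divide_strict_right_mono)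
          have "\<rho> s w z = 0" if "z \<in> D" for z
          proof (rule fibre_density_eq_0)
            have "1 \<le> s * d"
              using s(2) d(1) by (simp add: field_simps)
            also have "\<dots> \<le> s * norm (f z - w)"
              using d(2)[OF that] s(4) by (simp add: mult_left_mono)
            finally show "1 \<le> s * norm (f z - w)" .
          qed (use s(4) in simp)
          then have "pushforward (\<lambda>z. 1) s w = integral D (\<lambda>z. 0)"
            unfolding pushforward_def by (intro integral_cong) simp
          then have "pushforward (\<lambda>z. 1) (2 / e) w = 0"
            using pushforward_scale[OF holomorphic_Cn_const sub(1) e(1) s(1,3)] by simp
          then have "pushforward (\<lambda>z. 1) (2 / e) w0 = 0"
            using pushforward_const_locally[OF e(2,1) _ w, of "2 / e"] s(3) by simp
          then show False
            using pushforward_pos[OF sub(2) e(1) _ z0(1), of "2 / e"] s(3) z0(2) by simp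
        qed
      qed
      then show "\<exists>e>0. ball w0 e \<subseteq> f ` D"
        using e(1) by blast
    qed
  qed
  moreover have "closedin (top_of_set G) (f ` D)"
  proof -
    have "open (G - f ` D)"
      unfolding open_contains_ball
    proof (intro ballI)
      fix w assume w: "w \<in> G - f ` D"
      then obtain d where d: "d > 0" "\<And>z. z \<in> D \<Longrightarrow> d \<le> norm (f z - w)"
        using image_gap by blast
      obtain r where r: "r > 0" "ball w r \<subseteq> G"
        using G(1) w open_contains_ball by blast
      have "ball w (min d r) \<subseteq> G - f ` D"
        using d(2) r(2) by (fastforce simp: dist_norm norm_minus_commute)
      then show "\<exists>e>0. ball w e \<subseteq> G - f ` D"
        using d(1) r(1) by (intro exI[of _ "min d r"]) auto
    qed
    then show ?thesis
      using maps by (simp add: closedin_def openin_open_eq[OF G(1)])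
  qed
  ultimately show ?thesis
    using G(2) D(4) unfolding connected_clopen by blast
qed

section \<open>Regular fibres and concentration of the density\<close>

lemma regular_point_isolated:
  assumes z1: "z1 \<in> D" "det (jac f z1) \<noteq> 0"
  shows "\<not> z1 islimpt {z\<in>D. f z = f z1}"
proof -
  note der = holomorphic_map_has_derivative[OF f z1(1)]
  have "inj ((*v) (jac f z1))"
    using z1(2) inj_matrix_vector_mult_iff by blast
  then obtain B where B: "B > 0" "\<And>x. B * norm x \<le> norm (jac f z1 *v x)"
    using linear_inj_bounded_below_pos[OF has_derivative_linear[OF der]] by metis
  then obtain d where d: "d > 0" "\<And>y. norm (y - z1) < d \<Longrightarrow>
      norm (f y - f z1 - jac f z1 *v (y - z1)) \<le> B / 2 * norm (y - z1)"
    using der unfolding has_derivative_at_alt by (meson half_gt_zero)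
  have "y = z1" if "dist y z1 < d" "f y = f z1" for y
  proof -
    have "B * norm (y - z1) \<le> B / 2 * norm (y - z1)"
      using B(2)[of "y - z1"] d(2)[of y] that by (simp add: dist_norm)
    then have "B / 2 * norm (y - z1) \<le> 0" by linarith
    then show ?thesis
      using B(1) by (simp add: mult_le_0_iff)
  qed
  then show ?thesis
    unfolding islimpt_approachable using d(1) by blast
qed

lemma regular_fibre_finite:
  assumes "w \<in> G" and reg: "\<And>z. z \<in> D \<Longrightarrow> f z = w \<Longrightarrow> det (jac f z) \<noteq> 0"
  shows "finite {z\<in>D. f z = w}"
proof -
  have "compact {z\<in>D. f z = w}"
    using proper[of "{w}"] assms(1) by simp
  moreover have "\<not> z islimpt {z\<in>D. f z = w}" if "z \<in> {z\<in>D. f z = w}" for z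
    using regular_point_isolated[of z] reg[of z] that by auto
  ultimately show ?thesis
    using finite_not_islimpt_in_compact[of "{z\<in>D. f z = w}" "{z\<in>D. f z = w}"] by simp
qed

text \<open>Here \<open>\<psi>\<close> is merely continuous, so its integral may depend on the
  scale. The points over the ball at which \<open>\<psi>\<close> has modulus at least
  \<open>\<eta>\<close> form a compact set that misses the fibre, and for large \<open>s\<close> the
  density vanishes on it.\<close>

lemma pushforward_vanishing:
  assumes w: "cball w e \<subseteq> G" "e > 0" and \<psi>: "continuous_on D \<psi>" "\<And>z. z \<in> D \<Longrightarrow> f z = w \<Longrightarrow> \<psi> z = 0"
    and \<eta>: "\<eta> > 0"
  shows "\<exists>s0. \<forall>s\<ge>s0. norm (pushforward \<psi> s w) \<le> \<eta> * Re (pushforward (\<lambda>z. 1) s w)"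
proof -
  let ?K = "{z\<in>D. f z \<in> cball w e}"
  let ?C = "{z\<in>?K. \<eta> \<le> norm (\<psi> z)}"
  have contK: "continuous_on ?K \<psi>"
    by (rule continuous_on_subset[OF \<psi>(1)]) auto
  have "closed ?C"
    by (rule continuous_on_closed_Collect_le[OF _ continuous_on_norm[OF contK] compact_imp_closed[OF fibre_nbhd_compact[OF w(1)]]])
      (rule continuous_on_const)
  then have "compact ?C"
    using fibre_nbhd_compact[OF w(1)] by (metis (no_types, lifting) compact_Int_closed inf.absorb_iff2 mem_Collect_eq subsetI)
  then obtain d where d: "d > 0" "\<And>z. z \<in> ?C \<Longrightarrow> d \<le> norm (f z - w)"
    using compact_gap[of ?C w] \<psi>(2) \<eta> by force
  show ?thesis
  proof (intro exI[of _ "max (1 / e) (1 / d)"] allI impI)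
    fix s assume s: "s \<ge> max (1 / e) (1 / d)"
    then have s': "s \<ge> 1 / e" "s \<ge> 1 / d" "s > 0"
      using w(2) by (auto intro: less_le_trans[of _ "1/e"])
    show "norm (pushforward \<psi> s w) \<le> \<eta> * Re (pushforward (\<lambda>z. 1) s w)"
    proof (rule pushforward_norm_le[OF w s'(1) \<psi>(1)])
      fix z assume z: "z \<in> D" "s * norm (f z - w) < 1"
      have "z \<in> ?K"
      proof (rule ccontr)
        assume "z \<notin> ?K"
        then have "1 \<le> s * norm (f z - w)"
          using density_supp[OF w(2) s'(1)] z(1) by blast
        with z(2) show False by simp
      qed
      moreover have "norm (f z - w) < d"
      proof -
        have "s * norm (f z - w) < s * d"
          using z(2) s'(2) d(1) by (simp add: field_simps)
        then show ?thesis using s'(3) by simp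
      qed
      ultimately show "norm (\<psi> z) \<le> \<eta>"
        using d(2)[of z] by fastforce
    qed
  qed
qed

end

section \<open>Elementary estimates for cubes and powers, and separation of points\<close>

lemma content_cube:
  fixes c :: "'a::euclidean_space"
  assumes "d \<ge> 0"
  shows "measure lborel (cbox (c - d *\<^sub>R One) (c + d *\<^sub>R One)) = (2 * d) ^ DIM('a)"
proof -
  have "measure lborel (cbox (c - d *\<^sub>R One) (c + d *\<^sub>R One)) = (\<Prod>b\<in>(Basis::'a set). 2 * d)"
    by (subst content_cbox) (use assms in \<open>auto simp: inner_diff_left inner_add_left\<close>)
  then show ?thesis by simp
qed

lemma norm_le_of_mem_cube:
  fixes c :: "'a::euclidean_space" and d :: real
  assumes "x \<in> cbox (c - d *\<^sub>R One) (c + d *\<^sub>R One)"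
  shows "norm (x - c) \<le> DIM('a) * d"
proof -
  have "norm (x - c) \<le> (\<Sum>b\<in>Basis. \<bar>(x - c) \<bullet> b\<bar>)"
    by (rule norm_le_l1)
  also have "\<dots> \<le> (\<Sum>b\<in>(Basis::'a set). d)"
    using assms by (intro sum_mono) (force simp: mem_box inner_diff_left inner_add_left abs_le_iff)
  finally show ?thesis by simp
qed

text \<open>Neither constant depends on \<open>k\<close>, so the rates of growth decide.\<close>

lemma le_of_powers_le:
  fixes x y :: real
  assumes "c > 0" "x \<ge> 0" "y \<ge> 0" and le: "\<And>k. x ^ k * c \<le> C * y ^ k"
  shows "x \<le> y"
proof (rule ccontr)
  assume "\<not> x \<le> y"
  then have x: "x > 0" "\<bar>y / x\<bar> < 1"
    using assms by (auto simp: field_simps)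
  have "c \<le> C * (y / x) ^ k" for k
    using le[of k] x(1) by (simp add: field_simps power_divide)
  moreover have "(\<lambda>k. C * (y / x) ^ k) \<longlonglongrightarrow> C * 0"
    by (intro tendsto_mult_left LIMSEQ_power_zero) (use x in simp)
  ultimately have "c \<le> C * 0"
    by (intro LIMSEQ_le_const) auto
  with assms(1) show False by simp
qed

lemma holomorphic_separating:
  fixes z1 :: "complex^'n"
  assumes "finite Z"
  shows "\<exists>g. holomorphic_Cn g UNIV \<and> g z1 = 1 \<and> (\<forall>y\<in>Z - {z1}. g y = 0)"
proof -
  have "\<forall>y\<in>Z - {z1}. \<exists>i. y $ i \<noteq> z1 $ i"
    by (auto simp: vec_eq_iff)
  then obtain i where i: "\<And>y. y \<in> Z - {z1} \<Longrightarrow> y $ i y \<noteq> z1 $ i y"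
    by metis
  define g where "g z = (\<Prod>y\<in>Z - {z1}. inverse (z1 $ i y - y $ i y) * (z $ i y - y $ i y))" for z
  have "holomorphic_Cn g UNIV"
    unfolding g_def
    by (intro holomorphic_Cn_prod holomorphic_Cn_cmult holomorphic_Cn_diff holomorphic_Cn_coord holomorphic_Cn_const)
  moreover have "g z1 = 1"
    unfolding g_def by (rule prod.neutral) (use i in fastforce)
  moreover have "g y = 0" if "y \<in> Z - {z1}" for y
    unfolding g_def by (rule prod_zero) (use assms that in auto)
  ultimately show ?thesis by blast
qed

lemma open_superlevel:
  fixes g :: "'a::topological_space \<Rightarrow> real"
  assumes "continuous_on D g" "open D"
  shows "open {z\<in>D. a < g z}"
proof -
  have "open (D \<inter> g -` {a<..})"
    by (rule continuous_open_preimage[OF assms open_greaterThan])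
  moreover have "D \<inter> g -` {a<..} = {z\<in>D. a < g z}"
    by auto
  ultimately show ?thesis by simp
qed

context proper_holo
begin

text \<open>On a cube about \<open>z1\<close> of side proportional to 1/s the map moves by at most
  1/(2s), so the bump stays away from 0 and the density is at least a multiple of
  \<open>s ^ N\<close>, where \<open>N\<close> is the real dimension. The volume of the cube is a
  multiple of the inverse power, so the bound does not depend on \<open>s\<close>.\<close>

lemma density_integral_lower_bound:
  assumes z1: "z1 \<in> D" "det (jac f z1) \<noteq> 0" and e: "cball (f z1) e \<subseteq> G" "e > 0"
    and g: "continuous_on D g" "\<And>z. g z \<ge> 0" "g z1 = 1"
  shows "\<exists>c>0. \<exists>s0. \<forall>s\<ge>s0. c \<le> integral D (\<lambda>z. \<rho> s (f z1) z *\<^sub>R (g z :: real))"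
proof -
  define j0 where "j0 = cmod (det (jac f z1))"
  define N where "N = DIM(complex^'n)"
  have j0: "j0 > 0"
    using z1(2) by (simp add: j0_def)
  have N: "N > 0" "N = 2 * CARD('n)"
    by (auto simp: N_def)
  note der = holomorphic_map_has_derivative[OF f z1(1)]
  obtain B0 where B0: "B0 > 0" "\<And>v. norm (jac f z1 *v v) \<le> norm v * B0"
    using bounded_linear.pos_bounded[OF has_derivative_bounded_linear[OF der]] by blast
  define B where "B = B0 + 1"
  obtain d1 where d1: "d1 > 0" "\<And>y. norm (y - z1) < d1 \<Longrightarrow>
      norm (f y - f z1 - jac f z1 *v (y - z1)) \<le> 1 * norm (y - z1)"
    using der unfolding has_derivative_at_alt by (meson zero_less_one)
  have fB: "norm (f y - f z1) \<le> B * norm (y - z1)" if "norm (y - z1) < d1" for y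
  proof -
    have "norm (f y - f z1) \<le> norm (f y - f z1 - jac f z1 *v (y - z1)) + norm (jac f z1 *v (y - z1))"
      using norm_triangle_ineq[of "f y - f z1 - jac f z1 *v (y - z1)" "jac f z1 *v (y - z1)"] by simp
    also have "\<dots> \<le> 1 * norm (y - z1) + norm (y - z1) * B0"
      by (intro add_mono d1(2)[OF that] B0(2))
    finally show ?thesis
      by (simp add: B_def algebra_simps)
  qed
  have contJ: "continuous_on D (\<lambda>z. cmod (det (jac f z)))"
    by (intro continuous_intros holomorphic_Cn_continuous_on[OF holomorphic_det_jac[OF D(1) f]])
  let ?A = "{z\<in>D. cmod (det (jac f z)) > j0 / 2}" and ?B = "{z\<in>D. g z > 1 / 2}"
  have op: "open ?A" "open ?B"
    by (rule open_superlevel[OF contJ D(1)], rule open_superlevel[OF g(1) D(1)])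
  have "j0 / 2 < j0"
    using j0 by simp
  then have "j0 / 2 < cmod (det (jac f z1))"
    unfolding j0_def .
  then have "z1 \<in> ?A \<inter> ?B"
    using z1(1) g(3) by simp
  then obtain d2 where d2: "d2 > 0" "ball z1 d2 \<subseteq> ?A \<inter> ?B"
    using open_Int[OF op] unfolding open_contains_ball by blast
  define r where "r = min d1 d2"
  have r: "r > 0"
    using d1 d2 by (simp add: r_def)
  \<comment> \<open>The first factor is the volume of the cube times \<open>s ^ N\<close>. On the
    cube the bump is at least (3/4)^2, its argument being at most (1/2)^2; the determinant is at
    least \<open>j0 / 2\<close> in modulus and \<open>g\<close> at least 1/2.\<close>
  define c where "c = (1 / (B * N)) ^ N * (9 / 16 * (j0 / 2)\<^sup>2 * (1 / 2))"
  have B: "B > 0"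
    using B0(1) by (simp add: B_def)
  have c: "c > 0"
    unfolding c_def using B N(1) j0 by simp
  define s0 where "s0 = max (1 / e) (1 / (B * r))"
  have "c \<le> integral D (\<lambda>z. \<rho> s (f z1) z *\<^sub>R g z)" if s: "s \<ge> s0" for s
  proof -
    have s': "s \<ge> 1 / e" "s \<ge> 1 / (B * r)" "s > 0"
      using s e(2) by (auto simp: s0_def intro: less_le_trans[of _ "1/e"])
    \<comment> \<open>Points of the cube are within \<open>N * d = 1 / (2 * B * s)\<close> of
      \<open>z1\<close>, and the local Lipschitz constant \<open>B\<close> turns this into 1/(2s)
      for the values of \<open>f\<close>.\<close>
    define d where "d = 1 / (2 * B * N * s)"
    have d: "d > 0"
      using B N(1) s'(3) by (simp add: d_def)
    let ?Q = "cbox (z1 - d *\<^sub>R One) (z1 + d *\<^sub>R One)"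
    have Nd: "N * d = 1 / (2 * B * s)"
      using N(1) B s'(3) by (simp add: d_def)
    have small: "N * d < r"
    proof -
      have "1 \<le> s * (B * r)"
        using s'(2) B r by (simp add: field_simps)
      then have "1 < 2 * B * s * r"
        by (simp add: mult_ac)
      then show ?thesis
        unfolding Nd using B s'(3) by (simp add: field_simps)
    qed
    have Q: "z \<in> D \<and> 9 / 16 * (s ^ CARD('n) * (j0 / 2))\<^sup>2 * (1 / 2) \<le> \<rho> s (f z1) z *\<^sub>R g z" if "z \<in> ?Q" for z
    proof -
      have near: "norm (z - z1) \<le> N * d"
        using norm_le_of_mem_cube[OF that] by (simp add: N_def)
      then have "z \<in> ball z1 d2" "norm (z - z1) < d1"
        using small by (auto simp: r_def dist_norm norm_minus_commute)
      then have z: "z \<in> D" "cmod (det (jac f z)) > j0 / 2" "g z > 1 / 2" "norm (f z - f z1) \<le> B * norm (z - z1)"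
        using d2(2) fB by auto
      have "s * norm (f z - f z1) \<le> s * (B * (N * d))"
        using z(4) near s'(3) B by (intro mult_left_mono order_trans[OF z(4)]) auto
      also have "\<dots> = 1 / 2"
        unfolding Nd using B s'(3) by simp
      finally have "(norm (s *\<^sub>R (f z - f z1)))\<^sup>2 \<le> (1 / 2)\<^sup>2"
        using s'(3) by (intro power_mono) auto
      then have "bump ((norm (s *\<^sub>R (f z - f z1)))\<^sup>2) \<ge> (3 / 4)\<^sup>2"
        unfolding bump_def by (intro power_mono) (auto simp: power2_eq_square)
      then have b: "bump ((norm (s *\<^sub>R (f z - f z1)))\<^sup>2) \<ge> 9 / 16"
        by (simp add: power2_eq_square)
      have "(s ^ CARD('n) * (j0 / 2))\<^sup>2 \<le> (s ^ CARD('n) * cmod (det (jac f z)))\<^sup>2"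
        using z(2) s'(3) j0 by (intro power_mono mult_left_mono) auto
      then show ?thesis
        unfolding fibre_density_def real_scaleR_def using b z(1,3)
        by (intro conjI mult_mono) (auto simp: bump_nonneg)
    qed
    have int: "(\<lambda>z. \<rho> s (f z1) z *\<^sub>R g z) integrable_on D"
      by (rule density_integrable[OF e s'(1) g(1)])
    have "c = measure lborel ?Q *\<^sub>R (9 / 16 * (s ^ CARD('n) * (j0 / 2))\<^sup>2 * (1 / 2))"
    proof -
      have "measure lborel ?Q = (1 / (B * N * s)) ^ N"
      proof -
        have "2 * d = 1 / (B * N * s)"
          by (simp add: d_def)
        then show ?thesis
          using content_cube[of d z1] d unfolding N_def by simp
      qed
      moreover have "(s ^ CARD('n))\<^sup>2 = s ^ N"
        by (simp add: N(2) power_mult[symmetric] mult.commute)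
      ultimately show ?thesis
        using s'(3) B N(1) unfolding c_def power_mult_distrib by (simp add: field_simps power_mult_distrib)
    qed
    also have "\<dots> = integral ?Q (\<lambda>z. 9 / 16 * (s ^ CARD('n) * (j0 / 2))\<^sup>2 * (1 / 2))"
      by (rule integral_const[symmetric])
    also have "\<dots> \<le> integral ?Q (\<lambda>z. \<rho> s (f z1) z *\<^sub>R g z)"
    proof (rule integral_le)
      show "(\<lambda>z. \<rho> s (f z1) z *\<^sub>R g z) integrable_on ?Q"
        by (rule integrable_on_subcbox[OF int]) (use Q in blast)
    qed (use Q in auto)
    also have "\<dots> \<le> integral D (\<lambda>z. \<rho> s (f z1) z *\<^sub>R g z)"
    proof (rule integral_subset_le[OF _ _ int])
      show "(\<lambda>z. \<rho> s (f z1) z *\<^sub>R g z) integrable_on ?Q"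
        by (rule integrable_on_subcbox[OF int]) (use Q in blast)
    qed (use Q in \<open>auto simp: g(2) fibre_density_nonneg\<close>)
    finally show ?thesis .
  qed
  with c show ?thesis by blast
qed

lemma pushforward_diff:
  assumes w: "cball w e \<subseteq> G" "e > 0" "s \<ge> 1 / e" and "continuous_on D g" "continuous_on D h"
  shows "pushforward (\<lambda>z. g z - h z) s w = pushforward g s w - pushforward h s w"
  unfolding pushforward_def scaleR_diff_right
  by (rule integral_diff[OF density_integrable[OF w assms(4)] density_integrable[OF w assms(5)]])

lemma pushforward_cmult: "pushforward (\<lambda>z. c * g z) s w = c * pushforward g s w"
  unfolding pushforward_def mult_scaleR_right[symmetric]
  by (rule Henstock_Kurzweil_Integration.integral_mult_right)

text \<open>The power sums over a fibre determine the largest modulus of \<open>h\<close> on it; the factor \<open>g\<close>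
  isolates one point of the fibre, so that no cancellation between the points can occur.\<close>

lemma fibre_estimate:
  assumes h: "holomorphic_Cn h D" and z1: "z1 \<in> D" and w: "w = f z1"
    and reg: "\<And>z. z \<in> D \<Longrightarrow> f z = w \<Longrightarrow> det (jac f z) \<noteq> 0"
    and e: "cball w e \<subseteq> G" "e > 0" and s: "s > 1 / e" and y: "y \<ge> 0"
    and bound: "\<And>g. holomorphic_Cn g UNIV \<Longrightarrow> \<exists>C. \<forall>k. cmod (pushforward (\<lambda>z. g z * h z ^ k) s w) \<le> C * y ^ k"
  shows "cmod (h z1) \<le> y"
proof -
  have "w \<in> G"
    using w z1 maps by blast
  then have fin: "finite {z\<in>D. f z = w}"
    by (rule regular_fibre_finite) (rule reg)
  obtain g where g: "holomorphic_Cn g UNIV" "g z1 = 1" "\<And>z. z \<in> D \<Longrightarrow> f z = w \<Longrightarrow> z \<noteq> z1 \<Longrightarrow> g z = 0"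
    using holomorphic_separating[OF fin, of z1] by auto
  have gD: "holomorphic_Cn g D"
    using holomorphic_Cn_subset[OF g(1)] by simp
  have contg: "continuous_on D g" and conth: "continuous_on D h"
    by (rule holomorphic_Cn_continuous_on[OF gD], rule holomorphic_Cn_continuous_on[OF h])
  obtain C where C: "\<And>k. cmod (pushforward (\<lambda>z. g z * h z ^ k) s w) \<le> C * y ^ k"
    using bound[OF g(1)] by blast
  have contng: "continuous_on D (\<lambda>z. cmod (g z))"
    by (intro continuous_intros contg)
  obtain c s0 where c: "c > 0" "\<And>s. s \<ge> s0 \<Longrightarrow> c \<le> integral D (\<lambda>z. \<rho> s w z *\<^sub>R cmod (g z))"
    using density_integral_lower_bound[OF z1 reg[OF z1] _ e(2) contng] g(2) e(1) w by force
  have "cmod (h z1) ^ k * c \<le> C * y ^ k" for k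
  proof (rule field_le_epsilon)
    fix \<eta> :: real assume \<eta>: "\<eta> > 0"
    \<comment> \<open>This vanishes on the whole fibre: at \<open>z1\<close> the two terms agree
      because \<open>g z1 = 1\<close>, and elsewhere \<open>g\<close> is 0. The modulus of
      \<open>g\<close> gives the second term the nonnegative weight that the lower bound
      requires.\<close>
    define \<psi> where "\<psi> z = g z * h z ^ k - h z1 ^ k * of_real (cmod (g z))" for z
    have cont\<psi>: "continuous_on D \<psi>"
      unfolding \<psi>_def by (intro continuous_intros contg conth)
    have \<psi>0: "\<psi> z = 0" if "z \<in> D" "f z = w" for z
      using g(2) g(3)[OF that] by (cases "z = z1") (auto simp: \<psi>_def)
    define M where "M = Re (pushforward (\<lambda>z. 1) s w)"
    define \<epsilon> where "\<epsilon> = \<eta> / (\<bar>M\<bar> + 1)"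
    have \<epsilon>: "\<epsilon> > 0"
      using \<eta> by (simp add: \<epsilon>_def)
    obtain s1 where s1: "\<And>s. s \<ge> s1 \<Longrightarrow> cmod (pushforward \<psi> s w) \<le> \<epsilon> * Re (pushforward (\<lambda>z. 1) s w)"
      using pushforward_vanishing[OF e cont\<psi> \<psi>0 \<epsilon>] by blast
    \<comment> \<open>The estimates for \<open>\<psi>\<close> and for the modulus of
      \<open>g\<close> hold at large scales, while \<open>C\<close> belongs to the scale
      \<open>s\<close>. Only integrals of holomorphic functions are carried from \<open>S\<close>
      back to \<open>s\<close>.\<close>
    define S where "S = Max {s0, s1, s}"
    have S: "S \<ge> s0" "S \<ge> s1" "S > 1 / e" "S \<ge> 1 / e"
      using s by (auto simp: S_def less_max_iff_disj)
    have MS: "pushforward (\<lambda>z. 1) S w = pushforward (\<lambda>z. 1) s w"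
      by (rule pushforward_scale[OF holomorphic_Cn_const e S(3) s])
    have PS: "pushforward (\<lambda>z. g z * h z ^ k) S w = pushforward (\<lambda>z. g z * h z ^ k) s w"
      by (rule pushforward_scale[OF _ e S(3) s]) (intro holomorphic_Cn_mult holomorphic_Cn_power gD h)
    have "pushforward (\<lambda>z. of_real (cmod (g z))) S w = of_real (integral D (\<lambda>z. \<rho> S w z *\<^sub>R cmod (g z)))"
      using integral_linear[OF density_integrable[OF e S(4) contng] bounded_linear_of_real[where 'a = complex]]
      by (simp add: pushforward_def o_def scaleR_conv_of_real)
    then have lower: "c \<le> cmod (pushforward (\<lambda>z. of_real (cmod (g z))) S w)"
      using c(2)[OF S(1)] by simp
    have "pushforward \<psi> S w = pushforward (\<lambda>z. g z * h z ^ k) S w - h z1 ^ k * pushforward (\<lambda>z. of_real (cmod (g z))) S w"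
      unfolding \<psi>_def
      by (subst pushforward_diff[OF e S(4)]) (auto intro!: continuous_intros contg conth simp: pushforward_cmult)
    then have "cmod (h z1 ^ k * pushforward (\<lambda>z. of_real (cmod (g z))) S w) \<le>
        cmod (pushforward (\<lambda>z. g z * h z ^ k) s w) + cmod (pushforward \<psi> S w)"
      using norm_triangle_ineq4[of "pushforward (\<lambda>z. g z * h z ^ k) s w" "pushforward \<psi> S w"] PS by simp
    also have "cmod (pushforward \<psi> S w) \<le> \<epsilon> * M"
      using s1[OF S(2)] MS by (simp add: M_def)
    also have "\<epsilon> * M \<le> \<eta>"
    proof -
      have "\<eta> * M \<le> \<eta> * (\<bar>M\<bar> + 1)"
        using \<eta> by (intro mult_left_mono) auto
      then show ?thesis
        by (simp add: \<epsilon>_def pos_divide_le_eq)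
    qed
    finally have "cmod (h z1) ^ k * cmod (pushforward (\<lambda>z. of_real (cmod (g z))) S w) \<le> C * y ^ k + \<eta>"
      using C[of k] by (simp add: norm_mult norm_power)
    moreover have "cmod (h z1) ^ k * c \<le> cmod (h z1) ^ k * cmod (pushforward (\<lambda>z. of_real (cmod (g z))) S w)"
      using lower by (intro mult_left_mono) auto
    ultimately show "cmod (h z1) ^ k * c \<le> C * y ^ k + \<eta>"
      by linarith
  qed
  then show ?thesis
    by (intro le_of_powers_le[OF c(1) _ y]) auto
qed

text \<open>The image of a neighbourhood of a regular point has interior, so it is not covered by
  the negligible set of critical values. Avoiding that set makes the whole fibre regular, not only
  the point in \<open>U\<close>.\<close>

lemma regular_values_dense:
  assumes U: "open U" "U \<subseteq> D" "U \<noteq> {}"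
  obtains z where "z \<in> U" "\<And>z'. z' \<in> D \<Longrightarrow> f z' = f z \<Longrightarrow> det (jac f z') \<noteq> 0"
proof -
  obtain x where x: "x \<in> U" "det (jac f x) \<noteq> 0"
    using jac_nonzero[OF U] by blast
  then have xD: "x \<in> D"
    using U by blast
  note der = holomorphic_map_has_derivative[OF f xD]
  have "invertible (jac f x)"
    using x(2) by (simp add: invertible_det_nz)
  then obtain A where "jac f x ** A = mat 1"
    unfolding invertible_def by blast
  then have inv: "(*v) (jac f x) \<circ> (*v) A = id"
    by (simp add: fun_eq_iff matrix_vector_mul_assoc)
  have lin: "bounded_linear ((*v) A)"
    by (rule linear_conv_bounded_linear[THEN iffD1], rule linearI)
      (simp_all add: vec_eq_iff matrix_vector_mult_def sum.distrib algebra_simps sum_distrib_left scaleR_conv_of_real[where 'a = complex])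
  have "f x \<in> interior (f ` U)"
    by (rule sussmann_open_mapping[OF D(1) cont_f xD der lin inv U(2)]) (use x U in \<open>simp add: interior_open\<close>)
  then have "\<not> negligible (f ` U)"
    using open_not_negligible[of "interior (f ` U)"] negligible_subset interior_subset by blast
  moreover have "negligible (f ` {z\<in>D. det (jac f z) = 0})"
    by (rule negligible_critical_values[OF f]) auto
  ultimately have "\<not> f ` U \<subseteq> f ` {z\<in>D. det (jac f z) = 0}"
    using negligible_subset by blast
  then obtain z where "z \<in> U" "f z \<notin> f ` {z\<in>D. det (jac f z) = 0}"
    by blast
  then show ?thesis
    using that[of z] by (metis (mono_tags, lifting) image_eqI mem_Collect_eq)
qed

end

section \<open>Shilov boundaries\<close>

definition domain_algebra :: "(complex^'n) set \<Rightarrow> (complex^'n \<Rightarrow> complex) set"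
  where "domain_algebra D = {h. holomorphic_Cn h D \<and> continuous_on (closure D) h}"

lemma domain_algebra_attains:
  assumes "bounded D" "h \<in> domain_algebra D" "closed S" "S \<subseteq> closure D" "S \<noteq> {}"
  obtains z where "z \<in> S" "\<And>y. y \<in> S \<Longrightarrow> cmod (h y) \<le> cmod (h z)"
proof -
  have "compact S"
    using assms by (meson bounded_closure bounded_subset compact_eq_bounded_closed)
  moreover have "continuous_on S (\<lambda>z. cmod (h z))"
    using assms(2,4) by (auto simp: domain_algebra_def intro!: continuous_on_norm intro: continuous_on_subset)
  ultimately show ?thesis
    using continuous_attains_sup[of S "\<lambda>z. cmod (h z)"] assms(5) that by blast
qed

text \<open>Since moduli attain their maxima on compact sets, equality of the suprema means that
  every bound on \<open>S\<close> is a bound on the closure. This form is easier to apply and to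
  refute.\<close>

lemma max_modulus_set_iff:
  assumes "bounded D" "D \<noteq> {}"
  shows "max_modulus_set D S \<longleftrightarrow> closed S \<and> S \<subseteq> closure D \<and> S \<noteq> {} \<and>
    (\<forall>h\<in>domain_algebra D. \<forall>M. (\<forall>z\<in>S. cmod (h z) \<le> M) \<longrightarrow> (\<forall>z\<in>closure D. cmod (h z) \<le> M))"
proof -
  have "(SUP z\<in>closure D. cmod (h z)) = (SUP z\<in>S. cmod (h z)) \<longleftrightarrow>
      (\<forall>M. (\<forall>z\<in>S. cmod (h z) \<le> M) \<longrightarrow> (\<forall>z\<in>closure D. cmod (h z) \<le> M))"
    if h: "h \<in> domain_algebra D" and S: "closed S" "S \<subseteq> closure D" "S \<noteq> {}" for h
  proof -
    obtain a where a: "a \<in> closure D" "\<And>y. y \<in> closure D \<Longrightarrow> cmod (h y) \<le> cmod (h a)"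
      using domain_algebra_attains[OF assms(1) h closed_closure order_refl] assms(2) by auto
    obtain b where b: "b \<in> S" "\<And>y. y \<in> S \<Longrightarrow> cmod (h y) \<le> cmod (h b)"
      using domain_algebra_attains[OF assms(1) h S] by blast
    have "(SUP z\<in>closure D. cmod (h z)) = cmod (h a)" "(SUP z\<in>S. cmod (h z)) = cmod (h b)"
      using a b by (auto intro!: cSup_eq_maximum)
    moreover have "cmod (h a) = cmod (h b) \<longleftrightarrow>
        (\<forall>M. (\<forall>z\<in>S. cmod (h z) \<le> M) \<longrightarrow> (\<forall>z\<in>closure D. cmod (h z) \<le> M))"
    proof
      assume eq: "cmod (h a) = cmod (h b)"
      show "\<forall>M. (\<forall>z\<in>S. cmod (h z) \<le> M) \<longrightarrow> (\<forall>z\<in>closure D. cmod (h z) \<le> M)"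
        using a(2) b(1) order_trans unfolding eq by blast
    next
      assume "\<forall>M. (\<forall>z\<in>S. cmod (h z) \<le> M) \<longrightarrow> (\<forall>z\<in>closure D. cmod (h z) \<le> M)"
      then have "cmod (h a) \<le> cmod (h b)"
        using a(1) b(2) by blast
      moreover have "cmod (h b) \<le> cmod (h a)"
        using a(2) b(1) S(2) by blast
      ultimately show "cmod (h a) = cmod (h b)"
        by (rule order_antisym)
    qed
    ultimately show ?thesis by simp
  qed
  note key = this
  have "max_modulus_set D S \<longleftrightarrow> closed S \<and> S \<subseteq> closure D \<and> S \<noteq> {} \<and>
      (\<forall>h\<in>domain_algebra D. (SUP z\<in>closure D. cmod (h z)) = (SUP z\<in>S. cmod (h z)))"
    unfolding max_modulus_set_def domain_algebra_def by simp
  also have "\<dots> \<longleftrightarrow> closed S \<and> S \<subseteq> closure D \<and> S \<noteq> {} \<and>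
      (\<forall>h\<in>domain_algebra D. \<forall>M. (\<forall>z\<in>S. cmod (h z) \<le> M) \<longrightarrow> (\<forall>z\<in>closure D. cmod (h z) \<le> M))"
    by (intro conj_cong refl ball_cong) (rule key)
  finally show ?thesis .
qed

lemma max_modulus_setD:
  assumes "bounded D" "D \<noteq> {}" "max_modulus_set D S" "h \<in> domain_algebra D"
    "\<And>z. z \<in> S \<Longrightarrow> cmod (h z) \<le> M" "z \<in> closure D"
  shows "cmod (h z) \<le> M"
  using assms(3-6) unfolding max_modulus_set_iff[OF assms(1,2)] by simp

lemma domain_algebra_const: "(\<lambda>z. c) \<in> domain_algebra D"
  by (simp add: domain_algebra_def holomorphic_Cn_const)

lemma domain_algebra_mult: "g \<in> domain_algebra D \<Longrightarrow> h \<in> domain_algebra D \<Longrightarrow> (\<lambda>z. g z * h z) \<in> domain_algebra D"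
  by (auto simp: domain_algebra_def intro: holomorphic_Cn_mult continuous_on_mult)

lemma domain_algebra_power: "h \<in> domain_algebra D \<Longrightarrow> (\<lambda>z. h z ^ k) \<in> domain_algebra D"
  by (auto simp: domain_algebra_def intro: holomorphic_Cn_power continuous_on_power)

lemma domain_algebra_coord_diff: "(\<lambda>z. z $ i - c) \<in> domain_algebra D"
  by (auto simp: domain_algebra_def intro!: holomorphic_Cn_diff holomorphic_Cn_coord holomorphic_Cn_const continuous_intros)

text \<open>These neighbourhoods are cut out by coordinate functions, which belong to the algebra;
  that a point lies outside is witnessed by a single coordinate.\<close>

definition polydisc :: "complex^'n \<Rightarrow> real \<Rightarrow> (complex^'n) set"
  where "polydisc x d = {z. \<forall>i. cmod (z $ i - x $ i) < d}"

lemma open_polydisc: "open (polydisc x d)"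
proof -
  have "polydisc x d = (\<Inter>i\<in>UNIV. {z. cmod (z $ i - x $ i) < d})"
    by (auto simp: polydisc_def)
  moreover have "open {z. cmod (z $ i - x $ i) < d}" for i
    by (intro open_Collect_less continuous_intros)
  ultimately show ?thesis
    by (simp add: open_INT)
qed

lemma polydisc_subset_ball:
  fixes x :: "complex^'n"
  assumes "r > 0"
  shows "polydisc x (r / CARD('n)) \<subseteq> ball x r"
proof
  fix z assume z: "z \<in> polydisc x (r / CARD('n))"
  have "norm (z - x) \<le> (\<Sum>i\<in>UNIV. norm ((z - x) $ i))"
    unfolding norm_vec_def by (rule L2_set_le_sum) auto
  also have "\<dots> < (\<Sum>i\<in>(UNIV::'n set). r / CARD('n))"
    using z by (intro sum_strict_mono) (auto simp: polydisc_def)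
  finally show "z \<in> ball x r"
    by (simp add: dist_norm norm_minus_commute)
qed

text \<open>If \<open>h\<close> were larger on \<open>V\<close> than on \<open>T - V\<close>, then for large \<open>N\<close> the functions
  \<open>(z\<^sub>i - x\<^sub>i) h\<^sup>N\<close> would be small on \<open>T\<close>, but not all of them at a point of \<open>E\<close> where \<open>\<bar>h\<bar>\<close> is maximal.\<close>

lemma max_modulus_set_Diff_polydisc:
  fixes D :: "(complex^'n) set"
  assumes D: "bounded D" "D \<noteq> {}" and T: "max_modulus_set D T" and E: "max_modulus_set D E"
    and d: "d > 0" and disj: "polydisc x d \<inter> E = {}"
  shows "max_modulus_set D (T - polydisc x d)"
proof (rule ccontr)
  let ?V = "polydisc x d"
  assume neg: "\<not> max_modulus_set D (T - ?V)"
  note T' = T[unfolded max_modulus_set_iff[OF D]] and E' = E[unfolded max_modulus_set_iff[OF D]]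
  \<comment> \<open>An empty \<open>T - ?V\<close> fails by definition and not through some
    function; the constant 1 with bound 0 then plays the same part.\<close>
  have "\<exists>h\<in>domain_algebra D. \<exists>M\<ge>0. (\<forall>z\<in>T - ?V. cmod (h z) \<le> M) \<and> (\<exists>z\<in>closure D. M < cmod (h z))"
  proof (cases "T - ?V = {}")
    case True
    then show ?thesis
      using D(2) by (intro bexI[of _ "\<lambda>z. 1"] exI[of _ 0]) (auto simp: domain_algebra_const ex_in_conv)
  next
    case False
    moreover have "closed (T - ?V)"
      using T' closed_Diff[OF _ open_polydisc] by blast
    moreover have "T - ?V \<subseteq> closure D"
      using T' by blast
    ultimately obtain h M where h: "h \<in> domain_algebra D" "\<forall>z\<in>T - ?V. cmod (h z) \<le> M" "\<exists>z\<in>closure D. M < cmod (h z)"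
      using neg unfolding max_modulus_set_iff[OF D] by (meson not_le)
    moreover have "M \<ge> 0"
      using h(2) False norm_ge_zero order_trans by blast
    ultimately show ?thesis by blast
  qed
  then obtain h M z0 where h: "h \<in> domain_algebra D" and M: "M \<ge> 0" "\<And>z. z \<in> T - ?V \<Longrightarrow> cmod (h z) \<le> M"
    and z0: "z0 \<in> closure D" "M < cmod (h z0)"
    by blast
  obtain e where e: "e \<in> E" "\<And>y. y \<in> E \<Longrightarrow> cmod (h y) \<le> cmod (h e)"
    using domain_algebra_attains[OF D(1) h, of E] E' by blast
  define m where "m = cmod (h e)"
  have m: "cmod (h z) \<le> m" if "z \<in> closure D" for z
    unfolding m_def by (rule max_modulus_setD[OF D E h e(2) that])
  have Mm: "M < m"
    using m[OF z0(1)] z0(2) by simp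
  obtain R where R: "R > 0" "\<And>z. z \<in> closure D \<Longrightarrow> norm (z - x) \<le> R"
  proof -
    obtain R0 where "\<And>z. z \<in> closure D \<Longrightarrow> norm z \<le> R0" "R0 > 0"
      using bounded_closure[OF D(1)] bounded_pos by metis
    then show ?thesis
      by (intro that[of "R0 + norm x"]) (auto intro: add_pos_nonneg order_trans[OF norm_triangle_ineq4] add_mono)
  qed
  have Ri: "cmod (z $ i - x $ i) \<le> R" if "z \<in> closure D" for z i
    using order_trans[OF Finite_Cartesian_Product.norm_nth_le R(2)[OF that], of i] by simp
  \<comment> \<open>A high power amplifies the gap between the bound \<open>M\<close> off the
    polydisc and the maximum \<open>m\<close> until it outweighs the size \<open>R\<close> of the
    coordinate differences.\<close>
  obtain N where N: "(M / m) ^ N < d / R"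
    using real_arch_pow_inv[of "d / R" "M / m"] d R(1) Mm M(1) by (auto simp: divide_less_eq)
  have N': "R * M ^ N < d * m ^ N"
    using N Mm M(1) R(1) by (simp add: power_divide field_simps)
  have mN: "m ^ N > 0"
    using Mm M(1) by simp
  have lt: "cmod ((z $ i - x $ i) * h z ^ N) < d * m ^ N" if z: "z \<in> T" for z i
  proof (cases "z \<in> ?V")
    case True
    have "cmod (h z) ^ N \<le> m ^ N"
      using z T' m by (intro power_mono) auto
    then have "cmod (z $ i - x $ i) * cmod (h z) ^ N \<le> cmod (z $ i - x $ i) * m ^ N"
      by (intro mult_left_mono) auto
    also have "\<dots> < d * m ^ N"
      using True mN by (auto simp: polydisc_def)
    finally show ?thesis
      by (simp add: norm_mult norm_power)
  next
    case False
    have "cmod (z $ i - x $ i) * cmod (h z) ^ N \<le> R * M ^ N"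
      using z False T' M(2)[of z] Ri[of z i] R(1) by (intro mult_mono power_mono) auto
    with N' show ?thesis
      by (simp add: norm_mult norm_power)
  qed
  have "e \<notin> ?V"
    using disj e(1) by blast
  then obtain i where i: "d \<le> cmod (e $ i - x $ i)"
    by (auto simp: polydisc_def not_less)
  let ?g = "\<lambda>z. (z $ i - x $ i) * h z ^ N"
  have g: "?g \<in> domain_algebra D"
    by (intro domain_algebra_mult domain_algebra_power domain_algebra_coord_diff h)
  obtain t where t: "t \<in> T" "\<And>y. y \<in> T \<Longrightarrow> cmod (?g y) \<le> cmod (?g t)"
    using domain_algebra_attains[OF D(1) g, of T] T' by blast
  have "e \<in> closure D"
    using e(1) E' by blast
  from max_modulus_setD[OF D T g t(2) this] have "cmod (?g e) \<le> cmod (?g t)" .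
  also have "\<dots> < d * m ^ N"
    by (rule lt[OF t(1)])
  also have "\<dots> \<le> cmod (?g e)"
    using i mN by (simp add: norm_mult norm_power m_def mult_right_mono)
  finally show False by simp
qed

text \<open>If the intersection failed, some \<open>h\<close> would exceed at \<open>z0\<close> all
  its moduli there. The compact set \<open>C\<close> where the modulus is at least that of
  \<open>h z0\<close> is then covered by finitely many polydiscs, each missing some maximum modulus
  set. Removing them one by one from the closure of \<open>D\<close> leaves a maximum modulus set
  disjoint from \<open>C\<close>, on which the modulus must nevertheless reach that value.\<close>

lemma max_modulus_set_Inter:
  fixes D :: "(complex^'n) set"
  assumes D: "bounded D" "D \<noteq> {}"
  shows "max_modulus_set D (\<Inter>{S. max_modulus_set D S})"
proof (rule ccontr)
  define S0 where "S0 = \<Inter>{S. max_modulus_set D S}"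
  assume "\<not> max_modulus_set D (\<Inter>{S. max_modulus_set D S})"
  then have neg: "\<not> max_modulus_set D S0"
    by (simp add: S0_def)
  have top: "max_modulus_set D (closure D)"
    using D by (auto simp: max_modulus_set_iff)
  have "closed S0" "S0 \<subseteq> closure D"
    using top by (auto simp: S0_def max_modulus_set_def)
  have "\<exists>h\<in>domain_algebra D. \<exists>z0\<in>closure D. \<forall>z\<in>S0. cmod (h z) < cmod (h z0)"
  proof (cases "S0 = {}")
    case True
    then show ?thesis
      using D(2) domain_algebra_const by fastforce
  next
    case False
    with neg \<open>closed S0\<close> \<open>S0 \<subseteq> closure D\<close> obtain h M z0 where h: "h \<in> domain_algebra D"
      "\<forall>z\<in>S0. cmod (h z) \<le> M" "z0 \<in> closure D" "\<not> cmod (h z0) \<le> M"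
      unfolding max_modulus_set_iff[OF D] by blast
    then have "\<forall>z\<in>S0. cmod (h z) < cmod (h z0)"
      by fastforce
    with h(1,3) show ?thesis by blast
  qed
  then obtain h z0 where h: "h \<in> domain_algebra D" and z0: "z0 \<in> closure D" "\<And>z. z \<in> S0 \<Longrightarrow> cmod (h z) < cmod (h z0)"
    by blast
  define C where "C = {z\<in>closure D. cmod (h z0) \<le> cmod (h z)}"
  have "closed C"
    unfolding C_def using h
    by (intro continuous_on_closed_Collect_le) (auto simp: domain_algebra_def intro!: continuous_intros)
  then have "compact C"
    using D(1) by (metis (no_types, lifting) C_def bounded_closure bounded_subset compact_eq_bounded_closed mem_Collect_eq subsetI)
  define \<V> where "\<V> = {V. \<exists>x d E. V = polydisc x d \<and> d > 0 \<and> max_modulus_set D E \<and> polydisc x d \<inter> E = {}}"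
  have "C \<subseteq> \<Union>\<V>"
  proof
    fix x assume "x \<in> C"
    then have "x \<notin> S0"
      using z0(2)[of x] by (auto simp: C_def)
    then obtain E where E: "max_modulus_set D E" "x \<notin> E"
      by (auto simp: S0_def)
    then have "open (- E)" "x \<in> - E"
      by (auto simp: max_modulus_set_def)
    then obtain r where r: "r > 0" "ball x r \<subseteq> - E"
      using open_contains_ball by blast
    have "polydisc x (r / CARD('n)) \<inter> E = {}"
      using polydisc_subset_ball[OF r(1), of x] r(2) by blast
    moreover have "x \<in> polydisc x (r / CARD('n))"
      using r(1) by (simp add: polydisc_def)
    moreover have "polydisc x (r / CARD('n)) \<in> \<V>" if "polydisc x (r / CARD('n)) \<inter> E = {}"
      unfolding \<V>_def using E(1) r(1) that
      by (intro CollectI exI[of _ x] exI[of _ "r / CARD('n)"] exI[of _ E]) auto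
    ultimately show "x \<in> \<Union>\<V>"
      by blast
  qed
  moreover have "open V" if "V \<in> \<V>" for V
    using that open_polydisc by (auto simp: \<V>_def)
  ultimately obtain \<F> where \<F>: "\<F> \<subseteq> \<V>" "finite \<F>" "C \<subseteq> \<Union>\<F>"
    using compactE[OF \<open>compact C\<close>] by metis
  have closure_minus: "max_modulus_set D (closure D - \<Union>\<F>)"
    using \<F>(2,1)
  proof (induction \<F> rule: finite_induct)
    case empty
    then show ?case using top by simp
  next
    case (insert V \<F>)
    then obtain x d E where V: "V = polydisc x d" "d > 0" "max_modulus_set D E" "polydisc x d \<inter> E = {}"
      by (auto simp: \<V>_def)
    have "closure D - \<Union>(insert V \<F>) = (closure D - \<Union>\<F>) - polydisc x d"
      using V(1) by auto
    then show ?case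
      using max_modulus_set_Diff_polydisc[OF D _ V(3,2,4), of "closure D - \<Union>\<F>"] insert by simp
  qed
  note T = this[unfolded max_modulus_set_iff[OF D]]
  obtain t where t: "t \<in> closure D - \<Union>\<F>" "\<And>y. y \<in> closure D - \<Union>\<F> \<Longrightarrow> cmod (h y) \<le> cmod (h t)"
    using domain_algebra_attains[OF D(1) h, of "closure D - \<Union>\<F>"] T by blast
  have "cmod (h z0) \<le> cmod (h t)"
    by (rule max_modulus_setD[OF D closure_minus h t(2) z0(1)])
  then have "t \<in> C"
    using t(1) by (simp add: C_def)
  then show False
    using t(1) \<F>(3) by blast
qed

lemma shilov_boundary_eq_Inter:
  assumes "bounded D" "D \<noteq> {}"
  shows "shilov_boundary D = \<Inter>{S. max_modulus_set D S}"
  unfolding shilov_boundary_def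
  by (rule Least_equality) (use max_modulus_set_Inter[OF assms] in auto)

lemma max_modulus_set_shilov:
  assumes "bounded D" "D \<noteq> {}"
  shows "max_modulus_set D (shilov_boundary D)"
  unfolding shilov_boundary_eq_Inter[OF assms] by (rule max_modulus_set_Inter[OF assms])

lemma shilov_boundary_least:
  assumes "bounded D" "D \<noteq> {}" "max_modulus_set D S"
  shows "shilov_boundary D \<subseteq> S"
  using assms by (auto simp: shilov_boundary_eq_Inter)

text \<open>The one-variable maximum principle on the slice of \<open>D\<close> by a complex line
  through \<open>z\<close>. It serves to place the Shilov boundary outside the open set
  itself.\<close>

lemma max_modulus_set_frontier:
  fixes D :: "(complex^'n) set"
  assumes D: "open D" "bounded D" "D \<noteq> {}"
  shows "max_modulus_set D (frontier D)"
  unfolding max_modulus_set_iff[OF D(2,3)]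
proof (intro conjI ballI allI impI)
  show "closed (frontier D)" "frontier D \<subseteq> closure D"
    by (auto simp: frontier_def)
  show "frontier D \<noteq> {}"
    using D not_bounded_UNIV frontier_not_empty by blast
  fix h M z
  assume h: "h \<in> domain_algebra D" and M: "\<forall>z\<in>frontier D. cmod (h z) \<le> M" and z: "z \<in> closure D"
  show "cmod (h z) \<le> M"
  proof (cases "z \<in> D")
    case False
    with z D(1) M show ?thesis
      by (simp add: frontier_def interior_open)
  next
    case True
    \<comment> \<open>Any nonzero direction will do; \<open>undefined\<close> picks some
      coordinate.\<close>
    define v :: "complex^'n" where "v = axis undefined 1"
    define S where "S = {\<zeta>. z + \<zeta> *s v \<in> D}"
    have S: "open S"
      unfolding S_def by (rule open_complex_line_vimage[OF D(1)])
    have "(\<lambda>\<zeta>. z + \<zeta> *s v) ` closure S \<subseteq> closure D"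
      by (rule image_closure_subset[OF continuous_on_complex_line]) (auto simp: S_def intro: closure_subset[THEN subsetD])
    then have cl: "z + \<zeta> *s v \<in> closure D" if "\<zeta> \<in> closure S" for \<zeta>
      using that by blast
    have "cmod (h (z + 0 *s v)) \<le> M"
    proof (rule maximum_modulus_frontier[where f = "\<lambda>\<zeta>. h (z + \<zeta> *s v)" and \<xi> = 0 and S = S])
      show "(\<lambda>\<zeta>. h (z + \<zeta> *s v)) holomorphic_on interior S"
        using holomorphic_on_line[of h D z v] h S by (simp add: S_def interior_open domain_algebra_def)
      show "continuous_on (closure S) (\<lambda>\<zeta>. h (z + \<zeta> *s v))"
        by (rule continuous_on_compose2[of "closure D" h, OF _ continuous_on_complex_line])
          (use h cl in \<open>auto simp: domain_algebra_def\<close>)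
      obtain R where R: "\<And>y. y \<in> D \<Longrightarrow> norm y \<le> R"
        using D(2) bounded_iff by blast
      have "cmod \<zeta> \<le> R + norm z" if "\<zeta> \<in> S" for \<zeta>
      proof -
        have "norm (\<zeta> *s v) \<le> norm (z + \<zeta> *s v) + norm z"
          using norm_triangle_ineq4[of "z + \<zeta> *s v" z] by simp
        moreover have "norm (\<zeta> *s v) = cmod \<zeta>"
          unfolding v_def axis_conv_smult[symmetric] by simp
        ultimately show ?thesis
          using R[of "z + \<zeta> *s v"] that by (simp add: S_def)
      qed
      then show "bounded S"
        by (auto simp: bounded_iff)
      show "cmod (h (z + \<zeta> *s v)) \<le> M" if "\<zeta> \<in> frontier S" for \<zeta>
      proof -
        have "z + \<zeta> *s v \<in> closure D" "z + \<zeta> *s v \<notin> D"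
          using that cl S by (auto simp: frontier_def interior_open S_def)
        then show ?thesis
          using M D(1) by (simp add: frontier_def interior_open)
      qed
      show "0 \<in> S"
        using True by (simp add: S_def)
    qed
    then show ?thesis by simp
  qed
qed

section \<open>The image of the Shilov boundary\<close>

text \<open>Suppose that \<open>h\<close> has modulus at most \<open>B\<close> over the
  \<open>\<epsilon>\<close>-neighbourhood of the Shilov boundary of \<open>W\<close>. On this
  boundary the fibre integrals of g h^k are then at most a constant times B^k, and by maximality so
  on all of \<open>W\<close>. Hence \<open>fibre_estimate\<close> bounds \<open>h\<close> by
  \<open>B\<close> on every regular fibre over \<open>W\<close>, and one of these meets the nonempty
  open set over \<open>W\<close> where the modulus exceeds \<open>B\<close>.\<close>

lemma (in proper_holo) exhaustion_estimate:
  assumes W: "bounded W" "W \<noteq> {}" "open W" and \<epsilon>: "\<epsilon> > 0" "\<And>w. w \<in> closure W \<Longrightarrow> cball w \<epsilon> \<subseteq> G"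
    and h: "holomorphic_Cn h D" and x: "x \<in> D" "f x \<in> W" and B: "B < cmod (h x)"
  shows "\<exists>z\<in>D. \<exists>p\<in>shilov_boundary W. norm (f z - p) \<le> \<epsilon> \<and> B < cmod (h z)"
proof (rule ccontr)
  assume "\<not> ?thesis"
  then have hB: "cmod (h z) \<le> B" if "z \<in> D" "p \<in> shilov_boundary W" "norm (f z - p) \<le> \<epsilon>" for z p
    using that by force
  note shilov = max_modulus_set_shilov[OF W(1,2)]
  note shilov' = shilov[unfolded max_modulus_set_iff[OF W(1,2)]]
  \<comment> \<open>The comparison of powers requires a nonnegative bound; surjectivity supplies a
    point over the Shilov boundary at which the assumed bound holds.\<close>
  have "B \<ge> 0"
  proof -
    obtain p where p: "p \<in> shilov_boundary W"
      using shilov' by blast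
    have "p \<in> cball p \<epsilon>" "p \<in> closure W"
      using p shilov' \<epsilon>(1) by auto
    then have "p \<in> G"
      using \<epsilon>(2) by blast
    then obtain z where "z \<in> D" "f z = p"
      using image_eq by blast
    then have "cmod (h z) \<le> B"
      using hB[OF _ p] \<epsilon>(1) by auto
    then show ?thesis
      using norm_ge_zero order_trans by blast
  qed
  \<comment> \<open>Strictly above \<open>1 / \<epsilon>\<close>, as scale invariance asks; the
    density at a point sees only values of \<open>f\<close> within \<open>\<epsilon> / 2\<close> of
    it.\<close>
  define s where "s = 2 / \<epsilon>"
  have s: "s > 1 / \<epsilon>" "s \<ge> 1 / \<epsilon>" "s > 0"
    using \<epsilon>(1) by (auto simp: s_def divide_strict_right_mono divide_right_mono)
  have hol: "holomorphic_Cn (pushforward H s) (closure W)" if "holomorphic_Cn H D" for H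
    by (rule pushforward_holomorphic[OF that \<epsilon>(2) \<epsilon>(1) s(2)])
  have alg: "pushforward H s \<in> domain_algebra W" if "holomorphic_Cn H D" for H
    using hol[OF that] holomorphic_Cn_subset[OF hol[OF that] closure_subset]
    by (simp add: domain_algebra_def holomorphic_Cn_continuous_on)
  \<comment> \<open>A point of the compact closure with the largest total mass, so that the constant
    in the bound depends neither on \<open>p\<close> nor on \<open>k\<close>.\<close>
  obtain N where N: "\<And>w. w \<in> closure W \<Longrightarrow> cmod (pushforward (\<lambda>z. 1) s w) \<le> cmod (pushforward (\<lambda>z. 1) s N)"
  proof -
    have "closure W \<noteq> {}"
      using W(2) by simp
    from domain_algebra_attains[OF W(1) alg[OF holomorphic_Cn_const[of 1]] closed_closure order_refl this] that
    show ?thesis by blast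
  qed
  have reg_bound: "cmod (h z1) \<le> B"
    if z1: "z1 \<in> D" "f z1 \<in> W" and reg: "\<And>z. z \<in> D \<Longrightarrow> f z = f z1 \<Longrightarrow> det (jac f z) \<noteq> 0" for z1
  proof (rule fibre_estimate[OF h z1(1) refl reg _ \<epsilon>(1) s(1) \<open>B \<ge> 0\<close>])
    have z1W: "f z1 \<in> closure W"
      using z1(2) closure_subset by blast
    then show "cball (f z1) \<epsilon> \<subseteq> G"
      by (rule \<epsilon>(2))
    fix g :: "complex^'n \<Rightarrow> complex" assume g: "holomorphic_Cn g UNIV"
    have "compact (closure D)"
      using D(2) by (simp add: bounded_closure compact_eq_bounded_closed)
    then have "compact (g ` closure D)"
      by (intro compact_continuous_image continuous_on_subset[OF holomorphic_Cn_continuous_on[OF g]]) auto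
    then obtain Cg where Cg: "\<And>z. z \<in> D \<Longrightarrow> cmod (g z) \<le> Cg" "Cg > 0"
      using closure_subset[of D] bounded_pos compact_imp_bounded by (metis (no_types, opaque_lifting) imageI subsetD)
    let ?N = "cmod (pushforward (\<lambda>z. 1) s N)"
    have gD: "holomorphic_Cn g D"
      using holomorphic_Cn_subset[OF g] by simp
    have "cmod (pushforward (\<lambda>z. g z * h z ^ k) s (f z1)) \<le> Cg * ?N * B ^ k" for k
    proof -
      have H: "holomorphic_Cn (\<lambda>z. g z * h z ^ k) D"
        by (intro holomorphic_Cn_mult holomorphic_Cn_power gD h)
      have "cmod (pushforward (\<lambda>z. g z * h z ^ k) s p) \<le> Cg * ?N * B ^ k" if p: "p \<in> shilov_boundary W" for p
      proof -
        have pW: "p \<in> closure W"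
          using p shilov' by blast
        have "cmod (pushforward (\<lambda>z. g z * h z ^ k) s p) \<le> (Cg * B ^ k) * Re (pushforward (\<lambda>z. 1) s p)"
        proof (rule pushforward_norm_le[OF \<epsilon>(2)[OF pW] \<epsilon>(1) s(2) holomorphic_Cn_continuous_on[OF H]])
          fix z assume z: "z \<in> D" "s * norm (f z - p) < 1"
          have "2 * norm (f z - p) < \<epsilon>"
            using z(2) \<epsilon>(1) by (simp add: s_def field_simps)
          then have "norm (f z - p) \<le> \<epsilon>"
            using norm_ge_zero[of "f z - p"] by linarith
          then have "cmod (h z) ^ k \<le> B ^ k"
            by (intro power_mono hB[OF z(1) p]) auto
          then show "cmod (g z * h z ^ k) \<le> Cg * B ^ k"
            using Cg z(1) by (simp add: norm_mult norm_power mult_mono)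
        qed
        also have "\<dots> \<le> (Cg * B ^ k) * ?N"
          using Cg(2) \<open>B \<ge> 0\<close> N[OF pW] by (intro mult_left_mono order_trans[OF complex_Re_le_cmod]) auto
        finally show ?thesis
          by (simp add: mult_ac)
      qed
      from max_modulus_setD[OF W(1,2) shilov alg[OF H] this z1W] show ?thesis .
    qed
    then show "\<exists>C. \<forall>k. cmod (pushforward (\<lambda>z. g z * h z ^ k) s (f z1)) \<le> C * B ^ k"
      by blast
  qed
  let ?U = "{z\<in>D. B < cmod (h z)} \<inter> (D \<inter> f -` W)"
  have "open ?U"
    by (intro open_Int open_superlevel continuous_open_preimage continuous_on_norm
        holomorphic_Cn_continuous_on[OF h] cont_f D(1) W(3))
  moreover have "x \<in> ?U"
    using x B by simp
  ultimately obtain z where "z \<in> ?U" "\<And>z'. z' \<in> D \<Longrightarrow> f z' = f z \<Longrightarrow> det (jac f z') \<noteq> 0"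
    using regular_values_dense[of ?U] by blast
  with reg_bound[of z] show False
    by auto
qed

theorem theorem2:
  fixes D G :: "(complex ^ 'n) set"
    and f :: "complex ^ 'n \<Rightarrow> complex ^ 'n"
    and Gm :: "nat \<Rightarrow> (complex ^ 'n) set"
  assumes "domain_Cn D" and "bounded D"
    and "domain_Cn G" and "bounded G"
    and "proper_holomorphic_map D G f"
    and "continuous_on (closure D) f"
    and "\<And>m. domain_Cn (Gm m)"
    and "\<And>m. relatively_compact_in (Gm m) (Gm (Suc m))"
    and "(\<Union>m. Gm m) = G"
    and "closure (\<Union>m. shilov_boundary (Gm m)) \<inter> frontier G = shilov_boundary G"
  shows "f ` shilov_boundary D = shilov_boundary G"
proof -
  interpret proper_holo D G f
    using assms(1-5) unfolding domain_Cn_def proper_holomorphic_map_def proper_map_top_of_set_iff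
    by unfold_locales auto
  note contf = assms(6)
  have G0: "G \<noteq> {}" "bounded G"
    using assms(3,4) by (auto simp: domain_Cn_def)
  have compD: "compact (closure D)"
    using D(2) by (simp add: bounded_closure compact_eq_bounded_closed)
  have fcl: "f ` closure D \<subseteq> closure G"
    by (rule image_closure_subset[OF contf closed_closure]) (use maps closure_subset in blast)
  note shD = max_modulus_set_shilov[OF D(2,4)]
  note shD' = shD[unfolded max_modulus_set_iff[OF D(2,4)]]
  have GmG: "Gm m \<subseteq> G" for m
    using assms(9) by blast
  have Gm: "open (Gm m)" "Gm m \<noteq> {}" "bounded (Gm m)" for m
    using assms(7)[of m] bounded_subset[OF G0(2) GmG] by (auto simp: domain_Cn_def)
  have clG: "closure (Gm m) \<subseteq> G" "compact (closure (Gm m))" for m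
    using assms(8)[of m] GmG[of "Suc m"] by (auto simp: relatively_compact_in_def)
  have mono: "Gm k \<subseteq> Gm m" if "k \<le> m" for k m
  proof (rule lift_Suc_mono_le[of Gm, OF _ that])
    show "Gm i \<subseteq> Gm (Suc i)" for i
      using assms(8)[of i] closure_subset[of "Gm i"] by (auto simp: relatively_compact_in_def)
  qed
  \<comment> \<open>This is what will keep limits of points of these Shilov boundaries out of
    \<open>G\<close>.\<close>
  have shGm: "shilov_boundary (Gm m) \<inter> Gm m = {}" for m
    using shilov_boundary_least[OF Gm(3,2) max_modulus_set_frontier[OF Gm(1,3,2)], of m] Gm(1)[of m]
    by (auto simp: frontier_def interior_open)

  have "max_modulus_set G (f ` shilov_boundary D)"
    unfolding max_modulus_set_iff[OF G0(2,1)]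
  proof (intro conjI ballI allI impI)
    have "compact (shilov_boundary D)"
      using shD' compD by (metis compact_Int_closed inf.absorb_iff2)
    then show "closed (f ` shilov_boundary D)"
      using shD' by (intro compact_imp_closed compact_continuous_image continuous_on_subset[OF contf]) auto
    show "f ` shilov_boundary D \<subseteq> closure G" "f ` shilov_boundary D \<noteq> {}"
      using shD' fcl by auto
    fix h M w
    assume h: "h \<in> domain_algebra G" and M: "\<forall>z\<in>f ` shilov_boundary D. cmod (h z) \<le> M" and w: "w \<in> closure G"
    have hf: "(\<lambda>z. h (f z)) \<in> domain_algebra D"
      using h holomorphic_Cn_compose[OF _ f maps] continuous_on_compose2[OF _ contf fcl]
      by (auto simp: domain_algebra_def)
    have "cmod (h (f z)) \<le> M" if "z \<in> closure D" for z
      using max_modulus_setD[OF D(2,4) shD hf _ that] M by blast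
    \<comment> \<open>Surjectivity concerns the open set \<open>G\<close>; its frontier is reached
      by continuity of \<open>h\<close>.\<close>
    then have "\<forall>w\<in>G. cmod (h w) \<le> M"
      using image_eq closure_subset by blast
    moreover have "continuous_on (closure G) (\<lambda>w. cmod (h w))"
      using h by (auto simp: domain_algebra_def intro: continuous_on_norm)
    ultimately show "cmod (h w) \<le> M"
      using continuous_le_on_closure[of G "\<lambda>w. cmod (h w)" w M] w by blast
  qed
  then have sub1: "shilov_boundary G \<subseteq> f ` shilov_boundary D"
    by (rule shilov_boundary_least[OF G0(2,1)])

  define S where "S = {z\<in>closure D. f z \<in> shilov_boundary G}"
  \<comment> \<open>It suffices that every function of the algebra attains its maximum modulus at
    some point of \<open>S\<close>; this also makes \<open>S\<close> nonempty.\<close>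
  have peak: "\<exists>z\<in>S. \<forall>y\<in>closure D. cmod (h y) \<le> cmod (h z)" if h: "h \<in> domain_algebra D" for h
  proof -
    have hD: "holomorphic_Cn h D" and conth: "continuous_on (closure D) h"
      using h by (auto simp: domain_algebra_def)
    obtain a where a: "a \<in> closure D" "\<And>y. y \<in> closure D \<Longrightarrow> cmod (h y) \<le> cmod (h a)"
      using domain_algebra_attains[OF D(2) h closed_closure order_refl] D(4) by auto
    \<comment> \<open>The peak point will be a limit of these points: their moduli approach the
      maximum, and their images approach the Shilov boundaries of sets with indices tending to
      infinity.\<close>
    have step: "\<exists>z\<in>D. \<exists>m\<ge>n. \<exists>p\<in>shilov_boundary (Gm m). norm (f z - p) \<le> inverse (Suc n) \<and>
        cmod (h a) - inverse (Suc n) < cmod (h z)" for n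
    proof -
      have "\<exists>x\<in>D. cmod (h a) - inverse (Suc n) < cmod (h x)"
      proof (rule ccontr)
        assume "\<not> ?thesis"
        then have "\<forall>x\<in>D. cmod (h x) \<le> cmod (h a) - inverse (Suc n)"
          by (auto simp: not_less)
        then have "cmod (h a) \<le> cmod (h a) - inverse (Suc n)"
          using continuous_le_on_closure[of D "\<lambda>w. cmod (h w)" a] a(1) conth continuous_on_norm by blast
        moreover have "inverse (real (Suc n)) > 0" by simp
        ultimately show False by linarith
      qed
      then obtain x where x: "x \<in> D" "cmod (h a) - inverse (Suc n) < cmod (h x)" by blast
      then obtain k where "f x \<in> Gm k"
        using maps assms(9) by blast
      \<comment> \<open>At least \<open>k\<close>, so that \<open>f x\<close> is covered, and at
        least \<open>n\<close>, so that the indices tend to infinity.\<close>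
      then have fx: "f x \<in> Gm (max n k)"
        using mono[of k "max n k"] by auto
      obtain e where e: "e > 0" "(\<Union>w\<in>closure (Gm (max n k)). ball w e) \<subseteq> G"
        using compact_subset_open_imp_ball_epsilon_subset[OF clG(2) G(1) clG(1)] by blast
      \<comment> \<open>Half of \<open>e\<close> keeps the closed balls inside \<open>G\<close>; the
        other bound forces the distances to 0 as \<open>n\<close> grows.\<close>
      define \<epsilon> where "\<epsilon> = min (e / 2) (inverse (Suc n))"
      have \<epsilon>: "\<epsilon> > 0" "\<epsilon> < e" "\<epsilon> \<le> inverse (Suc n)"
        using e(1) by (auto simp: \<epsilon>_def)
      have "cball w \<epsilon> \<subseteq> G" if "w \<in> closure (Gm (max n k))" for w
      proof -
        have "cball w \<epsilon> \<subseteq> ball w e"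
          using \<epsilon>(2) by auto
        then show ?thesis
          using e(2) that by blast
      qed
      from exhaustion_estimate[OF Gm(3,2,1) \<epsilon>(1) this hD x(1) fx x(2)] \<epsilon>(3)
      show ?thesis
        by (meson max.cobounded1 order_trans)
    qed
    then obtain z m p where z: "\<And>n. z n \<in> D" and m: "\<And>n. m n \<ge> n"
      and p: "\<And>n. p n \<in> shilov_boundary (Gm (m n))" and near: "\<And>n. norm (f (z n) - p n) \<le> inverse (Suc n)"
      and large: "\<And>n. cmod (h a) - inverse (Suc n) < cmod (h (z n))"
      by metis
    have zcl: "z n \<in> closure D" for n
      using z closure_subset by blast
    then obtain l r where l: "l \<in> closure D" and r: "strict_mono r" and lim: "(z \<circ> r) \<longlonglongrightarrow> l"
      using compD unfolding compact_def by metis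
    have inv0: "(\<lambda>n. inverse (real (Suc (r n)))) \<longlonglongrightarrow> 0"
      using LIMSEQ_subseq_LIMSEQ[OF LIMSEQ_inverse_real_of_nat r] by (simp add: o_def)
    have limf: "(\<lambda>n. f (z (r n))) \<longlonglongrightarrow> f l" and limh: "(\<lambda>n. cmod (h (z (r n)))) \<longlonglongrightarrow> cmod (h l)"
      using continuous_on_tendsto_compose[OF contf lim l] continuous_on_tendsto_compose[OF conth lim l] zcl
      by (auto simp: o_def intro: tendsto_norm)
    have "(\<lambda>n. f (z (r n)) - p (r n)) \<longlonglongrightarrow> 0"
      by (rule Lim_null_comparison[OF always_eventually inv0]) (use near in blast)
    from tendsto_diff[OF limf this] have limp: "(\<lambda>n. p (r n)) \<longlonglongrightarrow> f l"
      by simp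
    have "p n \<in> (\<Union>m. shilov_boundary (Gm m))" for n
      using p[of n] by (rule UN_I[OF UNIV_I])
    then have "p (r n) \<in> closure (\<Union>m. shilov_boundary (Gm m))" for n
      by (rule subsetD[OF closure_subset])
    from closed_sequentially[OF closed_closure this limp]
    have "f l \<in> closure (\<Union>m. shilov_boundary (Gm m))" .
    \<comment> \<open>Otherwise the points \<open>p (r n)\<close> would eventually lie in a fixed
      \<open>Gm k\<close>, hence in the larger set \<open>Gm (m (r n))\<close>, which is disjoint
      from its own Shilov boundary.\<close>
    moreover have "f l \<notin> G"
    proof
      assume "f l \<in> G"
      then obtain k where "f l \<in> Gm k"
        using assms(9) by blast
      then have "\<forall>\<^sub>F n in sequentially. p (r n) \<in> Gm k"
        using limp Gm(1) topological_tendstoD by blast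
      then obtain n0 where n0: "\<And>n. n \<ge> n0 \<Longrightarrow> p (r n) \<in> Gm k"
        by (auto simp: eventually_sequentially)
      define n where "n = max n0 k"
      have "k \<le> m (r n)"
        using m[of "r n"] seq_suble[OF r, of n] by (simp add: n_def)
      then have "p (r n) \<in> Gm (m (r n))"
        using n0[of n] mono[of k "m (r n)"] by (auto simp: n_def)
      then show False
        using p[of "r n"] shGm by blast
    qed
    moreover have "f l \<in> closure G"
      using fcl l by blast
    ultimately have "f l \<in> closure (\<Union>m. shilov_boundary (Gm m)) \<inter> frontier G"
      using G(1) by (simp add: frontier_def interior_open)
    then have "l \<in> S"
      using l assms(10) by (simp add: S_def)
    moreover have "cmod (h a) \<le> cmod (h l)"
    proof (rule LIMSEQ_le[OF _ limh])
      show "(\<lambda>n. cmod (h a) - inverse (real (Suc (r n)))) \<longlonglongrightarrow> cmod (h a)"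
        using tendsto_diff[OF tendsto_const inv0, of "cmod (h a)"] by simp
      show "\<exists>N. \<forall>n\<ge>N. cmod (h a) - inverse (real (Suc (r n))) \<le> cmod (h (z (r n)))"
        using large less_imp_le by blast
    qed
    ultimately show ?thesis
      using a(2) order_trans by blast
  qed
  have "max_modulus_set D S"
    unfolding max_modulus_set_iff[OF D(2,4)]
  proof (intro conjI ballI allI impI)
    have "closed (shilov_boundary G)"
      using max_modulus_set_shilov[OF G0(2,1)] by (simp add: max_modulus_set_def)
    then have "closed (closure D \<inter> f -` shilov_boundary G)"
      by (intro continuous_closed_preimage[OF contf]) auto
    then show "closed S"
      by (simp add: S_def vimage_def Int_def)
    show "S \<subseteq> closure D"
      by (auto simp: S_def)
    show "S \<noteq> {}"
      using peak[OF domain_algebra_const] by blast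
    show "cmod (h y) \<le> M" if "h \<in> domain_algebra D" "\<forall>z\<in>S. cmod (h z) \<le> M" "y \<in> closure D" for h M y
      using peak[OF that(1)] that(2,3) order_trans by blast
  qed
  from shilov_boundary_least[OF D(2,4) this]
  have "f ` shilov_boundary D \<subseteq> shilov_boundary G"
    by (auto simp: S_def)
  with sub1 show ?thesis
    by blast
qed

end
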